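(* Let $d\in[1/4,1/2)$ and let $(X_n)_{n\in\mathbb{Z}}$ and $(Y_n)_{n\in\mathbb{Z}}$ be independent processes with the same stochastic structure, satisfying the model assumptions stated in the context with memory parameter $d$. Assume that the process is Gaussian, that $\sigma(j)\sim\lambda j^{2d-1}$ as $j\to\infty$ with $\lambda>0$, that $b_j\sim\delta j^{d-1}$ as $j\to\infty$ with $\delta>0$, and that $\mathbb{E}(\varepsilon_n^4)<+\infty$ for all $n$. Assume also that the spectral density $f$ of the process satisfies $$\forall x\in[-\pi,\pi],\quad f(x)=f_d(x)L(x),\qquad f_d(x)=2^{-2d-1}\pi^{-1}\big(\sin^2(x/2)\big)^{-d},$$ where $L$ is positive, integrable on $[-\pi,\pi]$, continuous at $0$ and bounded below by a positive constant. Let $\widehat{X_k}(1)=\sum_{j=1}^ka_{j,k}X_{k+1-j}$ and $\widehat{X_{T,k}}(1)=\sum_{j=1}^k\widehat{a_{j,k}}X_{k+1-j}$, where $(a_{j,k})$ and $(\widehat{a_{j,k}})$ are the true Yule–Walker coefficients and those estimated from $Y_1,\dots,Y_T$. If $d=1/4$, then $$\mathbb{E}\Big[\big(\widehat{X_{T,k}}(1)-\widehat{X_k}(1)\big)^2\Big]=\mathrm{O}\Big(\frac{\log(T)\sqrt k}{T}\Big),$$ and if $d\in(1/4,1/2)$, then $$\mathbb{E}\Big[\big(\widehat{X_{T,k}}(1)-\widehat{X_k}(1)\big)^2\Big]=\mathrm{O}\Big(\frac{k^{1-2d}}{T^{2-4d}}\Big).$$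
   Context: Asymptotics: the $\mathrm{O}$ is understood as $T\to+\infty$ and then $k\to+\infty$: there is a constant independent of $k$ and $T$ such that for every sufficiently large $k$ the bound holds with this constant for all $T\ge T_0(k)$. Model assumptions: the process is real, weakly stationary, in $L^2$, with mean $0$ and autocovariance function $\sigma$ with $\sum_{k\in\mathbb{Z}}|\sigma(k)|=\infty$. It has representations $X_n=\sum_{j\ge0}b_j\varepsilon_{n-j}$ with $(b_j)$ square-summable and $\varepsilon_n=\sum_{j\ge0}a_jX_{n-j}$ with $(a_j)$ absolutely summable ($a_0=b_0=1$), where $(\varepsilon_n)$ is a white noise of uncorrelated variables with mean $0$ and variance $\sigma_\varepsilon^2$. For every $\eta>0$ there are constants $C_1,C_2$ with $|a_j|\le C_1j^{-d-1+\eta}$, $|b_j|\le C_2j^{d-1+\eta}$ for all $j\ge1$. Yule–Walker coefficients: $(a_{i,k})_{1\le i\le k}$ solves $\sum_{i=1}^ka_{i,k}\sigma(i-j)=\sigma(j)$, $1\le j\le k$. The estimates $(\widehat{a_{i,k}})_{1\le i\le k}$ solve the same equations with each $\sigma(l)$ replaced by the empirical covariance $\widehat{\sigma(l)}=\frac1T\sum_{t=1}^{T-l}Y_tY_{t+l}$, $l\ge0$ (with $\widehat{\sigma(-l)}=\widehat{\sigma(l)}$). *)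

theory Defs
  imports "HOL-Probability.Probability"
begin

definition L2_sums :: "'a measure \<Rightarrow> (nat \<Rightarrow> 'a \<Rightarrow> real) \<Rightarrow> ('a \<Rightarrow> real) \<Rightarrow> bool" where
  "L2_sums M u Z \<longleftrightarrow>
     (\<lambda>N. integral\<^sup>L M (\<lambda>\<omega>. (Z \<omega> - (\<Sum>j<N. u j \<omega>))\<^sup>2)) \<longlonglongrightarrow> 0"

text \<open>\<open>s2\<close> is the variance of the white noise \<open>\<epsilon>\<close>.  The two series representations
  converge in mean square.\<close>

locale long_memory_process = prob_space M
  for M :: "'a measure"
    and X \<epsilon> :: "int \<Rightarrow> 'a \<Rightarrow> real"
    and \<sigma> :: "int \<Rightarrow> real"
    and a b :: "nat \<Rightarrow> real"
    and s2 d :: real +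
  assumes X_measurable: "\<And>n. X n \<in> borel_measurable M"
    and X_square_integrable: "\<And>n. integrable M (\<lambda>\<omega>. (X n \<omega>)\<^sup>2)"
    and X_mean: "\<And>n. expectation (X n) = 0"
    and X_autocovariance: "\<And>n h. expectation (\<lambda>\<omega>. X n \<omega> * X (n + h) \<omega>) = \<sigma> h"
    and autocovariance_not_summable: "\<not> (\<lambda>h. \<bar>\<sigma> h\<bar>) summable_on UNIV"
    and noise_measurable: "\<And>n. \<epsilon> n \<in> borel_measurable M"
    and noise_square_integrable: "\<And>n. integrable M (\<lambda>\<omega>. (\<epsilon> n \<omega>)\<^sup>2)"
    and noise_mean: "\<And>n. expectation (\<epsilon> n) = 0"
    and noise_covariance:
      "\<And>m n. expectation (\<lambda>\<omega>. \<epsilon> m \<omega> * \<epsilon> n \<omega>) = (if m = n then s2 else 0)"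
    and a_0: "a 0 = 1"
    and b_0: "b 0 = 1"
    and a_summable: "summable (\<lambda>j. \<bar>a j\<bar>)"
    and b_square_summable: "summable (\<lambda>j. (b j)\<^sup>2)"
    and moving_average: "\<And>n. L2_sums M (\<lambda>j \<omega>. b j * \<epsilon> (n - int j) \<omega>) (X n)"
    and autoregression: "\<And>n. L2_sums M (\<lambda>j \<omega>. a j * X (n - int j) \<omega>) (\<epsilon> n)"
    and coefficient_bounds:
      "\<And>\<eta>. \<eta> > 0 \<Longrightarrow> \<exists>C1 C2. \<forall>j\<ge>1.
          \<bar>a j\<bar> \<le> C1 * real j powr (- d - 1 + \<eta>) \<and> \<bar>b j\<bar> \<le> C2 * real j powr (d - 1 + \<eta>)"

text \<open>Degenerate (almost surely constant) variables count as Gaussian, as is needed for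
  arbitrary linear combinations.\<close>

definition gaussian_rv :: "'a measure \<Rightarrow> ('a \<Rightarrow> real) \<Rightarrow> bool" where
  "gaussian_rv M Z \<longleftrightarrow>
     (\<exists>\<mu> s. s > 0 \<and> distributed M lborel Z (\<lambda>x. ennreal (normal_density \<mu> s x))) \<or>
     (\<exists>\<mu>. Z \<in> borel_measurable M \<and> (AE \<omega> in M. Z \<omega> = \<mu>))"

definition gaussian_process :: "'a measure \<Rightarrow> ('i \<Rightarrow> 'a \<Rightarrow> real) \<Rightarrow> bool" where
  "gaussian_process M X \<longleftrightarrow>
     (\<forall>I c. finite I \<longrightarrow> gaussian_rv M (\<lambda>\<omega>. \<Sum>i\<in>I. c i * X i \<omega>))"

text \<open>The normalisation is \<open>\<sigma> h = \<integral> f x exp (\<i> h x) dx\<close> over \<open>[-\<pi>, \<pi>]\<close> without a factor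
  \<open>1 / (2 \<pi>)\<close>; for it, \<open>spectral_density_fd d x = \<bar>1 - exp (\<i> x)\<bar> powr (- 2 * d) / (2 \<pi>)\<close>
  below is the spectral density of fractionally integrated noise of unit variance.\<close>

definition spectral_density :: "(int \<Rightarrow> real) \<Rightarrow> (real \<Rightarrow> real) \<Rightarrow> bool" where
  "spectral_density \<sigma> f \<longleftrightarrow>
     (\<forall>x\<in>{-pi..pi}. 0 \<le> f x) \<and>
     set_integrable lebesgue {-pi..pi} f \<and>
     (\<forall>h. complex_of_real (\<sigma> h) =
        set_lebesgue_integral lebesgue {-pi..pi}
          (\<lambda>x. complex_of_real (f x) * exp (\<i> * of_int h * of_real x)))"

definition spectral_density_fd :: "real \<Rightarrow> real \<Rightarrow> real" where
  "spectral_density_fd d x = 2 powr (- 2 * d - 1) * inverse pi * ((sin (x / 2))\<^sup>2) powr (- d)"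

definition yule_walker :: "(int \<Rightarrow> real) \<Rightarrow> nat \<Rightarrow> (nat \<Rightarrow> real) \<Rightarrow> bool" where
  "yule_walker r k c \<longleftrightarrow>
     (\<forall>j\<in>{1..k}. (\<Sum>i=1..k. c i * r (int i - int j)) = r (int j))"

text \<open>For lags \<open>\<bar>h\<bar> \<ge> T\<close> the sum is empty.\<close>

definition empirical_covariance :: "(int \<Rightarrow> 'a \<Rightarrow> real) \<Rightarrow> nat \<Rightarrow> 'a \<Rightarrow> int \<Rightarrow> real" where
  "empirical_covariance Y T \<omega> h =
     1 / real T * (\<Sum>t=1..T - nat \<bar>h\<bar>. Y (int t) \<omega> * Y (int t + \<bar>h\<bar>) \<omega>)"

definition one_step_predictor :: "nat \<Rightarrow> (nat \<Rightarrow> real) \<Rightarrow> (int \<Rightarrow> 'a \<Rightarrow> real) \<Rightarrow> 'a \<Rightarrow> real" where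
  "one_step_predictor k c X \<omega> = (\<Sum>j=1..k. c j * X (int k + 1 - int j) \<omega>)"

text \<open>\<open>O\<close> as \<open>T \<rightarrow> \<infinity>\<close> and then \<open>k \<rightarrow> \<infinity>\<close>: one constant for all \<open>k\<close> and \<open>T\<close>, but the threshold for
  \<open>T\<close> may depend on \<open>k\<close>.\<close>

definition iterated_bigo :: "(nat \<Rightarrow> nat \<Rightarrow> real) \<Rightarrow> (nat \<Rightarrow> nat \<Rightarrow> real) \<Rightarrow> bool" where
  "iterated_bigo F G \<longleftrightarrow>
     (\<exists>C. \<forall>\<^sub>F k in sequentially. \<forall>\<^sub>F T in sequentially. \<bar>F T k\<bar> \<le> C * \<bar>G T k\<bar>)"

end

theory Submission
  imports Defs
begin

text \<open>The estimated coefficients depend on \<open>Y\<close> only, so the expected squared difference of the two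
  predictors is the expectation of \<open>Q(e)\<close>, where \<open>e\<close> is the error of the coefficients and \<open>Q\<close> is the quadratic
  form of the Toeplitz matrix of \<open>\<sigma>\<close> (lemma \<open>prediction_second_moment_independent_coefficients\<close>). Let \<open>\<rho> h\<close> be the
  error of the empirical covariance at lag \<open>h\<close>.

  The key fact is that in the range \<open>d \<ge> 1/4\<close> the errors at all lags are equal to leading order. Indeed \<open>\<rho> h - \<rho> 0\<close> is, up to
  boundary terms, an error of the empirical variance of the increments \<open>Y (t + h) - Y t\<close>, whose covariances are
  second differences of \<open>\<sigma>\<close> and so of smaller order; and the sum \<open>U T\<close> of the squared covariances at lags below \<open>T\<close>
  diverges. For a Gaussian process the mean square of \<open>\<rho> 0\<close> is at most \<open>4 * U T / T\<close>, and that of \<open>\<rho> h - \<rho> 0\<close> is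
  \<open>o(U T / T)\<close> for each \<open>h\<close> (lemma \<open>covariance_error_difference_smallo\<close>).

  In the Yule-Walker equations a common error \<open>\<rho> 0\<close> at all lags produces a constant right-hand side \<open>p * \<rho> 0\<close>,
  with \<open>p\<close> one minus the sum of the true coefficients. The response of the form \<open>Q\<close> to it is bounded through
  the inequality \<open>(\<Sum>w)\<^sup>2 \<le> C * k powr (1 - 2 * d) * Q(w)\<close>, a consequence of the singularity of the spectral density
  at the origin (lemma \<open>sum_squared_le_toeplitz_form\<close>). Moreover \<open>p\<close> is bounded in \<open>k\<close> (lemma
  \<open>sum_predictor_coefficients_bounded\<close>). Hence \<open>Q(e)\<close> is at most a constant times \<open>k powr (1 - 2 * d) * (\<rho> 0)\<^sup>2\<close>, plus terms
  that are negligible as \<open>T\<close> tends to infinity for fixed \<open>k\<close>. Finally \<open>U T / T\<close> is \<open>O(ln T / T)\<close> if \<open>d = 1/4\<close> and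
  \<open>O(T powr (4 * d - 2))\<close> otherwise.

  Two points need care. The empirical Toeplitz matrix may be nearly singular. On the event that the differences
  \<open>\<rho> h - \<rho> 0\<close> are small this cannot happen, because positive semidefiniteness of larger empirical matrices
  prevents \<open>\<rho> 0\<close> from being too negative (lemma \<open>yule_walker_perturbation\<close>). On the complement, whose probability
  is \<open>o(U T / T)\<close>, the estimated coefficients are still bounded by \<open>2 ^ k\<close>, as the Levinson-Durbin recursion shows
  (lemma \<open>yule_walker_measurable_bounded_solution\<close>). The same recursion shows that the estimates are almost surely measurable functions of the
  path of \<open>Y\<close>, so that independence applies.\<close>

section \<open>Toeplitz forms and the Yule-Walker equations\<close>

definition toeplitz_form :: "(int \<Rightarrow> real) \<Rightarrow> nat set \<Rightarrow> (nat \<Rightarrow> real) \<Rightarrow> real" where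
  "toeplitz_form r I w = (\<Sum>i\<in>I. \<Sum>j\<in>I. w i * w j * r (int i - int j))"

definition positive_definite :: "(int \<Rightarrow> real) \<Rightarrow> bool" where
  "positive_definite r \<longleftrightarrow> (\<forall>h. r (- h) = r h) \<and>
     (\<forall>I w. finite I \<longrightarrow> (\<exists>i\<in>I. w i \<noteq> 0) \<longrightarrow> toeplitz_form r I w > 0)"

lemma positive_definiteD:
  assumes "positive_definite r" "finite I" "i \<in> I" "w i \<noteq> 0"
  shows "0 < toeplitz_form r I w"
  using assms unfolding positive_definite_def by blast

text \<open>The inner sums are the left-hand sides of the Yule-Walker equations, so this is how those
  equations enter quadratic forms.\<close>

lemma toeplitz_form_rows:
  "toeplitz_form r I w = (\<Sum>j\<in>I. w j * (\<Sum>i\<in>I. w i * r (int i - int j)))"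
  unfolding toeplitz_form_def
  by (subst sum.swap) (simp add: sum_distrib_left mult_ac)

lemma yule_walker_unique:
  assumes "positive_definite r" "yule_walker r k c" "yule_walker r k c'" "i \<in> {1..k}"
  shows "c i = c' i"
proof (rule ccontr)
  assume "c i \<noteq> c' i"
  then have "toeplitz_form r {1..k} (\<lambda>i. c i - c' i) > 0"
    using assms(1,4) by (intro positive_definiteD) auto
  moreover have "(\<Sum>i=1..k. (c i - c' i) * r (int i - int j)) = 0" if "j \<in> {1..k}" for j
    using assms(2,3) that by (simp add: yule_walker_def left_diff_distrib sum_subtractf)
  ultimately show False by (simp add: toeplitz_form_rows)
qed

lemma sum_reflect: "(\<Sum>i=1..m. g (Suc m - i)) = (\<Sum>i=1..m. (g i :: real))"
  by (rule sum.reindex_bij_witness[of _ "\<lambda>i. Suc m - i" "\<lambda>i. Suc m - i"]) auto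

text \<open>The quadratic form at the prediction-error filter \<open>(1, - \<phi> 1, \<dots>, - \<phi> m)\<close> is the prediction
  error variance: by the Yule-Walker equations all rows but the first vanish.\<close>

lemma prediction_error_eq_toeplitz_form:
  assumes sym: "\<And>h. r (- h) = r h" and yw: "yule_walker r m \<phi>"
  shows "toeplitz_form r {0..m} (\<lambda>i. if i = 0 then 1 else - \<phi> i) = r 0 - (\<Sum>i=1..m. \<phi> i * r (int i))"
proof -
  let ?c = "\<lambda>i. if i = 0 then 1 else - \<phi> i"
  have row: "(\<Sum>i=0..m. ?c i * r (int i - int j)) = r (int j) - (\<Sum>i=1..m. \<phi> i * r (int i - int j))" for j
    by (simp add: sum.atLeast_Suc_atMost sum_negf sym[of "int j", simplified])
  have "toeplitz_form r {0..m} ?c = (\<Sum>j=0..m. ?c j * (r (int j) - (\<Sum>i=1..m. \<phi> i * r (int i - int j))))"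
    by (simp only: toeplitz_form_rows row)
  also have "\<dots> = r 0 - (\<Sum>i=1..m. \<phi> i * r (int i))"
    using yw unfolding yule_walker_def by (simp add: sum.atLeast_Suc_atMost[of 0])
  finally show ?thesis .
qed

text \<open>The Levinson-Durbin recursion: a solution of order \<open>m\<close> is corrected by a multiple of its own
  reversal, because the reversed vector solves the reversed Toeplitz system. The factor \<open>\<kappa>\<close> is the partial
  autocorrelation, and it governs the decrease of the prediction error variance \<open>v\<close>.\<close>

lemma levinson_durbin_step:
  fixes r :: "int \<Rightarrow> real" and m :: nat and \<phi> :: "nat \<Rightarrow> real"
  assumes sym: "\<And>h. r (- h) = r h" and yw: "yule_walker r m \<phi>"
  defines "v \<equiv> r 0 - (\<Sum>i=1..m. \<phi> i * r (int i))"
  defines "\<kappa> \<equiv> (r (int (Suc m)) - (\<Sum>i=1..m. \<phi> i * r (int (Suc m) - int i))) / v"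
  defines "\<phi>' \<equiv> (\<lambda>i. if i = Suc m then \<kappa> else \<phi> i - \<kappa> * \<phi> (Suc m - i))"
  assumes v: "v \<noteq> 0"
  shows "yule_walker r (Suc m) \<phi>'"
    and "r 0 - (\<Sum>i=1..Suc m. \<phi>' i * r (int i)) = v * (1 - \<kappa>\<^sup>2)"
proof -
  have kv: "\<kappa> * v = r (int (Suc m)) - (\<Sum>i=1..m. \<phi> i * r (int (Suc m) - int i))"
    using v by (simp add: \<kappa>_def)
  have row: "(\<Sum>i=1..Suc m. \<phi>' i * r (int i - int j))
      = (\<Sum>i=1..m. \<phi> i * r (int i - int j))
        - \<kappa> * (\<Sum>i=1..m. \<phi> i * r (int (Suc m) - int i - int j)) + \<kappa> * r (int (Suc m) - int j)" for j
  proof -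
    have "(\<Sum>i=1..m. \<phi> (Suc m - i) * r (int i - int j))
        = (\<Sum>i=1..m. \<phi> i * r (int (Suc m) - int i - int j))"
      using sum_reflect[of "\<lambda>i. \<phi> i * r (int (Suc m) - int i - int j)" m]
      by (auto intro!: sum.cong simp: of_nat_diff)
    moreover have "(\<Sum>i=1..m. \<phi>' i * r (int i - int j))
        = (\<Sum>i=1..m. \<phi> i * r (int i - int j)) - \<kappa> * (\<Sum>i=1..m. \<phi> (Suc m - i) * r (int i - int j))"
      by (simp add: \<phi>'_def left_diff_distrib sum_subtractf sum_distrib_left mult.assoc)
    ultimately show ?thesis by (simp add: \<phi>'_def)
  qed
  have flip: "r (int (Suc m) - int i - int j) = r (int i - (int (Suc m) - int j))" for i j
    using sym[of "int (Suc m) - int i - int j"] by (simp add: algebra_simps)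
  show "yule_walker r (Suc m) \<phi>'"
    unfolding yule_walker_def
  proof
    fix j assume j: "j \<in> {1..Suc m}"
    show "(\<Sum>i=1..Suc m. \<phi>' i * r (int i - int j)) = r (int j)"
    proof (cases "j = Suc m")
      case True
      have "(\<Sum>i=1..m. \<phi> i * r (int i - int j)) = (\<Sum>i=1..m. \<phi> i * r (int (Suc m) - int i))"
        using True sym[of "int _ - int (Suc m)"] by (intro sum.cong) (auto simp: algebra_simps)
      moreover have "(\<Sum>i=1..m. \<phi> i * r (int (Suc m) - int i - int j)) = (\<Sum>i=1..m. \<phi> i * r (int i))"
        using True sym by (intro sum.cong) auto
      ultimately show ?thesis
        using kv True unfolding row v_def by (simp add: algebra_simps)
    next
      case False
      with j have j: "j \<in> {1..m}" "Suc m - j \<in> {1..m}" "int (Suc m - j) = int (Suc m) - int j" by auto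
      have "(\<Sum>i=1..m. \<phi> i * r (int (Suc m) - int i - int j)) = r (int (Suc m) - int j)"
        using yw j unfolding yule_walker_def flip by metis
      then show ?thesis using yw j unfolding row yule_walker_def by simp
    qed
  qed
  have "(\<Sum>i=1..Suc m. \<phi>' i * r (int i))
      = (\<Sum>i=1..m. \<phi> i * r (int i)) + \<kappa> * (\<kappa> * v)"
    using row[of 0] unfolding kv by (simp del: sum.cl_ivl_Suc add: algebra_simps)
  then show "r 0 - (\<Sum>i=1..Suc m. \<phi>' i * r (int i)) = v * (1 - \<kappa>\<^sup>2)"
    by (simp only: v_def[symmetric]) (simp add: v_def algebra_simps power2_eq_square)
qed

text \<open>The recursion serves two purposes at once. Its steps are rational in the covariances, so
  solutions depend measurably on the data; and positivity of the two successive error variances \<open>v\<close> and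
  \<open>v * (1 - \<kappa>\<^sup>2)\<close> forces \<open>\<bar>\<kappa>\<bar> \<le> 1\<close>, so each step at most doubles the largest coefficient. The
  resulting bound holds for every sample, however close to singular its covariance matrix is.\<close>

lemma yule_walker_measurable_bounded_solution:
  fixes r :: "'b \<Rightarrow> int \<Rightarrow> real"
  assumes meas: "\<And>h. (\<lambda>y. r y h) \<in> borel_measurable N"
    and pd: "\<And>y. y \<in> A \<Longrightarrow> positive_definite (r y)"
  shows "\<exists>\<phi>. (\<forall>i. \<phi> i \<in> borel_measurable N) \<and>
    (\<forall>y\<in>A. yule_walker (r y) k (\<lambda>i. \<phi> i y) \<and> (\<forall>i\<in>{1..k}. \<bar>\<phi> i y\<bar> \<le> 2 ^ k))"
proof (induction k)
  case 0
  show ?case by (intro exI[of _ "\<lambda>i y. 0"]) (auto simp: yule_walker_def)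
next
  case (Suc m)
  then obtain \<phi> where \<phi>: "\<And>i. \<phi> i \<in> borel_measurable N"
    "\<And>y. y \<in> A \<Longrightarrow> yule_walker (r y) m (\<lambda>i. \<phi> i y)"
    "\<And>y i. y \<in> A \<Longrightarrow> i \<in> {1..m} \<Longrightarrow> \<bar>\<phi> i y\<bar> \<le> 2 ^ m" by blast
  define v where "v = (\<lambda>y. r y 0 - (\<Sum>i=1..m. \<phi> i y * r y (int i)))"
  define \<kappa> where "\<kappa> = (\<lambda>y. (r y (int (Suc m)) - (\<Sum>i=1..m. \<phi> i y * r y (int (Suc m) - int i))) / v y)"
  define \<phi>' where "\<phi>' = (\<lambda>i y. if i = Suc m then \<kappa> y else \<phi> i y - \<kappa> y * \<phi> (Suc m - i) y)"
  have mv: "v \<in> borel_measurable N" "\<kappa> \<in> borel_measurable N"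
    unfolding v_def \<kappa>_def using meas \<phi>(1) by measurable
  have m': "\<phi>' i \<in> borel_measurable N" for i
    unfolding \<phi>'_def using \<phi>(1) mv by (cases "i = Suc m") auto
  have "yule_walker (r y) (Suc m) (\<lambda>i. \<phi>' i y) \<and> (\<forall>i\<in>{1..Suc m}. \<bar>\<phi>' i y\<bar> \<le> 2 ^ Suc m)" if y: "y \<in> A" for y
  proof -
    have sym: "r y (- h) = r y h" for h using pd[OF y] by (simp add: positive_definite_def)
    have pos: "0 < r y 0 - (\<Sum>i=1..n. \<psi> i * r y (int i))" if "yule_walker (r y) n \<psi>" for n \<psi>
    proof -
      have "0 < toeplitz_form (r y) {0..n} (\<lambda>i. if i = 0 then 1 else - \<psi> i)"
        using pd[OF y] by (rule positive_definiteD[where i = 0]) auto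
      then show ?thesis by (simp add: prediction_error_eq_toeplitz_form[OF sym that])
    qed
    have v: "v y > 0" using pos[OF \<phi>(2)[OF y]] by (simp add: v_def)
    have yw': "yule_walker (r y) (Suc m) (\<lambda>i. \<phi>' i y)"
      using levinson_durbin_step(1)[OF sym \<phi>(2)[OF y]] v unfolding \<phi>'_def \<kappa>_def v_def by simp
    have "r y 0 - (\<Sum>i=1..Suc m. \<phi>' i y * r y (int i)) = v y * (1 - (\<kappa> y)\<^sup>2)"
      using levinson_durbin_step(2)[OF sym \<phi>(2)[OF y]] v unfolding \<phi>'_def \<kappa>_def v_def by simp
    then have "0 < v y * (1 - (\<kappa> y)\<^sup>2)" using pos[OF yw'] by simp
    then have "(\<kappa> y)\<^sup>2 \<le> 1" using v by (simp add: zero_less_mult_iff)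
    then have k1: "\<bar>\<kappa> y\<bar> \<le> 1" by (simp add: abs_square_le_1)
    have "\<bar>\<phi>' i y\<bar> \<le> 2 ^ Suc m" if i: "i \<in> {1..Suc m}" for i
    proof (cases "i = Suc m")
      case True
      have "\<bar>\<kappa> y\<bar> \<le> 2 ^ Suc m" using k1 one_le_power[of "2::real" "Suc m"] by linarith
      then show ?thesis using True by (simp add: \<phi>'_def)
    next
      case False
      then have "\<bar>\<phi> i y\<bar> \<le> 2 ^ m" "\<bar>\<phi> (Suc m - i) y\<bar> \<le> 2 ^ m" using i y by (auto intro!: \<phi>(3))
      moreover have "\<bar>\<kappa> y * \<phi> (Suc m - i) y\<bar> \<le> 1 * 2 ^ m"
        unfolding abs_mult using k1 calculation by (intro mult_mono) auto
      ultimately show ?thesis using False by (simp add: \<phi>'_def)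
    qed
    with yw' show ?thesis by blast
  qed
  with m' show ?case by (intro exI[of _ \<phi>']) auto
qed

section \<open>Empirical covariances\<close>

lemma empirical_covariance_zero_padded:
  assumes "h \<ge> 0"
  shows "(\<Sum>t=1..T - nat h. Y (int t) * Y (int t + h))
    = (\<Sum>t\<in>{1..int T}. (if t \<in> {1..int T} then Y t else 0) * (if t + h \<in> {1..int T} then Y (t + h) else (0::real)))"
proof -
  have "(\<Sum>t\<in>{1..int T}. (if t \<in> {1..int T} then Y t else 0) * (if t + h \<in> {1..int T} then Y (t + h) else 0))
     = (\<Sum>t\<in>{t\<in>{1..int T}. t + h \<le> int T}. Y t * Y (t + h))"
    using assms by (intro sum.mono_neutral_cong_right) auto
  also have "\<dots> = (\<Sum>t=1..T - nat h. Y (int t) * Y (int t + h))"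
    using assms by (intro sum.reindex_bij_witness[of _ int nat]) auto
  finally show ?thesis by simp
qed

lemma empirical_covariance_sym: "empirical_covariance Y T \<omega> (- h) = empirical_covariance Y T \<omega> h"
  by (simp add: empirical_covariance_def)

text \<open>Dividing by \<open>T\<close> at every lag, instead of by the number of summands, makes the empirical
  covariances the correlations of the sample padded by zeros. Their quadratic form is then a sum of squares
  of a convolution.\<close>

lemma empirical_toeplitz_form:
  fixes Y :: "int \<Rightarrow> 'a \<Rightarrow> real" and T :: nat and \<omega> :: 'a
  assumes I: "finite I" "I \<subseteq> {..K}"
  defines "y \<equiv> (\<lambda>t. if t \<in> {1..int T} then Y t \<omega> else 0)"
  shows "toeplitz_form (empirical_covariance Y T \<omega>) I w
    = 1 / real T * (\<Sum>s\<in>{1 - int K..int T}. (\<Sum>i\<in>I. w i * y (s + int i))\<^sup>2)"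
proof -
  define S where "S = {1 - int K..int T}"
  have le: "(\<Sum>s\<in>S. y (s + int i) * y (s + int j)) = real T * empirical_covariance Y T \<omega> (int i - int j)"
    if ij: "i \<in> I" "j \<in> I" "i \<le> j" for i j
  proof -
    have "(\<Sum>s\<in>S. y (s + int i) * y (s + int j)) = (\<Sum>s\<in>{1 - int i..int T - int i}. y (s + int i) * y (s + int j))"
      using I ij unfolding S_def by (intro sum.mono_neutral_right) (auto simp: y_def)
    also have "\<dots> = (\<Sum>t\<in>{1..int T}. y t * y (t + int (j - i)))"
      by (rule sum.reindex_bij_witness[of _ "\<lambda>t. t - int i" "\<lambda>s. s + int i"])
        (use ij in \<open>auto simp: of_nat_diff algebra_simps\<close>)
    also have "\<dots> = (\<Sum>t=1..T - (j - i). Y (int t) \<omega> * Y (int t + int (j - i)) \<omega>)"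
      using empirical_covariance_zero_padded[of "int (j - i)" "\<lambda>t. Y t \<omega>" T] by (simp add: y_def)
    also have "\<dots> = real T * empirical_covariance Y T \<omega> (int i - int j)"
    proof -
      have "\<bar>int i - int j\<bar> = int (j - i)" using ij by auto
      then show ?thesis unfolding empirical_covariance_def by (cases "T = 0") (simp_all only: nat_int, simp_all)
    qed
    finally show ?thesis .
  qed
  have all: "(\<Sum>s\<in>S. y (s + int i) * y (s + int j)) = real T * empirical_covariance Y T \<omega> (int i - int j)"
    if ij: "i \<in> I" "j \<in> I" for i j
  proof (cases "i \<le> j")
    case False
    then have "(\<Sum>s\<in>S. y (s + int j) * y (s + int i)) = real T * empirical_covariance Y T \<omega> (int j - int i)"
      using le ij by auto
    then show ?thesis using empirical_covariance_sym[of Y T \<omega> "int i - int j"] by (simp add: mult.commute)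
  qed (use le ij in auto)
  have "(\<Sum>s\<in>S. (\<Sum>i\<in>I. w i * y (s + int i))\<^sup>2)
      = (\<Sum>s\<in>S. \<Sum>i\<in>I. \<Sum>j\<in>I. w i * w j * (y (s + int i) * y (s + int j)))"
    by (simp add: power2_eq_square sum_product mult_ac)
  also have "\<dots> = (\<Sum>i\<in>I. \<Sum>j\<in>I. w i * w j * (\<Sum>s\<in>S. y (s + int i) * y (s + int j)))"
    by (subst sum.swap, rule sum.cong[OF refl], subst sum.swap) (simp add: sum_distrib_left)
  also have "\<dots> = (\<Sum>i\<in>I. \<Sum>j\<in>I. w i * w j * (real T * empirical_covariance Y T \<omega> (int i - int j)))"
    using all by (intro sum.cong refl) simp
  also have "\<dots> = real T * toeplitz_form (empirical_covariance Y T \<omega>) I w"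
    by (simp add: toeplitz_form_def sum_distrib_left mult_ac)
  finally show ?thesis
    unfolding S_def by (cases "T = 0") (simp_all add: toeplitz_form_def empirical_covariance_def)
qed

lemma empirical_toeplitz_form_nonneg:
  assumes "finite I"
  shows "0 \<le> toeplitz_form (empirical_covariance Y T \<omega>) I w"
proof -
  have "I \<subseteq> {..Max (insert 0 I)}" using assms by auto
  then show ?thesis
    by (subst empirical_toeplitz_form[OF assms]) (auto intro!: sum_nonneg divide_nonneg_nonneg)
qed

text \<open>A convolution of two nonzero finitely supported sequences is nonzero: the product of the
  first nonzero sample value, here \<open>Y 1 \<omega>\<close>, with the last nonzero weight appears alone.\<close>

lemma empirical_covariance_positive_definite:
  assumes T: "T \<ge> 1" and Y: "Y 1 \<omega> \<noteq> 0"
  shows "positive_definite (empirical_covariance Y T \<omega>)"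
  unfolding positive_definite_def
proof (intro conjI allI impI empirical_covariance_sym)
  fix I and w :: "nat \<Rightarrow> real"
  assume I: "finite I" and w: "\<exists>i\<in>I. w i \<noteq> 0"
  define J where "J = {i\<in>I. w i \<noteq> 0}"
  have J: "finite J" "J \<noteq> {}" using I w by (auto simp: J_def)
  define i0 where "i0 = Max J"
  have i0: "i0 \<in> I" "w i0 \<noteq> 0" "\<And>i. i \<in> I \<Longrightarrow> w i \<noteq> 0 \<Longrightarrow> i \<le> i0"
    using Max_in[OF J] Max_ge[OF J(1)] by (auto simp: i0_def J_def)
  define K where "K = Max (insert 0 I)"
  have K: "I \<subseteq> {..K}" using I by (auto simp: K_def)
  define y where "y = (\<lambda>t. if t \<in> {1..int T} then Y t \<omega> else 0)"
  let ?s = "1 - int i0"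
  have "(\<Sum>i\<in>I. w i * y (?s + int i)) = (\<Sum>i\<in>{i0}. w i * y (?s + int i))"
  proof (rule sum.mono_neutral_right)
    show "\<forall>i\<in>I - {i0}. w i * y (?s + int i) = 0"
    proof
      fix i assume i: "i \<in> I - {i0}"
      show "w i * y (?s + int i) = 0"
      proof (cases "w i = 0")
        case False
        then have "?s + int i < 1" using i i0(3)[of i] by auto
        then show ?thesis by (simp add: y_def)
      qed simp
    qed
  qed (use I i0 in auto)
  then have "0 < (\<Sum>i\<in>I. w i * y (?s + int i))\<^sup>2"
    using i0 T Y by (simp add: y_def)
  moreover have "?s \<in> {1 - int K..int T}" using i0 K T by auto
  ultimately have "0 < (\<Sum>s\<in>{1 - int K..int T}. (\<Sum>i\<in>I. w i * y (s + int i))\<^sup>2)"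
    by (intro sum_pos2[of _ ?s]) auto
  then show "0 < toeplitz_form (empirical_covariance Y T \<omega>) I w"
    using empirical_toeplitz_form[OF I K, of Y T \<omega> w] T unfolding y_def by simp
qed

section \<open>Spectral bounds for Toeplitz forms\<close>

definition trig_poly :: "nat set \<Rightarrow> (nat \<Rightarrow> real) \<Rightarrow> real \<Rightarrow> complex" where
  "trig_poly I w x = (\<Sum>j\<in>I. of_real (w j) * cis (real j * x))"

lemma exp_frequency_eq_cis: "exp (\<i> * of_int h * of_real x) = cis (of_int h * x)"
  by (simp add: cis_conv_exp mult_ac)

lemma norm_trig_poly_squared:
  "complex_of_real ((cmod (trig_poly I w x))\<^sup>2)
    = (\<Sum>i\<in>I. \<Sum>j\<in>I. of_real (w i * w j) * cis (of_int (int i - int j) * x))"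
proof -
  have "complex_of_real ((cmod (trig_poly I w x))\<^sup>2) = trig_poly I w x * cnj (trig_poly I w x)"
    by (rule complex_norm_square)
  also have "\<dots> = (\<Sum>i\<in>I. \<Sum>j\<in>I. of_real (w i * w j) * (cis (real i * x) * cis (- (real j * x))))"
    by (simp add: trig_poly_def sum_product cis_cnj mult_ac)
  finally show ?thesis by (simp add: cis_mult algebra_simps)
qed

lemma continuous_on_trig_poly: "continuous_on S (trig_poly I w)"
  unfolding trig_poly_def by (intro continuous_intros)

lemma norm_trig_poly_le: "cmod (trig_poly I w x) \<le> (\<Sum>j\<in>I. \<bar>w j\<bar>)"
  unfolding trig_poly_def by (rule sum_norm_le) (simp add: norm_mult)

lemma integrable_circle_continuous:
  fixes g :: "real \<Rightarrow> 'b::euclidean_space"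
  assumes "continuous_on {-pi..pi} g"
  shows "set_integrable lebesgue {-pi..pi} g"
  using assms by (intro continuous_imp_integrable absolutely_integrable_continuous_real) auto

text \<open>For integrands against the spectral density, which may be unbounded at the origin.\<close>

lemma set_integrable_mult_continuous:
  fixes f :: "real \<Rightarrow> real" and g :: "real \<Rightarrow> 'b::{euclidean_space,real_normed_div_algebra}"
  assumes f: "set_integrable lebesgue {-pi..pi} f" and g: "continuous_on UNIV g"
  shows "set_integrable lebesgue {-pi..pi} (\<lambda>x. of_real (f x) * g x)"
proof -
  have "compact (g ` {-pi..pi})"
    using g continuous_on_subset by (intro compact_continuous_image) auto
  then have "bounded (g ` {-pi..pi})" by (rule compact_imp_bounded)
  then obtain B where "\<forall>y\<in>g ` {-pi..pi}. norm y \<le> B"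
    unfolding bounded_iff by blast
  then have B: "\<And>x. x \<in> {-pi..pi} \<Longrightarrow> norm (g x) \<le> B"
    by blast
  have fm: "(\<lambda>x. indicator {-pi..pi} x *\<^sub>R f x) \<in> borel_measurable lebesgue"
    using f unfolding set_integrable_def by auto
  have gm: "g \<in> borel_measurable lebesgue"
    using borel_measurable_continuous_onI[OF g] by (simp add: measurable_completion)
  have "(\<lambda>x. of_real (indicator {-pi..pi} x *\<^sub>R f x) * g x) \<in> borel_measurable lebesgue"
    using fm gm by measurable
  also have "(\<lambda>x. of_real (indicator {-pi..pi} x *\<^sub>R f x) * g x) = (\<lambda>x. indicator {-pi..pi} x *\<^sub>R (of_real (f x) * g x))"
    by (auto simp: indicator_def)
  finally have m: "(\<lambda>x. indicator {-pi..pi} x *\<^sub>R (of_real (f x) * g x)) \<in> borel_measurable lebesgue" .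
  show ?thesis
    unfolding set_integrable_def
  proof (rule Bochner_Integration.integrable_bound[OF _ m])
    show "integrable lebesgue (\<lambda>x. B *\<^sub>R (indicator {-pi..pi} x *\<^sub>R f x))"
      using f unfolding set_integrable_def by simp
    have "norm (of_real (f x) * g x) \<le> \<bar>B\<bar> * \<bar>f x\<bar>" if "x \<in> {-pi..pi}" for x
      using mult_left_mono[of "norm (g x)" "\<bar>B\<bar>" "\<bar>f x\<bar>"] B[OF that] by (simp add: norm_mult mult.commute)
    then show "AE x in lebesgue. norm (indicator {-pi..pi} x *\<^sub>R (of_real (f x) * g x))
        \<le> norm (B *\<^sub>R (indicator {-pi..pi} x *\<^sub>R f x))"
      by (intro AE_I2) (auto simp: indicator_def abs_mult)
  qed
qed

lemma set_integral_sum: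
  fixes f :: "'i \<Rightarrow> 'b \<Rightarrow> 'c::{banach, second_countable_topology}"
  assumes "\<And>i. i \<in> I \<Longrightarrow> set_integrable M A (f i)"
  shows "(LINT x:A|M. \<Sum>i\<in>I. f i x) = (\<Sum>i\<in>I. LINT x:A|M. f i x)"
    and "set_integrable M A (\<lambda>x. \<Sum>i\<in>I. f i x)"
  using assms unfolding set_lebesgue_integral_def set_integrable_def
  by (simp_all add: scaleR_sum_right)

text \<open>The quadratic form of the covariances is the squared norm of the associated trigonometric
  polynomial in \<open>L\<^sup>2(f)\<close>. Lower bounds on \<open>f\<close> become lower bounds on the form.\<close>

lemma toeplitz_form_spectral:
  assumes "spectral_density \<sigma> f" "finite I"
  shows "toeplitz_form \<sigma> I w = (LINT x:{-pi..pi}|lebesgue. f x * (cmod (trig_poly I w x))\<^sup>2)"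
proof -
  have fi: "set_integrable lebesgue {-pi..pi} f" using assms by (simp add: spectral_density_def)
  have ci: "set_integrable lebesgue {-pi..pi} (\<lambda>x. complex_of_real (f x) * cis (of_int h * x))" for h
    by (intro set_integrable_mult_continuous fi continuous_intros)
  have sig: "complex_of_real (\<sigma> h) = (LINT x:{-pi..pi}|lebesgue. complex_of_real (f x) * cis (of_int h * x))" for h
    using assms unfolding spectral_density_def exp_frequency_eq_cis by blast
  have "complex_of_real (toeplitz_form \<sigma> I w)
      = (\<Sum>i\<in>I. \<Sum>j\<in>I. of_real (w i * w j) * (LINT x:{-pi..pi}|lebesgue. complex_of_real (f x) * cis (of_int (int i - int j) * x)))"
    unfolding toeplitz_form_def sig[symmetric] by simp
  also have "\<dots> = (LINT x:{-pi..pi}|lebesgue. \<Sum>i\<in>I. \<Sum>j\<in>I. of_real (w i * w j) * (complex_of_real (f x) * cis (of_int (int i - int j) * x)))"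
    using ci[of "int _ - int _", simplified] assms(2)
    by (simp add: set_integral_sum set_integral_mult_right set_integrable_mult_right del: of_real_mult)
  also have "\<dots> = (LINT x:{-pi..pi}|lebesgue. complex_of_real (f x * (cmod (trig_poly I w x))\<^sup>2))"
    unfolding of_real_mult[of "f _"] norm_trig_poly_squared
    by (simp add: sum_distrib_left mult_ac)
  also have "\<dots> = complex_of_real (LINT x:{-pi..pi}|lebesgue. f x * (cmod (trig_poly I w x))\<^sup>2)"
    by (rule set_integral_complex_of_real)
  finally show ?thesis using of_real_eq_iff by blast
qed

lemma integral_cis_frequency:
  "(LINT x:{-pi..pi}|lebesgue. cis (of_int n * x)) = (if n = 0 then 2 * pi else 0)"
proof -
  have "((\<lambda>x. cis (of_int n * x)) has_integral (if n = 0 then of_real (2 * pi) else 0)) {-pi..pi}"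
  proof (cases "n = 0")
    case True
    then show ?thesis using has_integral_const_real[of "1::complex" "-pi" pi] by (simp add: scaleR_conv_of_real)
  next
    case False
    have "((\<lambda>x. cis (of_int n * x)) has_integral
       (cis (of_int n * pi) / (\<i> * of_int n) - cis (of_int n * (- pi)) / (\<i> * of_int n))) {-pi..pi}"
    proof (rule fundamental_theorem_of_calculus)
      fix x assume "x \<in> {-pi..pi}"
      show "((\<lambda>x. cis (of_int n * x) / (\<i> * of_int n)) has_vector_derivative cis (of_int n * x)) (at x within {-pi..pi})"
        using False unfolding cis_conv_exp
        by (auto intro!: derivative_eq_intros has_vector_derivative_real_field
            simp: field_simps)
    qed simp
    moreover have "cis (of_int n * pi) = cis (of_int n * (- pi))"
    proof -
      have "sin (of_int n * pi) = 0" by (subst sin_zero_iff_int2) auto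
      then show ?thesis by (simp add: complex_eq_iff)
    qed
    ultimately show ?thesis using False by simp
  qed
  moreover have "set_integrable lebesgue {-pi..pi} (\<lambda>x. cis (of_int n * x))"
    by (intro integrable_circle_continuous continuous_intros)
  ultimately show ?thesis
    by (auto simp: set_lebesgue_integral_eq_integral(2) integral_unique)
qed

lemma trig_poly_parseval:
  assumes "finite I"
  shows "(LINT x:{-pi..pi}|lebesgue. (cmod (trig_poly I w x))\<^sup>2) = 2 * pi * (\<Sum>i\<in>I. (w i)\<^sup>2)"
    and "(LINT x:{-pi..pi}|lebesgue. trig_poly I w x * cnj (trig_poly I (\<lambda>_. 1) x)) = of_real (2 * pi * (\<Sum>i\<in>I. w i))"
proof -
  have ci: "set_integrable lebesgue {-pi..pi} (\<lambda>x. cis (of_int h * x))" for h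
    by (intro integrable_circle_continuous continuous_intros)
  have diag: "(\<Sum>j\<in>I. c * (if i = j then u else 0)) = (c * u :: complex)" if "i \<in> I" for i c u
    using that assms by (simp add: sum.delta' if_distrib cong: if_cong)
  have "complex_of_real (LINT x:{-pi..pi}|lebesgue. (cmod (trig_poly I w x))\<^sup>2)
     = (LINT x:{-pi..pi}|lebesgue. complex_of_real ((cmod (trig_poly I w x))\<^sup>2))"
    by (rule set_integral_complex_of_real[symmetric])
  also have "\<dots> = (\<Sum>i\<in>I. \<Sum>j\<in>I. of_real (w i * w j) * complex_of_real (if int i - int j = 0 then 2 * pi else 0))"
    unfolding norm_trig_poly_squared using ci assms
    by (simp add: set_integral_sum set_integral_mult_right set_integrable_mult_right integral_cis_frequency del: of_real_mult of_int_diff)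
  also have "\<dots> = (\<Sum>i\<in>I. \<Sum>j\<in>I. if i = j then of_real (w i * w i * (2 * pi)) else 0)"
    by (intro sum.cong refl) auto
  also have "\<dots> = of_real (2 * pi * (\<Sum>i\<in>I. (w i)\<^sup>2))"
    using assms by (simp add: sum_distrib_left power2_eq_square mult_ac)
  finally show "(LINT x:{-pi..pi}|lebesgue. (cmod (trig_poly I w x))\<^sup>2) = 2 * pi * (\<Sum>i\<in>I. (w i)\<^sup>2)"
    using of_real_eq_iff by blast
  have "trig_poly I w x * cnj (trig_poly I (\<lambda>_. 1) x)
     = (\<Sum>i\<in>I. \<Sum>j\<in>I. of_real (w i) * cis (of_int (int i - int j) * x))" for x
    unfolding trig_poly_def cnj_sum sum_product
    by (intro sum.cong refl) (simp add: cis_cnj cis_mult algebra_simps)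
  then have "(LINT x:{-pi..pi}|lebesgue. trig_poly I w x * cnj (trig_poly I (\<lambda>_. 1) x))
    = (\<Sum>i\<in>I. \<Sum>j\<in>I. of_real (w i) * complex_of_real (if int i - int j = 0 then 2 * pi else 0))"
    using ci assms
    by (simp add: set_integral_sum set_integral_mult_right set_integrable_mult_right integral_cis_frequency del: of_real_mult of_int_diff)
  also have "\<dots> = (\<Sum>i\<in>I. \<Sum>j\<in>I. if i = j then of_real (w i * (2 * pi)) else 0)"
    by (intro sum.cong refl) auto
  also have "\<dots> = of_real (2 * pi * (\<Sum>i\<in>I. w i))"
    using assms by (simp add: sum_distrib_left mult_ac)
  finally show "(LINT x:{-pi..pi}|lebesgue. trig_poly I w x * cnj (trig_poly I (\<lambda>_. 1) x)) = of_real (2 * pi * (\<Sum>i\<in>I. w i))" .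
qed

text \<open>The singularity of the fractional spectral density at the origin survives as a lower bound
  because \<open>\<bar>sin (x / 2)\<bar> \<le> \<bar>x\<bar> / 2\<close>. The origin is excluded: there \<open>powr\<close> has the value \<open>0\<close>.\<close>

lemma spectral_density_lower_bound:
  assumes "0 < d" "m > 0" and x: "x \<in> {-pi..pi} - {0}" and "m \<le> l"
  shows "m / (2 * pi) * \<bar>x\<bar> powr (- 2 * d) \<le> spectral_density_fd d x * l"
proof -
  have s0: "sin (x / 2) \<noteq> 0"
  proof (cases "x > 0")
    case True
    then have "0 < sin (x / 2)" using x by (intro sin_gt_zero) (auto intro: order.strict_trans1[of _ "pi/2"])
    then show ?thesis by simp
  next
    case False
    then have "0 < sin (- x / 2)" using x by (intro sin_gt_zero) (auto intro: order.strict_trans1[of _ "pi/2"])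
    then show ?thesis by simp
  qed
  have "(sin (x / 2))\<^sup>2 \<le> (x / 2)\<^sup>2"
    using abs_sin_x_le_abs_x[of "x / 2"] by (simp only: abs_le_square_iff)
  then have "((x / 2)\<^sup>2) powr (- d) \<le> ((sin (x / 2))\<^sup>2) powr (- d)"
    using s0 assms by (intro powr_mono2') auto
  moreover have "((x / 2)\<^sup>2) powr (- d) = \<bar>x\<bar> powr (- 2 * d) * 2 powr (2 * d)"
  proof -
    have "(x / 2)\<^sup>2 = (\<bar>x\<bar> / 2) powr 2" using x by (simp add: powr_numeral power_divide)
    then have "((x / 2)\<^sup>2) powr (- d) = (\<bar>x\<bar> / 2) powr (- 2 * d)" by (simp only: powr_powr) simp
    also have "\<dots> = \<bar>x\<bar> powr (- 2 * d) * 2 powr (2 * d)"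
      by (simp add: powr_divide powr_minus field_simps)
    finally show ?thesis .
  qed
  moreover have "\<bar>x\<bar> powr (- 2 * d) / (2 * pi)
      = 2 powr (- 2 * d - 1) * inverse pi * (\<bar>x\<bar> powr (- 2 * d) * 2 powr (2 * d))"
  proof -
    have "2 powr (- 2 * d - 1) * 2 powr (2 * d) = (1/2 :: real)"
      by (simp add: powr_add[symmetric] powr_minus)
    then have "2 powr (- 2 * d - 1) * inverse pi * (\<bar>x\<bar> powr (- 2 * d) * 2 powr (2 * d))
        = (1 / 2) * (inverse pi * \<bar>x\<bar> powr (- 2 * d))"
      by (simp only: mult_ac)
    then show ?thesis by (simp add: field_simps)
  qed
  ultimately have "\<bar>x\<bar> powr (- 2 * d) / (2 * pi) \<le> spectral_density_fd d x"
    unfolding spectral_density_fd_def by (auto intro!: mult_left_mono)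
  then have "\<bar>x\<bar> powr (- 2 * d) / (2 * pi) * m \<le> spectral_density_fd d x * l"
    using assms by (intro mult_mono) (auto simp: spectral_density_fd_def)
  then show ?thesis by (simp add: field_simps)
qed

lemma AE_circle_nonzero:
  assumes "\<And>x. x \<in> {-pi..pi} - {0} \<Longrightarrow> P x"
  shows "AE x\<in>{-pi..pi} in lebesgue. P (x::real)"
  by (rule AE_I'[of "{0}"]) (use assms in \<open>auto simp: negligible_iff_null_sets[symmetric]\<close>)

lemma toeplitz_form_ge_sum_squares:
  assumes sd: "spectral_density \<sigma> f" and I: "finite I"
    and lb: "\<And>x. x \<in> {-pi..pi} - {0} \<Longrightarrow> \<mu> \<le> f x"
  shows "2 * pi * \<mu> * (\<Sum>i\<in>I. (w i)\<^sup>2) \<le> toeplitz_form \<sigma> I w"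
proof -
  have fi: "set_integrable lebesgue {-pi..pi} f" using sd by (simp add: spectral_density_def)
  have c: "continuous_on S (\<lambda>x. (cmod (trig_poly I w x))\<^sup>2)" for S
    by (intro continuous_intros continuous_on_trig_poly)
  have "(LINT x:{-pi..pi}|lebesgue. \<mu> * (cmod (trig_poly I w x))\<^sup>2)
     \<le> (LINT x:{-pi..pi}|lebesgue. f x * (cmod (trig_poly I w x))\<^sup>2)"
  proof (rule set_integral_mono_AE)
    show "set_integrable lebesgue {-pi..pi} (\<lambda>x. \<mu> * (cmod (trig_poly I w x))\<^sup>2)"
      by (intro set_integrable_mult_right integrable_circle_continuous c)
    show "set_integrable lebesgue {-pi..pi} (\<lambda>x. f x * (cmod (trig_poly I w x))\<^sup>2)"
      using set_integrable_mult_continuous[OF fi c] by simp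
    show "AE x\<in>{-pi..pi} in lebesgue. \<mu> * (cmod (trig_poly I w x))\<^sup>2 \<le> f x * (cmod (trig_poly I w x))\<^sup>2"
      by (rule AE_circle_nonzero) (use lb in \<open>auto intro: mult_right_mono\<close>)
  qed
  then show ?thesis
    by (simp add: toeplitz_form_spectral[OF sd I] trig_poly_parseval(1)[OF I] mult_ac)
qed

text \<open>Any positive constant in place of \<open>1 / 3\<close> would do; this one follows from the cubic Taylor
  bound and \<open>pi < 4\<close>.\<close>

lemma abs_le_abs_sin: "\<bar>t\<bar> \<le> pi / 2 \<Longrightarrow> \<bar>t\<bar> / 3 \<le> \<bar>sin (t::real)\<bar>"
proof -
  assume t: "\<bar>t\<bar> \<le> pi / 2"
  have "\<bar>sin t - t\<bar> \<le> \<bar>t\<bar> ^ 3 / 6"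
    using Maclaurin_sin_bound[of t 3] by (simp add: numeral_3_eq_3 sin_coeff_def)
  moreover have "\<bar>t\<bar> ^ 3 / 6 \<le> 2 * \<bar>t\<bar> / 3"
  proof -
    have "\<bar>t\<bar> * \<bar>t\<bar> \<le> 2 * 2" using t pi_less_4 by (intro mult_mono) auto
    then have "\<bar>t\<bar> * \<bar>t\<bar> * \<bar>t\<bar> \<le> 4 * \<bar>t\<bar>" by (intro mult_right_mono) auto
    then show ?thesis by (simp add: power3_eq_cube)
  qed
  ultimately show ?thesis by linarith
qed

lemma dirichlet_kernel_bounds:
  defines "D \<equiv> \<lambda>k. trig_poly {1..k} (\<lambda>_. 1)"
  shows "cmod (D k x) \<le> real k"
    and "x \<in> {-pi..pi} \<Longrightarrow> cmod (D k x) * \<bar>x\<bar> \<le> 6"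
proof -
  show "cmod (D k x) \<le> real k"
    using norm_trig_poly_le[of "{1..k}" "\<lambda>_. 1" x] by (simp add: D_def)
  assume x: "x \<in> {-pi..pi}"
  have "(1 - cis x) * D k x = (\<Sum>j=1..k. cis (real j * x) - cis (real (Suc j) * x))"
    by (simp add: D_def trig_poly_def sum_distrib_left left_diff_distrib cis_mult algebra_simps)
  also have "\<dots> = cis (real 1 * x) - cis (real (Suc k) * x)"
    by (induction k) auto
  finally have "cmod (1 - cis x) * cmod (D k x) \<le> 2"
    using norm_triangle_ineq4[of "cis x" "cis (real (Suc k) * x)"] by (simp add: norm_mult[symmetric])
  moreover have "\<bar>x\<bar> / 3 \<le> cmod (1 - cis x)"
  proof -
    have "(cmod (1 - cis x))\<^sup>2 = 2 - 2 * cos (2 * (x / 2))"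
      using sin_cos_squared_add[of x] unfolding cmod_power2 by (simp add: power2_eq_square algebra_simps)
    also have "\<dots> = (2 * \<bar>sin (x / 2)\<bar>)\<^sup>2"
      unfolding cos_double_sin by (simp add: power2_eq_square)
    finally have "cmod (1 - cis x) = 2 * \<bar>sin (x / 2)\<bar>"
      by (rule power2_eq_imp_eq) auto
    moreover have "\<bar>x\<bar> \<le> pi" using x by auto
    ultimately show ?thesis using abs_le_abs_sin[of "x / 2"] by simp
  qed
  then have "\<bar>x\<bar> / 3 * cmod (D k x) \<le> cmod (1 - cis x) * cmod (D k x)"
    by (rule mult_right_mono) simp
  ultimately show "cmod (D k x) * \<bar>x\<bar> \<le> 6" by (simp add: mult.commute)
qed

lemma has_integral_powr_Icc:
  fixes p :: real
  assumes "0 < a" "a \<le> b" "p \<noteq> -1"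
  shows "has_bochner_integral lborel (\<lambda>x. x powr p * indicator {a..b} x) ((b powr (p + 1) - a powr (p + 1)) / (p + 1))"
    and "has_bochner_integral lborel (\<lambda>x. (- x) powr p * indicator {-b..-a} x) ((b powr (p + 1) - a powr (p + 1)) / (p + 1))"
proof -
  have "has_bochner_integral lborel (\<lambda>x. x powr p * indicator {a..b} x)
     (b powr (p + 1) / (p + 1) - a powr (p + 1) / (p + 1))"
    using assms
    by (intro has_bochner_integral_FTC_Icc_real) (auto intro!: derivative_eq_intros continuous_intros)
  then show "has_bochner_integral lborel (\<lambda>x. x powr p * indicator {a..b} x) ((b powr (p + 1) - a powr (p + 1)) / (p + 1))"
    by (simp add: diff_divide_distrib)
  have "has_bochner_integral lborel (\<lambda>x. (- x) powr p * indicator {-b..-a} x)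
     (- ((- (- a)) powr (p + 1) / (p + 1)) - - ((- (- b)) powr (p + 1) / (p + 1)))"
    using assms
    by (intro has_bochner_integral_FTC_Icc_real) (auto intro!: derivative_eq_intros continuous_intros)
  then show "has_bochner_integral lborel (\<lambda>x. (- x) powr p * indicator {-b..-a} x) ((b powr (p + 1) - a powr (p + 1)) / (p + 1))"
    by (simp add: diff_divide_distrib)
qed

text \<open>The weight \<open>\<bar>x\<bar> powr (2 * d)\<close> is at most \<open>k powr (- 2 * d)\<close> where the kernel is of size \<open>k\<close>, that
  is for \<open>\<bar>x\<bar> \<le> 1 / k\<close>; outside, the kernel is of size \<open>1 / \<bar>x\<bar>\<close> and \<open>\<bar>x\<bar> powr (2 * d - 2)\<close> is integrable at
  infinity since \<open>2 * d < 1\<close>. Both parts contribute the order \<open>k powr (1 - 2 * d)\<close>, which is smaller than the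
  order \<open>k\<close> of the unweighted integral.\<close>

lemma dirichlet_kernel_weighted_square_dominated:
  fixes d :: real
  assumes d: "0 < d" "d < 1 / 2" and k: "k \<ge> 1"
  shows "\<exists>G. set_integrable lebesgue {-pi..pi} G \<and>
    (LINT x:{-pi..pi}|lebesgue. G x) \<le> (2 + 72 / (1 - 2 * d)) * real k powr (1 - 2 * d) \<and>
    (\<forall>x\<in>{-pi..pi}. (cmod (trig_poly {1..k} (\<lambda>_. 1) x))\<^sup>2 * \<bar>x\<bar> powr (2 * d) \<le> G x)"
proof -
  define a where "a = 1 / real k"
  have "1 / real k \<le> 1" using k by simp
  then have a: "0 < a" "a \<le> pi" using k pi_ge_two unfolding a_def by (simp, linarith)
  define G where "G = (\<lambda>x. real k powr (2 - 2 * d) * indicator {-a..a} x +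
     36 * (x powr (2 * d - 2) * indicator {a..pi} x) + 36 * ((- x) powr (2 * d - 2) * indicator {-pi..-a} x))"
  define v where "v = (pi powr (2 * d - 1) - a powr (2 * d - 1)) / (2 * d - 1)"
  have "has_bochner_integral lborel G (real k powr (2 - 2 * d) * (2 * a) + 36 * v + 36 * v)"
    unfolding G_def v_def
    using has_integral_powr_Icc[of a pi "2 * d - 2"] a d
    by (intro has_bochner_integral_add has_bochner_integral_mult_right)
      (auto simp: has_bochner_integral_iff algebra_simps)
  moreover have "(\<lambda>x. indicator {-pi..pi} x *\<^sub>R G x) = G"
    using a by (auto simp: G_def indicator_def fun_eq_iff)
  moreover have Gm: "G \<in> borel_measurable lborel" unfolding G_def by measurable
  ultimately have Gi: "set_integrable lebesgue {-pi..pi} G"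
    and GI: "(LINT x:{-pi..pi}|lebesgue. G x) = real k powr (2 - 2 * d) * (2 * a) + 72 * v"
    unfolding set_integrable_def set_lebesgue_integral_def
    by (auto simp: has_bochner_integral_iff integrable_completion integral_completion)
  have ap: "a powr (2 * d - 1) = real k powr (1 - 2 * d)"
    using k by (simp add: a_def powr_divide powr_minus_divide[symmetric])
  have "real k powr (2 - 2 * d) * a = real k powr (1 - 2 * d)"
    using k powr_add[of "real k" "1 - 2 * d" 1] by (simp add: a_def)
  moreover have "v \<le> real k powr (1 - 2 * d) / (1 - 2 * d)"
  proof -
    have "v = (real k powr (1 - 2 * d) - pi powr (2 * d - 1)) / (1 - 2 * d)"
      unfolding v_def ap using d by (simp add: field_simps)
    then show ?thesis using d by (simp add: divide_right_mono)
  qed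
  ultimately have "(LINT x:{-pi..pi}|lebesgue. G x) \<le> (2 + 72 / (1 - 2 * d)) * real k powr (1 - 2 * d)"
    unfolding GI by (simp add: algebra_simps)
  moreover have "(cmod (trig_poly {1..k} (\<lambda>_. 1) x))\<^sup>2 * \<bar>x\<bar> powr (2 * d) \<le> G x" if x: "x \<in> {-pi..pi}" for x
  proof (cases "\<bar>x\<bar> \<le> a")
    case True
    have "\<bar>x\<bar> powr (2 * d) \<le> a powr (2 * d)" using True d by (intro powr_mono2) auto
    then have "(cmod (trig_poly {1..k} (\<lambda>_. 1) x))\<^sup>2 * \<bar>x\<bar> powr (2 * d) \<le> (real k)\<^sup>2 * a powr (2 * d)"
      by (intro mult_mono power_mono dirichlet_kernel_bounds(1)) auto
    also have "\<dots> = real k powr (2 - 2 * d)"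
      using k by (simp add: a_def powr_divide powr_diff powr_numeral)
    also have "\<dots> \<le> G x" using True by (auto simp: G_def indicator_def)
    finally show ?thesis .
  next
    case False
    then have x0: "\<bar>x\<bar> > 0" using a by auto
    have "(cmod (trig_poly {1..k} (\<lambda>_. 1) x))\<^sup>2 * \<bar>x\<bar> powr (2 * d)
       = (cmod (trig_poly {1..k} (\<lambda>_. 1) x) * \<bar>x\<bar>)\<^sup>2 * \<bar>x\<bar> powr (2 * d - 2)"
      using x0 by (simp add: power_mult_distrib powr_diff powr_numeral)
    also have "\<dots> \<le> 6\<^sup>2 * \<bar>x\<bar> powr (2 * d - 2)"
      using dirichlet_kernel_bounds(2)[OF x] by (intro mult_right_mono power_mono) auto
    also have "\<dots> \<le> G x"
      using False x a by (cases "x > 0") (auto simp: G_def indicator_def)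
    finally show ?thesis .
  qed
  ultimately show ?thesis using Gi by blast
qed

text \<open>Optimising the weight \<open>\<theta>\<close> turns a family of arithmetic-geometric bounds into a
  Cauchy-Schwarz inequality.\<close>

lemma square_le_of_weighted_bounds:
  fixes A Q B :: real
  assumes "0 \<le> A" "0 \<le> Q" "0 \<le> B" and le: "\<And>\<theta>. \<theta> > 0 \<Longrightarrow> A \<le> \<theta> * Q + B / (4 * \<theta>)"
  shows "A\<^sup>2 \<le> Q * B"
proof (cases "A = 0")
  case False
  then have A: "A > 0" using assms by simp
  have "Q \<noteq> 0"
  proof
    assume "Q = 0"
    then have "A \<le> B * A / (4 * (B + 1))" using le[of "(B + 1) / A"] A assms by (simp add: field_simps)
    also have "\<dots> < A" using A assms by (simp add: field_simps add_pos_nonneg)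
    finally show False by simp
  qed
  then have "Q > 0" using assms by simp
  then show ?thesis using le[of "A / (2 * Q)"] A by (simp add: field_simps power2_eq_square)
qed (use assms in auto)

text \<open>The sum of the weights is the pairing of their trigonometric polynomial with the Dirichlet
  kernel; Cauchy-Schwarz with the weight \<open>f\<close> on the polynomial and \<open>1 / f\<close> on the kernel gives the claim.
  Equivalently, no unbiased linear estimator of the mean from \<open>k\<close> observations has a variance of smaller
  order than \<open>k powr (2 * d - 1)\<close>. This is the source of the factor \<open>k powr (1 - 2 * d)\<close> in the final rate.\<close>

lemma sum_squared_le_toeplitz_form:
  fixes d :: real
  assumes sd: "spectral_density \<sigma> f" and d: "0 < d" "d < 1 / 2" and c: "c > 0"
    and lb: "\<And>x. x \<in> {-pi..pi} - {0} \<Longrightarrow> c * \<bar>x\<bar> powr (- 2 * d) \<le> f x"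
  shows "\<exists>C>0. \<forall>k\<ge>1. \<forall>w. (\<Sum>i=1..k. w i)\<^sup>2 \<le> C * real k powr (1 - 2 * d) * toeplitz_form \<sigma> {1..k} w"
proof -
  define C where "C = (2 + 72 / (1 - 2 * d)) / c / (2 * pi)\<^sup>2"
  have C: "C > 0" using d c by (auto simp: C_def intro!: divide_pos_pos add_pos_pos)
  have fi: "set_integrable lebesgue {-pi..pi} f" using sd by (simp add: spectral_density_def)
  have "(\<Sum>i=1..k. w i)\<^sup>2 \<le> C * real k powr (1 - 2 * d) * toeplitz_form \<sigma> {1..k} w" if k: "k \<ge> 1" for k w
  proof -
    obtain G where G: "set_integrable lebesgue {-pi..pi} G"
      "(LINT x:{-pi..pi}|lebesgue. G x) \<le> (2 + 72 / (1 - 2 * d)) * real k powr (1 - 2 * d)"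
      "\<And>x. x \<in> {-pi..pi} \<Longrightarrow> (cmod (trig_poly {1..k} (\<lambda>_. 1) x))\<^sup>2 * \<bar>x\<bar> powr (2 * d) \<le> G x"
      using dirichlet_kernel_weighted_square_dominated[OF d k] by blast
    define W where "W = trig_poly {1..k} w"
    define D where "D = trig_poly {1..k} (\<lambda>_. 1)"
    have cW: "continuous_on S W" "continuous_on S D" for S
      by (auto simp: W_def D_def continuous_on_trig_poly)
    have Wi: "set_integrable lebesgue {-pi..pi} (\<lambda>x. f x * (cmod (W x))\<^sup>2)"
    proof -
      have "continuous_on UNIV (\<lambda>x. (cmod (W x))\<^sup>2)" by (intro continuous_intros cW)
      from set_integrable_mult_continuous[OF fi this] show ?thesis by simp
    qed
    define Q where "Q = toeplitz_form \<sigma> {1..k} w"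
    have Q: "Q = (LINT x:{-pi..pi}|lebesgue. f x * (cmod (W x))\<^sup>2)"
      unfolding Q_def W_def by (rule toeplitz_form_spectral[OF sd]) simp
    define B where "B = (2 + 72 / (1 - 2 * d)) * real k powr (1 - 2 * d) / c"
    have le: "\<bar>2 * pi * (\<Sum>i=1..k. w i)\<bar> \<le> \<theta> * Q + B / (4 * \<theta>)" if th: "\<theta> > 0" for \<theta>
    proof -
      have "\<bar>2 * pi * (\<Sum>i=1..k. w i)\<bar> = cmod (LINT x:{-pi..pi}|lebesgue. W x * cnj (D x))"
        unfolding W_def D_def trig_poly_parseval(2)[OF finite_atLeastAtMost] norm_of_real ..
      also have "\<dots> \<le> (LINT x:{-pi..pi}|lebesgue. cmod (W x * cnj (D x)))"
        by (intro set_integral_norm_bound integrable_circle_continuous continuous_intros cW)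
      also have "\<dots> \<le> (LINT x:{-pi..pi}|lebesgue. \<theta> * (f x * (cmod (W x))\<^sup>2) + G x / (c * (4 * \<theta>)))"
      proof (rule set_integral_mono_AE)
        show "set_integrable lebesgue {-pi..pi} (\<lambda>x. cmod (W x * cnj (D x)))"
          by (intro integrable_circle_continuous continuous_intros cW)
        show "set_integrable lebesgue {-pi..pi} (\<lambda>x. \<theta> * (f x * (cmod (W x))\<^sup>2) + G x / (c * (4 * \<theta>)))"
          using Wi G(1) by auto
        show "AE x\<in>{-pi..pi} in lebesgue. cmod (W x * cnj (D x)) \<le> \<theta> * (f x * (cmod (W x))\<^sup>2) + G x / (c * (4 * \<theta>))"
        proof (rule AE_circle_nonzero)
          fix x assume x: "x \<in> {-pi..pi} - {0::real}"
          define u where "u = cmod (W x)"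
          define z where "z = cmod (D x)"
          define q where "q = c * \<bar>x\<bar> powr (- 2 * d)"
          have q: "q > 0" using x c by (simp add: q_def)
          have "0 \<le> (2 * \<theta> * q * u - z)\<^sup>2 / (4 * \<theta> * q)" using q th by simp
          also have "\<dots> = \<theta> * (q * u\<^sup>2) + z\<^sup>2 / (4 * \<theta> * q) - u * z"
            using q th by (simp add: field_simps power2_eq_square)
          finally have "u * z \<le> \<theta> * (q * u\<^sup>2) + z\<^sup>2 / (4 * \<theta> * q)" by simp
          moreover have "\<theta> * (q * u\<^sup>2) \<le> \<theta> * (f x * u\<^sup>2)"
            using lb[OF x] th by (intro mult_left_mono mult_right_mono) (auto simp: q_def)
          moreover have "z\<^sup>2 / (4 * \<theta> * q) = z\<^sup>2 * \<bar>x\<bar> powr (2 * d) / (c * (4 * \<theta>))"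
            using x by (simp add: q_def powr_minus field_simps)
          moreover have "z\<^sup>2 * \<bar>x\<bar> powr (2 * d) / (c * (4 * \<theta>)) \<le> G x / (c * (4 * \<theta>))"
            using G(3)[of x] x c th by (intro divide_right_mono) (auto simp: z_def D_def)
          ultimately show "cmod (W x * cnj (D x)) \<le> \<theta> * (f x * (cmod (W x))\<^sup>2) + G x / (c * (4 * \<theta>))"
            by (simp add: norm_mult u_def z_def)
        qed
      qed
      also have "\<dots> = \<theta> * Q + (LINT x:{-pi..pi}|lebesgue. G x) / (c * (4 * \<theta>))"
        using Wi G(1) by (simp add: Q)
      also have "\<dots> \<le> \<theta> * Q + B / (4 * \<theta>)"
        using divide_right_mono[OF G(2), of "c * (4 * \<theta>)"] c th by (simp add: B_def)
      finally show ?thesis .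
    qed
    have Q0: "Q \<ge> 0"
      unfolding Q_def using toeplitz_form_ge_sum_squares[OF sd, of "{1..k}" 0 w] sd
      by (auto simp: spectral_density_def)
    have B0: "B \<ge> 0" using d c by (auto simp: B_def intro!: divide_nonneg_nonneg mult_nonneg_nonneg add_nonneg_nonneg)
    have "\<bar>2 * pi * (\<Sum>i=1..k. w i)\<bar>\<^sup>2 \<le> Q * B"
      using le Q0 B0 by (intro square_le_of_weighted_bounds) auto
    then have "(2 * pi)\<^sup>2 * (\<Sum>i=1..k. w i)\<^sup>2 \<le> Q * B" by (simp add: power_mult_distrib)
    then have "(\<Sum>i=1..k. w i)\<^sup>2 \<le> Q * B / (2 * pi)\<^sup>2"
      by (subst pos_le_divide_eq) (simp_all add: mult.commute)
    also have "\<dots> = C * real k powr (1 - 2 * d) * Q" by (simp add: C_def B_def)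
    finally show ?thesis by (simp add: Q_def)
  qed
  with C show ?thesis by blast
qed

section \<open>Square-integrable random variables and the autoregression\<close>

lemma integrable_mult_of_squares:
  fixes u v :: "'a \<Rightarrow> real"
  assumes "u \<in> borel_measurable M" "v \<in> borel_measurable M"
    and "integrable M (\<lambda>\<omega>. (u \<omega>)\<^sup>2)" "integrable M (\<lambda>\<omega>. (v \<omega>)\<^sup>2)"
  shows "integrable M (\<lambda>\<omega>. u \<omega> * v \<omega>)"
proof (rule Bochner_Integration.integrable_bound)
  show "integrable M (\<lambda>\<omega>. (u \<omega>)\<^sup>2 + (v \<omega>)\<^sup>2)" using assms by auto
  have "\<bar>x * y\<bar> \<le> x\<^sup>2 + y\<^sup>2" for x y :: real
  proof -
    have "2 * \<bar>x\<bar> * \<bar>y\<bar> \<le> \<bar>x\<bar>\<^sup>2 + \<bar>y\<bar>\<^sup>2" by (rule sum_squares_bound)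
    moreover have "0 \<le> \<bar>x\<bar> * \<bar>y\<bar>" by simp
    ultimately show ?thesis unfolding abs_mult power2_abs by linarith
  qed
  then show "AE \<omega> in M. norm (u \<omega> * v \<omega>) \<le> norm ((u \<omega>)\<^sup>2 + (v \<omega>)\<^sup>2)"
    by (intro AE_I2) simp
qed (use assms in measurable)

lemma integral_mult_squared_le:
  fixes u v :: "'a \<Rightarrow> real"
  assumes uv: "u \<in> borel_measurable M" "v \<in> borel_measurable M"
    "integrable M (\<lambda>\<omega>. (u \<omega>)\<^sup>2)" "integrable M (\<lambda>\<omega>. (v \<omega>)\<^sup>2)"
  shows "(LINT \<omega>|M. u \<omega> * v \<omega>)\<^sup>2 \<le> (LINT \<omega>|M. (u \<omega>)\<^sup>2) * (LINT \<omega>|M. (v \<omega>)\<^sup>2)"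
proof -
  have i: "integrable M (\<lambda>\<omega>. u \<omega> * v \<omega>)" by (rule integrable_mult_of_squares[OF uv])
  have "\<bar>LINT \<omega>|M. u \<omega> * v \<omega>\<bar> \<le> \<theta> * (LINT \<omega>|M. (u \<omega>)\<^sup>2) + (LINT \<omega>|M. (v \<omega>)\<^sup>2) / (4 * \<theta>)" if "\<theta> > 0" for \<theta>
  proof -
    have "\<bar>LINT \<omega>|M. u \<omega> * v \<omega>\<bar> \<le> (LINT \<omega>|M. \<bar>u \<omega> * v \<omega>\<bar>)"
      by (rule integral_abs_bound)
    also have "\<dots> \<le> (LINT \<omega>|M. \<theta> * (u \<omega>)\<^sup>2 + (v \<omega>)\<^sup>2 / (4 * \<theta>))"
    proof (rule integral_mono)
      fix \<omega>
      have "0 \<le> (2 * \<theta> * \<bar>u \<omega>\<bar> - \<bar>v \<omega>\<bar>)\<^sup>2 / (4 * \<theta>)" using that by simp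
      also have "\<dots> = \<theta> * (u \<omega>)\<^sup>2 + (v \<omega>)\<^sup>2 / (4 * \<theta>) - \<bar>u \<omega> * v \<omega>\<bar>"
        using that by (simp add: field_simps power2_diff abs_mult power_mult_distrib power2_eq_square)
      finally show "\<bar>u \<omega> * v \<omega>\<bar> \<le> \<theta> * (u \<omega>)\<^sup>2 + (v \<omega>)\<^sup>2 / (4 * \<theta>)" by simp
    qed (use i uv in auto)
    finally show ?thesis using uv by simp
  qed
  then have "\<bar>LINT \<omega>|M. u \<omega> * v \<omega>\<bar>\<^sup>2 \<le> (LINT \<omega>|M. (u \<omega>)\<^sup>2) * (LINT \<omega>|M. (v \<omega>)\<^sup>2)"
    by (intro square_le_of_weighted_bounds) auto
  then show ?thesis by simp
qed

lemma square_integrable_sum: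
  fixes u :: "'i \<Rightarrow> 'a \<Rightarrow> real"
  assumes "finite I" "\<And>i. i \<in> I \<Longrightarrow> u i \<in> borel_measurable M"
    "\<And>i. i \<in> I \<Longrightarrow> integrable M (\<lambda>\<omega>. (u i \<omega>)\<^sup>2)"
  shows "integrable M (\<lambda>\<omega>. (\<Sum>i\<in>I. u i \<omega>)\<^sup>2)"
proof -
  have "(\<lambda>\<omega>. (\<Sum>i\<in>I. u i \<omega>)\<^sup>2) = (\<lambda>\<omega>. \<Sum>i\<in>I. \<Sum>j\<in>I. u i \<omega> * u j \<omega>)"
    by (simp add: power2_eq_square sum_product)
  then show ?thesis
    by (simp only:) (intro Bochner_Integration.integrable_sum integrable_mult_of_squares assms)
qed

lemma L2_sums_inner_product:
  assumes L2: "L2_sums M u Z"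
    and Z: "Z \<in> borel_measurable M" "integrable M (\<lambda>\<omega>. (Z \<omega>)\<^sup>2)"
    and V: "V \<in> borel_measurable M" "integrable M (\<lambda>\<omega>. (V \<omega>)\<^sup>2)"
    and u: "\<And>j. u j \<in> borel_measurable M" "\<And>j. integrable M (\<lambda>\<omega>. (u j \<omega>)\<^sup>2)"
  shows "(\<lambda>N. \<Sum>j<N. LINT \<omega>|M. u j \<omega> * V \<omega>) \<longlonglongrightarrow> (LINT \<omega>|M. Z \<omega> * V \<omega>)"
proof -
  define S where "S = (\<lambda>N \<omega>. \<Sum>j<N. u j \<omega>)"
  have S: "S N \<in> borel_measurable M" "integrable M (\<lambda>\<omega>. (S N \<omega>)\<^sup>2)" for N
    unfolding S_def using u by (auto intro!: square_integrable_sum)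
  have ZS: "(\<lambda>\<omega>. Z \<omega> - S N \<omega>) \<in> borel_measurable M" "integrable M (\<lambda>\<omega>. (Z \<omega> - S N \<omega>)\<^sup>2)" for N
    using Z S[of N] integrable_mult_of_squares[OF Z(1) S(1)[of N] Z(2) S(2)]
    by (auto simp: power2_diff mult.assoc)
  have eq: "(LINT \<omega>|M. (Z \<omega> - S N \<omega>) * V \<omega>) = (LINT \<omega>|M. Z \<omega> * V \<omega>) - (\<Sum>j<N. LINT \<omega>|M. u j \<omega> * V \<omega>)" for N
    using integrable_mult_of_squares[OF Z(1) V(1) Z(2) V(2)] integrable_mult_of_squares[OF u(1) V(1) u(2) V(2)]
    by (simp add: S_def left_diff_distrib sum_distrib_right)
  have "(\<lambda>N. (LINT \<omega>|M. (Z \<omega> - S N \<omega>)\<^sup>2) * (LINT \<omega>|M. (V \<omega>)\<^sup>2)) \<longlonglongrightarrow> 0"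
    using L2 unfolding L2_sums_def S_def by (auto intro: tendsto_mult_left_zero)
  then have "(\<lambda>N. ((LINT \<omega>|M. (Z \<omega> - S N \<omega>) * V \<omega>))\<^sup>2) \<longlonglongrightarrow> 0"
    by (rule Lim_null_comparison[rotated])
      (use integral_mult_squared_le[OF ZS(1) V(1) ZS(2) V(2)] in \<open>simp add: always_eventually\<close>)
  then have "(\<lambda>N. (LINT \<omega>|M. (Z \<omega> - S N \<omega>) * V \<omega>)) \<longlonglongrightarrow> 0"
    by (simp add: power_tendsto_0_iff)
  then have "(\<lambda>N. (LINT \<omega>|M. Z \<omega> * V \<omega>) - (LINT \<omega>|M. (Z \<omega> - S N \<omega>) * V \<omega>)) \<longlonglongrightarrow> (LINT \<omega>|M. Z \<omega> * V \<omega>) - 0"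
    by (intro tendsto_diff tendsto_const)
  then show ?thesis by (simp add: eq)
qed

context long_memory_process
begin

lemma autocovariance_sym: "\<sigma> (- h) = \<sigma> h"
  using X_autocovariance[of 0 h] X_autocovariance[of h "- h"] by (simp add: mult.commute)

lemma covariance_eq: "expectation (\<lambda>\<omega>. X m \<omega> * X n \<omega>) = \<sigma> (n - m)"
  using X_autocovariance[of m "n - m"] by simp

lemma abs_autocovariance_le: "\<bar>\<sigma> h\<bar> \<le> \<sigma> 0"
proof -
  have s0: "expectation (\<lambda>\<omega>. (X n \<omega>)\<^sup>2) = \<sigma> 0" for n
    using covariance_eq[of n n] by (simp add: power2_eq_square)
  have "\<sigma> 0 \<ge> 0" unfolding s0[of 0, symmetric] by simp
  moreover have "(\<sigma> h)\<^sup>2 \<le> (\<sigma> 0)\<^sup>2"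
    using integral_mult_squared_le[OF X_measurable[of 0] X_measurable[of h] X_square_integrable X_square_integrable]
    by (simp add: s0 covariance_eq power2_eq_square)
  ultimately show ?thesis using abs_le_square_iff[of "\<sigma> h" "\<sigma> 0"] by simp
qed

text \<open>The past of the process lies in the closed span of the past of the noise, which is
  uncorrelated with the present noise.\<close>

lemma noise_orthogonal_past:
  assumes "j \<ge> 1"
  shows "expectation (\<lambda>\<omega>. X (n - int j) \<omega> * \<epsilon> n \<omega>) = 0"
proof -
  have "(\<lambda>N. \<Sum>i<N. LINT \<omega>|M. (b i * \<epsilon> (n - int j - int i) \<omega>) * \<epsilon> n \<omega>) \<longlonglongrightarrow> expectation (\<lambda>\<omega>. X (n - int j) \<omega> * \<epsilon> n \<omega>)"
    using moving_average
    by (rule L2_sums_inner_product)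
      (auto intro!: borel_measurable_times simp: power_mult_distrib X_measurable X_square_integrable noise_measurable noise_square_integrable)
  moreover have "(LINT \<omega>|M. (b i * \<epsilon> (n - int j - int i) \<omega>) * \<epsilon> n \<omega>) = 0" for i
    using noise_covariance[of "n - int j - int i" n] assms by (simp add: mult.assoc)
  ultimately show ?thesis by (simp add: LIMSEQ_const_iff)
qed

text \<open>The Yule-Walker equations of the predictor from the infinite past.\<close>

lemma autoregression_normal_equations:
  assumes "j \<ge> 1"
  shows "(\<lambda>N. \<Sum>i<N. a i * \<sigma> (int i - int j)) \<longlonglongrightarrow> 0"
proof -
  have "(\<lambda>N. \<Sum>i<N. LINT \<omega>|M. (a i * X (0 - int i) \<omega>) * X (0 - int j) \<omega>) \<longlonglongrightarrow> expectation (\<lambda>\<omega>. \<epsilon> 0 \<omega> * X (0 - int j) \<omega>)"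
  proof (rule L2_sums_inner_product[OF autoregression])
    show "integrable M (\<lambda>\<omega>. (a i * X (0 - int i) \<omega>)\<^sup>2)" for i
      unfolding power_mult_distrib by (intro integrable_mult_right X_square_integrable)
  qed (intro borel_measurable_times borel_measurable_const X_measurable X_square_integrable noise_measurable noise_square_integrable)+
  moreover have "(LINT \<omega>|M. (a i * X (0 - int i) \<omega>) * X (0 - int j) \<omega>) = a i * \<sigma> (int i - int j)" for i
    using covariance_eq[of "0 - int i" "0 - int j"] by (simp add: mult.assoc)
  moreover have "expectation (\<lambda>\<omega>. \<epsilon> 0 \<omega> * X (0 - int j) \<omega>) = 0"
    using noise_orthogonal_past[OF assms, of 0] by (simp only: mult.commute)
  ultimately show ?thesis by (simp only:)
qed

end

section \<open>The sum of the predictor coefficients\<close>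

lemma toeplitz_form_Un:
  assumes sym: "\<And>h. r (- h) = r h" and "finite I" "finite J" "I \<inter> J = {}"
  shows "toeplitz_form r (I \<union> J) w = toeplitz_form r I w + toeplitz_form r J w
    + 2 * (\<Sum>j\<in>I. w j * (\<Sum>i\<in>J. w i * r (int i - int j)))"
proof -
  have "(\<Sum>i\<in>I. \<Sum>j\<in>J. w i * w j * r (int i - int j)) = (\<Sum>j\<in>I. w j * (\<Sum>i\<in>J. w i * r (int i - int j)))"
    using sym[of "int _ - int _"] by (simp add: sum_distrib_left mult_ac)
  moreover have "(\<Sum>i\<in>J. \<Sum>j\<in>I. w i * w j * r (int i - int j)) = (\<Sum>j\<in>I. w j * (\<Sum>i\<in>J. w i * r (int i - int j)))"
    by (subst sum.swap) (simp add: sum_distrib_left mult_ac)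
  ultimately show ?thesis
    using assms by (simp add: toeplitz_form_def sum.union_disjoint sum.distrib)
qed

text \<open>One statement for both signs of \<open>p\<close>: negative exponents give telescoping bounds for tails of
  convergent sums, exponents in \<open>(0, 1)\<close> for partial sums of divergent ones.\<close>

lemma powr_le_difference_quotient:
  fixes p x :: real
  assumes p: "p < 1" "p \<noteq> 0" and x: "x > 0"
  shows "(x + 1) powr (p - 1) \<le> ((x + 1) powr p - x powr p) / p"
proof -
  have "\<exists>z. x < z \<and> z < x + 1 \<and> (x + 1) powr p / p - x powr p / p = (x + 1 - x) * z powr (p - 1)"
    using p x by (intro MVT2) (auto intro!: derivative_eq_intros)
  then obtain z where z: "x < z" "z < x + 1" "(x + 1) powr p / p - x powr p / p = z powr (p - 1)"
    by auto
  have "(x + 1) powr (p - 1) \<le> z powr (p - 1)"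
    using z x p by (intro powr_mono2') auto
  then show ?thesis using z by (simp add: diff_divide_distrib)
qed

lemma sum_powr_tail_le:
  fixes s :: real
  assumes s: "s > 0" and k: "k \<ge> 1"
  shows "(\<Sum>i\<in>{k<..<N}. real i powr (- s - 1)) \<le> real k powr (- s) / s"
proof -
  have "(\<Sum>i\<in>{k<..<k + m}. real i powr (- s - 1)) \<le> (real k powr (- s) - real (k + m - 1) powr (- s)) / s" if "m \<ge> 1" for m
    using that
  proof (induction m rule: dec_induct)
    case (step m)
    have "{k<..<k + Suc m} = insert (k + m) {k<..<k + m}" using step by auto
    then have "(\<Sum>i\<in>{k<..<k + Suc m}. real i powr (- s - 1))
       = real (k + m) powr (- s - 1) + (\<Sum>i\<in>{k<..<k + m}. real i powr (- s - 1))" by simp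
    moreover have "real (k + m) powr (- s - 1) \<le> (real (k + m) powr (- s) - real (k + m - 1) powr (- s)) / (- s)"
      using powr_le_difference_quotient[of "- s" "real (k + m - 1)"] s k step by (simp add: of_nat_diff)
    moreover have "(u - v) / (- s) = (v - u) / s" for u v by (simp add: field_simps minus_divide_left)
    ultimately show ?case using step.IH by (simp add: diff_divide_distrib)
  next
    case base
    have "{k<..<k + 1} = {}" by auto
    then show ?case by (simp only:) simp
  qed
  note partial = this
  have "(\<Sum>i\<in>{k<..<N}. real i powr (- s - 1)) \<le> real k powr (- s) / s" if "k < N"
  proof -
    have "(\<Sum>i\<in>{k<..<N}. real i powr (- s - 1)) \<le> (real k powr (- s) - real (N - 1) powr (- s)) / s"
      using partial[of "N - k"] that by simp
    also have "\<dots> \<le> real k powr (- s) / s" using s by (intro divide_right_mono) auto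
    finally show ?thesis .
  qed
  then show ?thesis using s by (cases "k < N") auto
qed

lemma asymp_equiv_powr_bound:
  fixes \<sigma> :: "int \<Rightarrow> real"
  assumes "(\<lambda>j. \<sigma> (int j)) \<sim>[at_top] (\<lambda>j. lam * real j powr p)"
  shows "\<exists>S\<ge>0. \<forall>j\<ge>1. \<bar>\<sigma> (int j)\<bar> \<le> S * real j powr p"
proof -
  have "(\<lambda>j. \<sigma> (int j)) \<in> O(\<lambda>j. lam * real j powr p)"
    using assms by (rule asymp_equiv_imp_bigo)
  also have "(\<lambda>j. lam * real j powr p) \<in> O(\<lambda>j. real j powr p)" by simp
  finally obtain c where c: "c > 0" "\<forall>\<^sub>F j in sequentially. norm (\<sigma> (int j)) \<le> c * norm (real j powr p)"
    by (rule landau_o.bigE)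
  then obtain N where N: "\<And>j. j \<ge> N \<Longrightarrow> \<bar>\<sigma> (int j)\<bar> \<le> c * real j powr p"
    by (auto simp: eventually_at_top_linorder)
  define S where "S = c + (\<Sum>j\<in>{1..N}. \<bar>\<sigma> (int j)\<bar> / real j powr p)"
  have S: "S \<ge> c" by (simp add: S_def sum_nonneg)
  have "\<bar>\<sigma> (int j)\<bar> \<le> S * real j powr p" if j: "j \<ge> 1" for j
  proof (cases "j \<ge> N")
    case True
    then show ?thesis using N[OF True] S by (meson mult_right_mono order_trans powr_ge_zero)
  next
    case False
    have "\<bar>\<sigma> (int j)\<bar> / real j powr p \<le> (\<Sum>j\<in>{1..N}. \<bar>\<sigma> (int j)\<bar> / real j powr p)"
      using False j by (intro member_le_sum) auto
    then have "\<bar>\<sigma> (int j)\<bar> / real j powr p \<le> S" using c by (simp add: S_def)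
    then show ?thesis using j by (simp add: divide_le_eq)
  qed
  then show ?thesis using S c by (intro exI[of _ S]) auto
qed

text \<open>The variance of the discarded part of the autoregression, applied with \<open>s\<close> slightly less
  than \<open>d\<close>. Bounding all covariances by \<open>r 0\<close> would give the exponent \<open>- 2 * s\<close>, which is just too large when
  \<open>d = 1 / 4\<close>. The gain of \<open>d - 1 / 2\<close> comes from
  splitting the inner sum at distance \<open>sqrt k\<close>: near the diagonal there are few terms, and away from it the
  covariances are small.\<close>

lemma toeplitz_form_tail_le:
  fixes a :: "nat \<Rightarrow> real"
  assumes s: "s > 0" and k: "k \<ge> 1" and d: "0 \<le> d" "d < 1 / 2" and A: "A \<ge> 0" and S: "S \<ge> 0"
    and a: "\<And>j. j \<ge> 1 \<Longrightarrow> \<bar>a j\<bar> \<le> A * real j powr (- s - 1)"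
    and r0: "\<And>h. \<bar>r h\<bar> \<le> r 0" and rS: "\<And>h. h \<noteq> 0 \<Longrightarrow> \<bar>r h\<bar> \<le> S * real_of_int \<bar>h\<bar> powr (2 * d - 1)"
  shows "toeplitz_form r {k<..<N} a \<le> A / s * (3 * A * r 0 + S * (A / s)) * real k powr (d - 1 / 2 - 2 * s)"
proof -
  \<comment> \<open>The radius that separates the near and the far part of the inner sum.\<close>
  define q where "q = nat \<lfloor>sqrt (real k)\<rfloor>"
  have r00: "r 0 \<ge> 0" using r0[of 0] by linarith
  have "1 \<le> sqrt (real k)" using k by simp
  then have qk: "real q \<le> sqrt (real k)" "sqrt (real k) \<le> real q + 1" "q \<ge> 1"
    unfolding q_def by linarith+
  define J where "J = {k<..<N}"
  have J: "finite J" "\<And>j. j \<in> J \<Longrightarrow> j > k" by (auto simp: J_def)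
  have aJ: "\<bar>a j\<bar> \<le> A * real k powr (- s - 1)" if "j \<in> J" for j
  proof -
    have "real j powr (- s - 1) \<le> real k powr (- s - 1)"
      using J(2)[OF that] k s by (intro powr_mono2') auto
    then show ?thesis using a[of j] J(2)[OF that] k A by (meson mult_left_mono le_trans less_imp_le order.trans)
  qed
  have tail: "(\<Sum>j\<in>J. \<bar>a j\<bar>) \<le> A / s * real k powr (- s)"
  proof -
    have "(\<Sum>j\<in>J. \<bar>a j\<bar>) \<le> (\<Sum>j\<in>J. A * real j powr (- s - 1))"
      using k J by (intro sum_mono a) force
    also have "\<dots> \<le> A * (real k powr (- s) / s)"
      unfolding sum_distrib_left[symmetric] J_def by (intro mult_left_mono sum_powr_tail_le s k A)
    finally show ?thesis by simp
  qed
  define B where "B = (3 * A * r 0 + S * (A / s)) * real k powr (d - 1 / 2 - s)"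
  have inner: "(\<Sum>j\<in>J. \<bar>a j\<bar> * \<bar>r (int i - int j)\<bar>) \<le> B" for i
  proof -
    define J1 where "J1 = {j\<in>J. \<bar>int i - int j\<bar> \<le> int q}"
    define J2 where "J2 = {j\<in>J. \<not> \<bar>int i - int j\<bar> \<le> int q}"
    have "J1 \<subseteq> {i - q..i + q}" by (auto simp: J1_def)
    then have "card J1 \<le> card {i - q..i + q}" by (intro card_mono) auto
    then have cJ1: "card J1 \<le> 2 * q + 1" by simp
    have "(\<Sum>j\<in>J1. \<bar>a j\<bar> * \<bar>r (int i - int j)\<bar>) \<le> (\<Sum>j\<in>J1. A * real k powr (- s - 1) * r 0)"
      using aJ r0 A r00 by (intro sum_mono mult_mono) (auto simp: J1_def)
    also have "\<dots> = real (card J1) * (A * real k powr (- s - 1) * r 0)" by simp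
    also have "\<dots> \<le> (3 * sqrt (real k)) * (A * real k powr (- s - 1) * r 0)"
      using cJ1 qk A r00 by (intro mult_right_mono) auto
    also have "\<dots> = 3 * A * r 0 * (real k powr (1 / 2) * real k powr (- s - 1))"
      using k by (simp add: powr_half_sqrt)
    also have "\<dots> = 3 * A * r 0 * real k powr (- 1 / 2 - s)"
    proof -
      have "1 / 2 + (- s - 1) = - 1 / 2 - s" by simp
      then show ?thesis by (simp only: powr_add[symmetric])
    qed
    also have "\<dots> \<le> 3 * A * r 0 * real k powr (d - 1 / 2 - s)"
      using k d A r00 by (intro mult_left_mono powr_mono) auto
    finally have 1: "(\<Sum>j\<in>J1. \<bar>a j\<bar> * \<bar>r (int i - int j)\<bar>) \<le> 3 * A * r 0 * real k powr (d - 1 / 2 - s)" .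
    have far: "\<bar>r (int i - int j)\<bar> \<le> S * real k powr (d - 1 / 2)" if "j \<in> J2" for j
    proof -
      have "real_of_int \<bar>int i - int j\<bar> \<ge> real q + 1" using that by (auto simp: J2_def)
      then have ge: "real_of_int \<bar>int i - int j\<bar> \<ge> sqrt (real k)" using qk by linarith
      have "int i - int j \<noteq> 0" using that by (auto simp: J2_def)
      then have "\<bar>r (int i - int j)\<bar> \<le> S * real_of_int \<bar>int i - int j\<bar> powr (2 * d - 1)" by (rule rS)
      also have "\<dots> \<le> S * sqrt (real k) powr (2 * d - 1)"
        using ge k d S by (intro mult_left_mono powr_mono2') auto
      also have "sqrt (real k) powr (2 * d - 1) = real k powr (d - 1 / 2)"
        using k by (simp add: powr_half_sqrt[symmetric] powr_powr algebra_simps)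
      finally show ?thesis .
    qed
    have "(\<Sum>j\<in>J2. \<bar>a j\<bar> * \<bar>r (int i - int j)\<bar>) \<le> (\<Sum>j\<in>J2. \<bar>a j\<bar> * (S * real k powr (d - 1 / 2)))"
      using far by (intro sum_mono mult_left_mono) auto
    also have "\<dots> \<le> (\<Sum>j\<in>J. \<bar>a j\<bar> * (S * real k powr (d - 1 / 2)))"
      using J S by (intro sum_mono2) (auto simp: J2_def)
    also have "\<dots> \<le> A / s * real k powr (- s) * (S * real k powr (d - 1 / 2))"
      unfolding sum_distrib_right[symmetric] using tail S by (intro mult_right_mono) auto
    also have "\<dots> = S * (A / s) * (real k powr (- s) * real k powr (d - 1 / 2))" by simp
    also have "\<dots> = S * (A / s) * real k powr (d - 1 / 2 - s)"
      by (simp only: powr_add[symmetric]) (simp add: algebra_simps)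
    finally have 2: "(\<Sum>j\<in>J2. \<bar>a j\<bar> * \<bar>r (int i - int j)\<bar>) \<le> S * (A / s) * real k powr (d - 1 / 2 - s)" .
    have "(\<Sum>j\<in>J. \<bar>a j\<bar> * \<bar>r (int i - int j)\<bar>)
       = (\<Sum>j\<in>J1. \<bar>a j\<bar> * \<bar>r (int i - int j)\<bar>) + (\<Sum>j\<in>J2. \<bar>a j\<bar> * \<bar>r (int i - int j)\<bar>)"
      unfolding J1_def J2_def using J by (subst sum.union_disjoint[symmetric]) (auto intro!: sum.cong)
    then show ?thesis using 1 2 by (simp add: B_def algebra_simps)
  qed
  have B0: "B \<ge> 0" using A S s r00 by (simp add: B_def)
  have "toeplitz_form r J a \<le> (\<Sum>i\<in>J. \<Sum>j\<in>J. \<bar>a i\<bar> * (\<bar>a j\<bar> * \<bar>r (int i - int j)\<bar>))"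
    unfolding toeplitz_form_def
    by (intro sum_mono) (simp add: abs_mult[symmetric] mult.assoc)
  also have "\<dots> = (\<Sum>i\<in>J. \<bar>a i\<bar> * (\<Sum>j\<in>J. \<bar>a j\<bar> * \<bar>r (int i - int j)\<bar>))"
    by (simp add: sum_distrib_left)
  also have "\<dots> \<le> (\<Sum>i\<in>J. \<bar>a i\<bar> * B)"
    by (intro sum_mono mult_left_mono inner) auto
  also have "\<dots> \<le> A / s * real k powr (- s) * B"
    unfolding sum_distrib_right[symmetric] using tail B0 by (intro mult_right_mono)
  also have "\<dots> = A / s * (3 * A * r 0 + S * (A / s)) * (real k powr (- s) * real k powr (d - 1 / 2 - s))"
    by (simp add: B_def)
  also have "\<dots> = A / s * (3 * A * r 0 + S * (A / s)) * real k powr (d - 1 / 2 - 2 * s)"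
    by (simp only: powr_add[symmetric]) (simp add: algebra_simps)
  finally show ?thesis by (simp add: J_def)
qed

text \<open>The coefficients \<open>(1, - ak k 1, \<dots>, - ak k k)\<close> are compared with the truncated
  autoregression, whose sum is bounded because \<open>a\<close> is summable. The difference \<open>D\<close> represents, up to sign,
  the projection of the discarded tail of the autoregression onto \<open>k\<close> observations, so its quadratic form
  is at most the variance of that tail, of order \<open>k powr (2 * d - 1)\<close>. Passing from the form at \<open>D\<close> to
  the square of the sum of its entries costs the factor \<open>k powr (1 - 2 * d)\<close>, which compensates this order.\<close>

lemma (in long_memory_process) sum_predictor_coefficients_bounded:
  assumes d: "1 / 4 \<le> d" "d < 1 / 2"
    and asym: "(\<lambda>j. \<sigma> (int j)) \<sim>[at_top] (\<lambda>j. lam * real j powr (2 * d - 1))"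
    and psd: "\<And>I w. finite I \<Longrightarrow> 0 \<le> toeplitz_form \<sigma> I w"
    and C: "C > 0" "\<And>k w. k \<ge> 1 \<Longrightarrow> (\<Sum>i=1..k. w i)\<^sup>2 \<le> C * real k powr (1 - 2 * d) * toeplitz_form \<sigma> {1..k} w"
    and ak: "\<And>k. yule_walker \<sigma> k (ak k)"
  shows "\<exists>P. \<forall>k\<ge>1. \<bar>1 - (\<Sum>i=1..k. ak k i)\<bar> \<le> P"
proof -
  \<comment> \<open>Any exponent margin below \<open>1 / 8\<close> suffices; \<open>d \<ge> 1 / 4\<close> leaves that much room.\<close>
  obtain A0 where A0: "\<And>j. j \<ge> 1 \<Longrightarrow> \<bar>a j\<bar> \<le> A0 * real j powr (- d - 1 + 1 / 16)"
    using coefficient_bounds[of "1 / 16"] by auto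
  define A where "A = max A0 0"
  define s where "s = d - 1 / 16"
  have s: "s > 0" using d by (simp add: s_def)
  have A: "A \<ge> 0" "\<bar>a j\<bar> \<le> A * real j powr (- s - 1)" if "j \<ge> 1" for j
  proof -
    have "A0 * real j powr (- s - 1) \<le> A * real j powr (- s - 1)" by (intro mult_right_mono) (auto simp: A_def)
    then show "\<bar>a j\<bar> \<le> A * real j powr (- s - 1)" using A0[OF that] by (simp add: s_def algebra_simps)
  qed (simp add: A_def)
  have A_nonneg: "A \<ge> 0" by (simp add: A_def)
  obtain S where S: "S \<ge> 0" "\<And>j. j \<ge> 1 \<Longrightarrow> \<bar>\<sigma> (int j)\<bar> \<le> S * real j powr (2 * d - 1)"
    using asymp_equiv_powr_bound[OF asym] by blast
  have S': "\<bar>\<sigma> h\<bar> \<le> S * real_of_int \<bar>h\<bar> powr (2 * d - 1)" if "h \<noteq> 0" for h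
  proof -
    have "\<sigma> \<bar>h\<bar> = \<sigma> h" using autocovariance_sym[of h] by (auto simp: abs_if)
    then show ?thesis using S(2)[of "nat \<bar>h\<bar>"] that by simp
  qed
  define V where "V = A / s * (3 * A * \<sigma> 0 + S * (A / s))"
  have s0: "\<sigma> 0 \<ge> 0" using abs_autocovariance_le[of 0] by linarith
  have V0: "V \<ge> 0" using s s0 S A_nonneg by (simp add: V_def)
  have V: "toeplitz_form \<sigma> {k<..<N} a \<le> V * real k powr (2 * d - 1)" if k: "k \<ge> 1" for k N
  proof -
    have "toeplitz_form \<sigma> {k<..<N} a \<le> V * real k powr (d - 1 / 2 - 2 * s)"
      unfolding V_def using d s S(1) A A_nonneg k S'
      by (intro toeplitz_form_tail_le abs_autocovariance_le) auto
    also have "\<dots> \<le> V * real k powr (2 * d - 1)"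
      using d k V0 by (intro mult_left_mono powr_mono) (auto simp: s_def)
    finally show ?thesis .
  qed
  define P where "P = (\<Sum>j. \<bar>a j\<bar>) + (C * V + 1)"
  have "\<bar>1 - (\<Sum>i=1..k. ak k i)\<bar> \<le> P" if k: "k \<ge> 1" for k
  proof -
    define D where "D = (\<lambda>i. - ak k i - a i)"
    define Q where "Q = toeplitz_form \<sigma> {1..k} D"
    have row: "(\<Sum>i=1..k. D i * \<sigma> (int i - int j)) = - (\<Sum>i<Suc k. a i * \<sigma> (int i - int j))" if "j \<in> {1..k}" for j
    proof -
      have "(\<Sum>i=1..k. ak k i * \<sigma> (int i - int j)) = \<sigma> (int j)"
        using ak that unfolding yule_walker_def by blast
      moreover have "(\<Sum>i<Suc k. a i * \<sigma> (int i - int j)) = \<sigma> (int j) + (\<Sum>i=1..k. a i * \<sigma> (int i - int j))"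
        unfolding lessThan_Suc_atMost atMost_atLeast0
        by (simp add: sum.atLeast_Suc_atMost[of 0] a_0 autocovariance_sym)
      ultimately show ?thesis
        by (simp add: D_def left_diff_distrib sum_subtractf sum_negf del: sum.lessThan_Suc)
    qed
    \<comment> \<open>The cross term between \<open>D\<close> and the tail tends to \<open>- Q\<close>, so nonnegativity of the joint form gives
      \<open>Q \<le> V * k powr (2 * d - 1)\<close> in the limit.\<close>
    define cross where "cross = (\<lambda>N. \<Sum>j=1..k. D j * (\<Sum>i\<in>{k<..<N}. - a i * \<sigma> (int i - int j)))"
    have inner: "(\<lambda>N. \<Sum>i\<in>{k<..<N}. - a i * \<sigma> (int i - int j)) \<longlonglongrightarrow> - (\<Sum>i=1..k. D i * \<sigma> (int i - int j))"
      if j: "j \<in> {1..k}" for j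
    proof -
      have "(\<lambda>N. (\<Sum>i<Suc k. a i * \<sigma> (int i - int j)) - (\<Sum>i<N. a i * \<sigma> (int i - int j))) \<longlonglongrightarrow> (\<Sum>i<Suc k. a i * \<sigma> (int i - int j)) - 0"
        using j by (intro tendsto_diff tendsto_const autoregression_normal_equations) auto
      moreover have "\<forall>\<^sub>F N in sequentially. (\<Sum>i<Suc k. a i * \<sigma> (int i - int j)) - (\<Sum>i<N. a i * \<sigma> (int i - int j))
          = (\<Sum>i\<in>{k<..<N}. - a i * \<sigma> (int i - int j))"
        using eventually_gt_at_top[of k]
      proof eventually_elim
        case (elim N)
        then have split: "{..<N} = {..<Suc k} \<union> {k<..<N}" by auto
        have "(\<Sum>i<N. a i * \<sigma> (int i - int j)) = (\<Sum>i<Suc k. a i * \<sigma> (int i - int j)) + (\<Sum>i\<in>{k<..<N}. a i * \<sigma> (int i - int j))"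
          unfolding split by (rule sum.union_disjoint) auto
        then show ?case by (simp add: sum_negf del: sum.lessThan_Suc)
      qed
      ultimately have "(\<lambda>N. \<Sum>i\<in>{k<..<N}. - a i * \<sigma> (int i - int j)) \<longlonglongrightarrow> (\<Sum>i<Suc k. a i * \<sigma> (int i - int j)) - 0"
        by (rule Lim_transform_eventually)
      then show ?thesis using row[OF j] by (simp del: sum.lessThan_Suc)
    qed
    have "cross \<longlonglongrightarrow> (\<Sum>j=1..k. D j * (- (\<Sum>i=1..k. D i * \<sigma> (int i - int j))))"
      unfolding cross_def by (intro tendsto_sum tendsto_mult tendsto_const inner)
    then have cross: "cross \<longlonglongrightarrow> - Q" by (simp add: Q_def toeplitz_form_rows sum_negf)
    have "0 \<le> Q + V * real k powr (2 * d - 1) + 2 * cross N" for N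
    proof -
      define w where "w = (\<lambda>i. if i \<le> k then D i else - a i)"
      have "0 \<le> toeplitz_form \<sigma> ({1..k} \<union> {k<..<N}) w" by (intro psd) auto
      also have "\<dots> = toeplitz_form \<sigma> {1..k} w + toeplitz_form \<sigma> {k<..<N} w
          + 2 * (\<Sum>j=1..k. w j * (\<Sum>i\<in>{k<..<N}. w i * \<sigma> (int i - int j)))"
        by (intro toeplitz_form_Un autocovariance_sym) auto
      also have "toeplitz_form \<sigma> {1..k} w = Q"
        unfolding Q_def toeplitz_form_def by (intro sum.cong refl) (auto simp: w_def)
      also have "toeplitz_form \<sigma> {k<..<N} w = toeplitz_form \<sigma> {k<..<N} a"
        unfolding toeplitz_form_def by (intro sum.cong refl) (auto simp: w_def)
      also have "(\<Sum>j=1..k. w j * (\<Sum>i\<in>{k<..<N}. w i * \<sigma> (int i - int j))) = cross N"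
        unfolding cross_def by (intro sum.cong arg_cong2[where f="(*)"]) (auto simp: w_def)
      finally show ?thesis using V[OF k, of N] by simp
    qed
    then have "0 \<le> Q + V * real k powr (2 * d - 1) + 2 * (- Q)"
      by (intro LIMSEQ_le_const[OF tendsto_add[OF tendsto_const tendsto_mult[OF tendsto_const cross]]]) auto
    then have "Q \<le> V * real k powr (2 * d - 1)" by simp
    then have "C * real k powr (1 - 2 * d) * Q \<le> C * real k powr (1 - 2 * d) * (V * real k powr (2 * d - 1))"
      using C by (intro mult_left_mono) auto
    also have "\<dots> = C * V * (real k powr (1 - 2 * d) * real k powr (2 * d - 1))" by simp
    also have "\<dots> = C * V" using k by (simp add: powr_add[symmetric])
    finally have "(\<Sum>i=1..k. D i)\<^sup>2 \<le> C * V" using C(2)[OF k, of D] unfolding Q_def by linarith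
    also have "\<dots> \<le> (C * V + 1)\<^sup>2" using C V0 by (simp add: power2_eq_square algebra_simps)
    finally have "\<bar>\<Sum>i=1..k. D i\<bar> \<le> C * V + 1"
      using C V0 by (simp add: abs_le_square_iff[symmetric])
    moreover have "1 - (\<Sum>i=1..k. ak k i) = (\<Sum>i<Suc k. a i) + (\<Sum>i=1..k. D i)"
      unfolding lessThan_Suc_atMost atMost_atLeast0
      by (simp add: D_def sum.atLeast_Suc_atMost[of 0] a_0 sum_subtractf sum_negf)
    moreover have "\<bar>\<Sum>i<Suc k. a i\<bar> \<le> (\<Sum>j. \<bar>a j\<bar>)"
      using a_summable by (intro order.trans[OF sum_abs] sum_le_suminf) auto
    ultimately show ?thesis unfolding P_def by linarith
  qed
  then show ?thesis by blast
qed

section \<open>Second moments of Gaussian empirical covariances\<close>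

lemma (in prob_space) centered_gaussian_fourth_moment:
  assumes Z: "gaussian_rv M Z" "expectation Z = 0"
  shows "Z \<in> borel_measurable M" "integrable M (\<lambda>\<omega>. (Z \<omega>)\<^sup>2)" "integrable M (\<lambda>\<omega>. (Z \<omega>) ^ 4)"
    and "expectation (\<lambda>\<omega>. (Z \<omega>) ^ 4) = 3 * (expectation (\<lambda>\<omega>. (Z \<omega>)\<^sup>2))\<^sup>2"
proof -
  have "Z \<in> borel_measurable M \<and> integrable M (\<lambda>\<omega>. (Z \<omega>)\<^sup>2) \<and> integrable M (\<lambda>\<omega>. (Z \<omega>) ^ 4) \<and>
    expectation (\<lambda>\<omega>. (Z \<omega>) ^ 4) = 3 * (expectation (\<lambda>\<omega>. (Z \<omega>)\<^sup>2))\<^sup>2"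
    using Z(1) unfolding gaussian_rv_def
  proof (elim disjE exE conjE)
    fix \<mu> s :: real
    assume s: "s > 0" and D: "distributed M lborel Z (\<lambda>x. ennreal (normal_density \<mu> s x))"
    have mu: "\<mu> = 0" using normal_distributed_expectation[OF s D] Z(2) by simp
    have h: "has_bochner_integral lborel (\<lambda>x. normal_density \<mu> s x * x ^ (2 * k)) (fact (2 * k) / ((2 / s\<^sup>2) ^ k * fact k))" for k
      using normal_moment_even[OF s, of \<mu> k] by (simp add: mu)
    have i: "integrable M (\<lambda>\<omega>. Z \<omega> ^ (2 * k))" for k
      using h[of k] by (subst distributed_integrable[OF D, symmetric]) (auto simp: has_bochner_integral_iff)
    have e: "expectation (\<lambda>\<omega>. Z \<omega> ^ (2 * k)) = fact (2 * k) / ((2 / s\<^sup>2) ^ k * fact k)" for k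
      using h[of k] by (subst distributed_integral[OF D, symmetric]) (auto simp: has_bochner_integral_iff)
    have "expectation (\<lambda>\<omega>. (Z \<omega>)\<^sup>2) = s\<^sup>2" using e[of 1] s by simp
    moreover have "expectation (\<lambda>\<omega>. (Z \<omega>) ^ 4) = 3 * (s\<^sup>2)\<^sup>2"
      using e[of 2] s by (simp add: fact_numeral field_simps)
    ultimately show ?thesis using i[of 1] i[of 2] distributed_measurable[OF D] by simp
  next
    fix \<mu> :: real
    assume m: "Z \<in> borel_measurable M" and ae: "AE \<omega> in M. Z \<omega> = \<mu>"
    have "expectation Z = expectation (\<lambda>_. \<mu>)" using ae m by (intro integral_cong_AE) auto
    then have "\<mu> = 0" using Z(2) by (simp add: prob_space)
    with ae have ae: "AE \<omega> in M. Z \<omega> ^ n = 0" if "n > 0" for n using that by auto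
    have "integrable M (\<lambda>\<omega>. Z \<omega> ^ n) \<and> expectation (\<lambda>\<omega>. Z \<omega> ^ n) = 0" if "n > 0" for n
      using ae[OF that] m
      by (subst integrable_cong_AE[where g="\<lambda>_. 0"], simp_all, subst integral_cong_AE[where g="\<lambda>_. 0"]) auto
    then show ?thesis using m by simp
  qed
  then show "Z \<in> borel_measurable M" "integrable M (\<lambda>\<omega>. (Z \<omega>)\<^sup>2)" "integrable M (\<lambda>\<omega>. (Z \<omega>) ^ 4)"
    and "expectation (\<lambda>\<omega>. (Z \<omega>) ^ 4) = 3 * (expectation (\<lambda>\<omega>. (Z \<omega>)\<^sup>2))\<^sup>2" by auto
qed

lemma gaussian_processD:
  "gaussian_process M X \<Longrightarrow> finite I \<Longrightarrow> gaussian_rv M (\<lambda>\<omega>. \<Sum>i\<in>I. c i * X i \<omega>)"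
  by (simp add: gaussian_process_def)

locale stationary_gaussian = prob_space M for M :: "'a measure" +
  fixes z :: "int \<Rightarrow> 'a \<Rightarrow> real" and \<gamma> :: "int \<Rightarrow> real"
  assumes gaussian: "gaussian_process M z"
    and mean_zero: "\<And>n. expectation (z n) = 0"
    and covariance: "\<And>m n. expectation (\<lambda>\<omega>. z m \<omega> * z n \<omega>) = \<gamma> (n - m)"
begin

lemma gaussian_single: "gaussian_rv M (z n)"
  using gaussian_processD[OF gaussian, of "{n}" "\<lambda>_. 1"] by simp

lemmas single = centered_gaussian_fourth_moment[OF gaussian_single mean_zero]

lemma integrable_single: "integrable M (z n)"
  using square_integrable_imp_integrable[OF single(1,2)] .

lemma integrable_mult: "integrable M (\<lambda>\<omega>. z m \<omega> * z n \<omega>)"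
  by (intro integrable_mult_of_squares single)

lemma integrable_mult_squares: "integrable M (\<lambda>\<omega>. (z m \<omega>)\<^sup>2 * (z n \<omega>)\<^sup>2)"
  by (intro integrable_mult_of_squares) (use single in \<open>auto simp: power_mult[symmetric]\<close>)

lemma variance_eq: "expectation (\<lambda>\<omega>. (z n \<omega>)\<^sup>2) = \<gamma> 0"
  using covariance[of n n] by (simp add: power2_eq_square)

text \<open>Both \<open>z m + z n\<close> and \<open>z m - z n\<close> are Gaussian, so their fourth moments are known; the
  mixed moment follows by polarization.\<close>

lemma mixed_fourth_moment:
  "expectation (\<lambda>\<omega>. (z m \<omega>)\<^sup>2 * (z n \<omega>)\<^sup>2) = (\<gamma> 0)\<^sup>2 + 2 * (\<gamma> (n - m))\<^sup>2"
proof (cases "m = n")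
  case True
  then show ?thesis using single(4)[of n] variance_eq[of n] by (simp add: power_add[symmetric])
next
  case False
  have comb: "gaussian_rv M (\<lambda>\<omega>. z m \<omega> + c * z n \<omega>)" for c
  proof -
    have "gaussian_rv M (\<lambda>\<omega>. \<Sum>i\<in>{m, n}. (if i = m then 1 else c) * z i \<omega>)"
      by (rule gaussian_processD[OF gaussian]) simp
    then show ?thesis using False by simp
  qed
  have m0: "expectation (\<lambda>\<omega>. z m \<omega> + c * z n \<omega>) = 0" for c
    using integrable_single by (simp add: mean_zero)
  note W = centered_gaussian_fourth_moment[OF comb m0]
  have W2: "expectation (\<lambda>\<omega>. (z m \<omega> + c * z n \<omega>)\<^sup>2) = (1 + c\<^sup>2) * \<gamma> 0 + 2 * c * \<gamma> (n - m)" for c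
  proof -
    have "(\<lambda>\<omega>. (z m \<omega> + c * z n \<omega>)\<^sup>2) = (\<lambda>\<omega>. (z m \<omega>)\<^sup>2 + c\<^sup>2 * (z n \<omega>)\<^sup>2 + 2 * c * (z m \<omega> * z n \<omega>))"
      by (simp add: power2_eq_square algebra_simps)
    then show ?thesis
      using single(2) integrable_mult by (simp add: variance_eq covariance algebra_simps)
  qed
  have "expectation (\<lambda>\<omega>. (z m \<omega> + 1 * z n \<omega>) ^ 4 + (z m \<omega> + (- 1) * z n \<omega>) ^ 4)
      = expectation (\<lambda>\<omega>. 2 * z m \<omega> ^ 4 + 12 * ((z m \<omega>)\<^sup>2 * (z n \<omega>)\<^sup>2) + 2 * z n \<omega> ^ 4)"
    by (intro Bochner_Integration.integral_cong refl) (simp add: power2_eq_square power4_eq_xxxx algebra_simps)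
  also have "\<dots> = 2 * (3 * (\<gamma> 0)\<^sup>2) + 12 * expectation (\<lambda>\<omega>. (z m \<omega>)\<^sup>2 * (z n \<omega>)\<^sup>2) + 2 * (3 * (\<gamma> 0)\<^sup>2)"
    using single(3) integrable_mult_squares by (simp add: single(4) variance_eq)
  also have "expectation (\<lambda>\<omega>. (z m \<omega> + 1 * z n \<omega>) ^ 4 + (z m \<omega> + (- 1) * z n \<omega>) ^ 4)
      = expectation (\<lambda>\<omega>. (z m \<omega> + 1 * z n \<omega>) ^ 4) + expectation (\<lambda>\<omega>. (z m \<omega> + (- 1) * z n \<omega>) ^ 4)"
    by (rule Bochner_Integration.integral_add[OF W(3) W(3)])
  finally show ?thesis unfolding W(4) W2 by (simp add: power2_eq_square algebra_simps)
qed

lemma centered_squares_second_moment: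
  assumes I: "finite I"
  shows "integrable M (\<lambda>\<omega>. (\<Sum>t\<in>I. (z t \<omega>)\<^sup>2 - \<gamma> 0)\<^sup>2)"
    and "expectation (\<lambda>\<omega>. (\<Sum>t\<in>I. (z t \<omega>)\<^sup>2 - \<gamma> 0)\<^sup>2) = 2 * (\<Sum>s\<in>I. \<Sum>t\<in>I. (\<gamma> (t - s))\<^sup>2)"
proof -
  have eq: "(\<lambda>\<omega>. (\<Sum>t\<in>I. (z t \<omega>)\<^sup>2 - \<gamma> 0)\<^sup>2)
     = (\<lambda>\<omega>. \<Sum>s\<in>I. \<Sum>t\<in>I. (z s \<omega>)\<^sup>2 * (z t \<omega>)\<^sup>2 - \<gamma> 0 * (z s \<omega>)\<^sup>2 - \<gamma> 0 * (z t \<omega>)\<^sup>2 + (\<gamma> 0)\<^sup>2)"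
  proof
    fix \<omega>
    have "(\<Sum>t\<in>I. (z t \<omega>)\<^sup>2 - \<gamma> 0)\<^sup>2 = (\<Sum>s\<in>I. \<Sum>t\<in>I. ((z s \<omega>)\<^sup>2 - \<gamma> 0) * ((z t \<omega>)\<^sup>2 - \<gamma> 0))"
      by (simp only: power2_eq_square[of "sum _ _"] sum_product)
    also have "\<dots> = (\<Sum>s\<in>I. \<Sum>t\<in>I. (z s \<omega>)\<^sup>2 * (z t \<omega>)\<^sup>2 - \<gamma> 0 * (z s \<omega>)\<^sup>2 - \<gamma> 0 * (z t \<omega>)\<^sup>2 + (\<gamma> 0)\<^sup>2)"
      by (intro sum.cong refl) (simp add: algebra_simps power2_eq_square[of "\<gamma> 0"])
    finally show "(\<Sum>t\<in>I. (z t \<omega>)\<^sup>2 - \<gamma> 0)\<^sup>2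
      = (\<Sum>s\<in>I. \<Sum>t\<in>I. (z s \<omega>)\<^sup>2 * (z t \<omega>)\<^sup>2 - \<gamma> 0 * (z s \<omega>)\<^sup>2 - \<gamma> 0 * (z t \<omega>)\<^sup>2 + (\<gamma> 0)\<^sup>2)" .
  qed
  have i: "integrable M (\<lambda>\<omega>. (z s \<omega>)\<^sup>2 * (z t \<omega>)\<^sup>2 - \<gamma> 0 * (z s \<omega>)\<^sup>2 - \<gamma> 0 * (z t \<omega>)\<^sup>2 + (\<gamma> 0)\<^sup>2)" for s t
    using integrable_mult_squares single(2) by simp
  have e: "expectation (\<lambda>\<omega>. (z s \<omega>)\<^sup>2 * (z t \<omega>)\<^sup>2 - \<gamma> 0 * (z s \<omega>)\<^sup>2 - \<gamma> 0 * (z t \<omega>)\<^sup>2 + (\<gamma> 0)\<^sup>2)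
     = 2 * (\<gamma> (t - s))\<^sup>2" for s t
    using integrable_mult_squares single(2)
    by (simp add: mixed_fourth_moment variance_eq prob_space) (simp add: power2_eq_square)
  show "integrable M (\<lambda>\<omega>. (\<Sum>t\<in>I. (z t \<omega>)\<^sup>2 - \<gamma> 0)\<^sup>2)"
    unfolding eq by (intro Bochner_Integration.integrable_sum i)
  show "expectation (\<lambda>\<omega>. (\<Sum>t\<in>I. (z t \<omega>)\<^sup>2 - \<gamma> 0)\<^sup>2) = 2 * (\<Sum>s\<in>I. \<Sum>t\<in>I. (\<gamma> (t - s))\<^sup>2)"
    unfolding eq using i by (simp add: e sum_distrib_left)
qed

lemma gamma_sym: "\<gamma> (- h) = \<gamma> h"
  using covariance[of 0 h] covariance[of h 0] by (simp add: mult.commute)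

end

lemma sum_nat_eq_sum_int: "(\<Sum>t=1..N. f (int t)) = (\<Sum>t\<in>{1..int N}. (f t :: real))"
  by (rule sum.reindex_bij_witness[of _ nat int]) auto

text \<open>Each lag \<open>h\<close> occurs at most \<open>2 * N\<close> times in a square of side \<open>N\<close>.\<close>

lemma double_sum_lag_le:
  fixes g :: "int \<Rightarrow> real"
  assumes g: "\<And>h. 0 \<le> g h" "\<And>h. g (- h) = g h"
  shows "(\<Sum>s\<in>{1..int N}. \<Sum>t\<in>{1..int N}. g (t - s)) \<le> 2 * real N * (\<Sum>h<N. g (int h))"
proof -
  have half: "(\<Sum>t\<in>T. g (\<bar>t - s\<bar>)) \<le> (\<Sum>h<N. g (int h))"
    if T: "T \<subseteq> {1..int N}" "s \<in> {1..int N}" "inj_on (\<lambda>t. nat \<bar>t - s\<bar>) T" for T s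
  proof -
    have "(\<Sum>t\<in>T. g (\<bar>t - s\<bar>)) = (\<Sum>h\<in>(\<lambda>t. nat \<bar>t - s\<bar>) ` T. g (int h))"
      by (simp add: sum.reindex[OF T(3)])
    also have "\<dots> \<le> (\<Sum>h<N. g (int h))"
    proof (intro sum_mono2)
      show "(\<lambda>t. nat \<bar>t - s\<bar>) ` T \<subseteq> {..<N}"
      proof (rule image_subsetI)
        fix t assume "t \<in> T"
        with T(1) have "t \<in> {1..int N}" by blast
        with T(2) have "\<bar>t - s\<bar> < int N" by auto
        then show "nat \<bar>t - s\<bar> \<in> {..<N}" by (simp add: nat_less_iff)
      qed
    qed (use g(1) in auto)
    finally show ?thesis .
  qed
  have "(\<Sum>t\<in>{1..int N}. g (t - s)) \<le> 2 * (\<Sum>h<N. g (int h))" if s: "s \<in> {1..int N}" for s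
  proof -
    have "(\<Sum>t\<in>{1..int N}. g (t - s)) = (\<Sum>t\<in>{1..int N}. g \<bar>t - s\<bar>)"
      using g(2)[of "_ - s"] by (intro sum.cong) (auto simp: abs_if)
    also have "\<dots> = (\<Sum>t\<in>{1..s} \<union> {s<..int N}. g \<bar>t - s\<bar>)"
      using s by (intro sum.cong) auto
    also have "\<dots> = (\<Sum>t\<in>{1..s}. g \<bar>t - s\<bar>) + (\<Sum>t\<in>{s<..int N}. g \<bar>t - s\<bar>)"
      by (rule sum.union_disjoint) auto
    also have "\<dots> \<le> (\<Sum>h<N. g (int h)) + (\<Sum>h<N. g (int h))"
      using s by (intro add_mono half) (auto simp: inj_on_def)
    finally show ?thesis by simp
  qed
  then have "(\<Sum>s\<in>{1..int N}. \<Sum>t\<in>{1..int N}. g (t - s)) \<le> (\<Sum>s\<in>{1..int N}. 2 * (\<Sum>h<N. g (int h)))"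
    by (rule sum_mono)
  then show ?thesis by simp
qed

lemma gaussian_process_increments:
  fixes Y :: "int \<Rightarrow> 'a \<Rightarrow> real"
  assumes "gaussian_process M Y"
  shows "gaussian_process M (\<lambda>t \<omega>. Y (t + h) \<omega> - Y t \<omega>)"
  unfolding gaussian_process_def
proof (intro allI impI)
  fix I :: "int set" and c
  assume I: "finite I"
  define J where "J = I \<union> (\<lambda>t. t + h) ` I"
  define e where "e = (\<lambda>j. (if j - h \<in> I then c (j - h) else 0) - (if j \<in> I then c j else (0::real)))"
  have shift: "(\<lambda>t. t + h) ` I = {j. j - h \<in> I}"
    by (force simp: image_iff)
  have "(\<Sum>i\<in>I. c i * (Y (i + h) \<omega> - Y i \<omega>)) = (\<Sum>j\<in>J. e j * Y j \<omega>)" for \<omega>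
  proof -
    have "(\<Sum>j\<in>J. (if j - h \<in> I then c (j - h) else 0) * Y j \<omega>) = (\<Sum>j\<in>(\<lambda>t. t + h) ` I. c (j - h) * Y j \<omega>)"
      using I by (intro sum.mono_neutral_cong_right) (auto simp: J_def shift[symmetric], auto simp: shift)
    also have "\<dots> = (\<Sum>i\<in>I. c i * Y (i + h) \<omega>)"
      by (subst sum.reindex) (auto simp: inj_on_def)
    finally have 1: "(\<Sum>j\<in>J. (if j - h \<in> I then c (j - h) else 0) * Y j \<omega>) = (\<Sum>i\<in>I. c i * Y (i + h) \<omega>)" .
    have 2: "(\<Sum>j\<in>J. (if j \<in> I then c j else 0) * Y j \<omega>) = (\<Sum>i\<in>I. c i * Y i \<omega>)"
      using I by (intro sum.mono_neutral_cong_right) (auto simp: J_def)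
    show ?thesis
      unfolding e_def left_diff_distrib sum_subtractf 1 2 by (simp add: right_diff_distrib sum_subtractf)
  qed
  moreover have "gaussian_rv M (\<lambda>\<omega>. \<Sum>j\<in>J. e j * Y j \<omega>)"
    using I by (intro gaussian_processD[OF assms]) (simp add: J_def)
  ultimately show "gaussian_rv M (\<lambda>\<omega>. \<Sum>i\<in>I. c i * (Y (i + h) \<omega> - Y i \<omega>))" by simp
qed

text \<open>The autocovariance at lag \<open>n\<close> of \<open>Y (t + h) - Y t\<close> when \<open>\<sigma>\<close> is that of \<open>Y\<close>: a second
  difference, hence of smaller order than \<open>\<sigma>\<close> itself if \<open>\<sigma>\<close> decays like a power.\<close>

definition increment_autocovariance :: "(int \<Rightarrow> real) \<Rightarrow> int \<Rightarrow> int \<Rightarrow> real" where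
  "increment_autocovariance \<sigma> h n = 2 * \<sigma> n - \<sigma> (n + h) - \<sigma> (n - h)"

context stationary_gaussian
begin

lemma increments: "stationary_gaussian M (\<lambda>t \<omega>. z (t + h) \<omega> - z t \<omega>) (increment_autocovariance \<gamma> h)"
proof unfold_locales
  show "gaussian_process M (\<lambda>t \<omega>. z (t + h) \<omega> - z t \<omega>)"
    by (rule gaussian_process_increments[OF gaussian])
  show "expectation (\<lambda>\<omega>. z (n + h) \<omega> - z n \<omega>) = 0" for n
    using integrable_single by (simp add: mean_zero)
  show "expectation (\<lambda>\<omega>. (z (m + h) \<omega> - z m \<omega>) * (z (n + h) \<omega> - z n \<omega>)) = increment_autocovariance \<gamma> h (n - m)" for m n
    using integrable_mult
    using gamma_sym[of "n - (h + m)"]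
    by (simp add: left_diff_distrib right_diff_distrib covariance increment_autocovariance_def algebra_simps)
qed

lemma empirical_variance_error:
  shows "integrable M (\<lambda>\<omega>. (\<Sum>t\<in>{1..int N}. (z t \<omega>)\<^sup>2 - \<gamma> 0)\<^sup>2)"
    and "expectation (\<lambda>\<omega>. (\<Sum>t\<in>{1..int N}. (z t \<omega>)\<^sup>2 - \<gamma> 0)\<^sup>2) \<le> 4 * real N * (\<Sum>h<N. (\<gamma> (int h))\<^sup>2)"
  using centered_squares_second_moment[of "{1..int N}"] double_sum_lag_le[of "\<lambda>h. (\<gamma> h)\<^sup>2" N]
  by (auto simp: gamma_sym)

lemma sum_squares_second_moment:
  assumes I: "finite I"
  shows "integrable M (\<lambda>\<omega>. (\<Sum>t\<in>I. (z t \<omega>)\<^sup>2)\<^sup>2)"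
    and "expectation (\<lambda>\<omega>. (\<Sum>t\<in>I. (z t \<omega>)\<^sup>2)\<^sup>2) \<le> (real (card I))\<^sup>2 * (3 * (\<gamma> 0)\<^sup>2)"
proof -
  have eq: "(\<lambda>\<omega>. (\<Sum>t\<in>I. (z t \<omega>)\<^sup>2)\<^sup>2) = (\<lambda>\<omega>. \<Sum>s\<in>I. \<Sum>t\<in>I. (z s \<omega>)\<^sup>2 * (z t \<omega>)\<^sup>2)"
    by (simp only: power2_eq_square[of "sum _ _"] sum_product)
  show "integrable M (\<lambda>\<omega>. (\<Sum>t\<in>I. (z t \<omega>)\<^sup>2)\<^sup>2)"
    unfolding eq by (intro Bochner_Integration.integrable_sum integrable_mult_squares)
  have g: "(\<gamma> h)\<^sup>2 \<le> (\<gamma> 0)\<^sup>2" for h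
    using integral_mult_squared_le[OF single(1)[of 0] single(1)[of h] single(2) single(2)]
    by (simp add: covariance variance_eq power2_eq_square)
  have "expectation (\<lambda>\<omega>. (\<Sum>t\<in>I. (z t \<omega>)\<^sup>2)\<^sup>2) = (\<Sum>s\<in>I. \<Sum>t\<in>I. (\<gamma> 0)\<^sup>2 + 2 * (\<gamma> (t - s))\<^sup>2)"
    unfolding eq using integrable_mult_squares by (simp add: mixed_fourth_moment)
  also have "\<dots> \<le> (\<Sum>s\<in>I. \<Sum>t\<in>I. 3 * (\<gamma> 0)\<^sup>2)"
    using g by (intro sum_mono) (smt (verit))
  finally show "expectation (\<lambda>\<omega>. (\<Sum>t\<in>I. (z t \<omega>)\<^sup>2)\<^sup>2) \<le> (real (card I))\<^sup>2 * (3 * (\<gamma> 0)\<^sup>2)"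
    by (simp add: power2_eq_square)
qed

definition covariance_error :: "nat \<Rightarrow> 'a \<Rightarrow> int \<Rightarrow> real" where
  "covariance_error T \<omega> h = empirical_covariance z T \<omega> h - \<gamma> h"

lemma covariance_error_0:
  assumes "T \<ge> 1"
  shows "covariance_error T \<omega> 0 = 1 / real T * (\<Sum>t\<in>{1..int T}. (z t \<omega>)\<^sup>2 - \<gamma> 0)"
proof -
  have "(\<Sum>t\<in>{1..int T}. (z t \<omega>)\<^sup>2 - \<gamma> 0) = (\<Sum>t\<in>{1..int T}. (z t \<omega>)\<^sup>2) - real T * \<gamma> 0"
    by (simp add: sum_subtractf)
  moreover have "empirical_covariance z T \<omega> 0 = 1 / real T * (\<Sum>t\<in>{1..int T}. (z t \<omega>)\<^sup>2)"
    using sum_nat_eq_sum_int[of "\<lambda>t. (z t \<omega>)\<^sup>2" T]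
    by (simp add: empirical_covariance_def power2_eq_square)
  ultimately show ?thesis
    using assms by (simp add: covariance_error_def right_diff_distrib diff_divide_distrib)
qed

lemma covariance_error_0_second_moment:
  assumes T: "T \<ge> 1"
  shows "integrable M (\<lambda>\<omega>. (covariance_error T \<omega> 0)\<^sup>2)"
    and "expectation (\<lambda>\<omega>. (covariance_error T \<omega> 0)\<^sup>2) \<le> 4 * ((\<Sum>h<T. (\<gamma> (int h))\<^sup>2) / real T)"
proof -
  have eq: "(\<lambda>\<omega>. (covariance_error T \<omega> 0)\<^sup>2) = (\<lambda>\<omega>. (1 / real T)\<^sup>2 * (\<Sum>t\<in>{1..int T}. (z t \<omega>)\<^sup>2 - \<gamma> 0)\<^sup>2)"
    by (simp only: covariance_error_0[OF T] power_mult_distrib)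
  show "integrable M (\<lambda>\<omega>. (covariance_error T \<omega> 0)\<^sup>2)"
    unfolding eq by (intro integrable_mult_right empirical_variance_error)
  have "expectation (\<lambda>\<omega>. (covariance_error T \<omega> 0)\<^sup>2) \<le> (1 / real T)\<^sup>2 * (4 * real T * (\<Sum>h<T. (\<gamma> (int h))\<^sup>2))"
    unfolding eq using empirical_variance_error(2)[of T] by (simp add: mult_left_mono divide_right_mono)
  also have "\<dots> = 4 * ((\<Sum>h<T. (\<gamma> (int h))\<^sup>2) / real T)"
    using T by (simp add: power2_eq_square field_simps)
  finally show "expectation (\<lambda>\<omega>. (covariance_error T \<omega> 0)\<^sup>2) \<le> 4 * ((\<Sum>h<T. (\<gamma> (int h))\<^sup>2) / real T)" .
qed

text \<open>Since \<open>2 * y * y' = y\<^sup>2 + y'\<^sup>2 - (y' - y)\<^sup>2\<close>, the empirical covariances at lags \<open>h\<close> and \<open>0\<close>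
  differ by the empirical variance of the increments over \<open>h\<close> steps, up to \<open>h\<close> boundary terms at each
  end. This shows that the estimation errors at all lags agree to leading order.\<close>

lemma covariance_error_difference:
  fixes h T :: nat
  assumes T: "h < T"
  defines "N \<equiv> T - h"
  shows "covariance_error T \<omega> (int h) - covariance_error T \<omega> 0 =
    (- (\<Sum>t\<in>{1..int N}. (z (t + int h) \<omega> - z t \<omega>)\<^sup>2 - increment_autocovariance \<gamma> (int h) 0)
     + real h * increment_autocovariance \<gamma> (int h) 0
     - (\<Sum>t\<in>{1..int h}. (z t \<omega>)\<^sup>2) - (\<Sum>t\<in>{int N + 1..int T}. (z t \<omega>)\<^sup>2)) / (2 * real T)"
proof -
  define A where "A = (\<Sum>t\<in>{1..int T}. (z t \<omega>)\<^sup>2)"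
  define P where "P = (\<Sum>t\<in>{1..int N}. z t \<omega> * z (t + int h) \<omega>)"
  have NT: "int T = int N + int h" "N \<ge> 1" using T by (auto simp: N_def)
  have 1: "(\<Sum>t\<in>{1..int N}. (z t \<omega>)\<^sup>2) = A - (\<Sum>t\<in>{int N + 1..int T}. (z t \<omega>)\<^sup>2)"
  proof -
    have "{1..int T} = {1..int N} \<union> {int N + 1..int T}" using NT by auto
    then show ?thesis unfolding A_def by (simp only: sum.union_disjoint) (subst sum.union_disjoint, auto)
  qed
  have 2: "(\<Sum>t\<in>{1..int N}. (z (t + int h) \<omega>)\<^sup>2) = A - (\<Sum>t\<in>{1..int h}. (z t \<omega>)\<^sup>2)"
  proof -
    have "(\<Sum>t\<in>{1..int N}. (z (t + int h) \<omega>)\<^sup>2) = (\<Sum>t\<in>{int h + 1..int T}. (z t \<omega>)\<^sup>2)"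
      by (rule sum.reindex_bij_witness[of _ "\<lambda>t. t - int h" "\<lambda>t. t + int h"]) (use NT in auto)
    moreover have "{1..int T} = {1..int h} \<union> {int h + 1..int T}" using NT by auto
    ultimately show ?thesis unfolding A_def by (simp only:) (subst sum.union_disjoint, auto)
  qed
  have "(\<Sum>t\<in>{1..int N}. (z (t + int h) \<omega> - z t \<omega>)\<^sup>2)
      = (\<Sum>t\<in>{1..int N}. (z (t + int h) \<omega>)\<^sup>2) + (\<Sum>t\<in>{1..int N}. (z t \<omega>)\<^sup>2) - 2 * P"
    by (simp add: P_def power2_diff sum.distrib sum_subtractf sum_distrib_left mult_ac)
  then have S: "(\<Sum>t\<in>{1..int N}. (z (t + int h) \<omega> - z t \<omega>)\<^sup>2)
      = 2 * A - (\<Sum>t\<in>{1..int h}. (z t \<omega>)\<^sup>2) - (\<Sum>t\<in>{int N + 1..int T}. (z t \<omega>)\<^sup>2) - 2 * P"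
    using 1 2 by simp
  have e0: "empirical_covariance z T \<omega> 0 = A / real T"
    using sum_nat_eq_sum_int[of "\<lambda>t. (z t \<omega>)\<^sup>2" T]
    by (simp add: empirical_covariance_def A_def power2_eq_square)
  have eh: "empirical_covariance z T \<omega> (int h) = P / real T"
    using sum_nat_eq_sum_int[of "\<lambda>t. z t \<omega> * z (t + int h) \<omega>" N]
    by (simp add: empirical_covariance_def P_def N_def)
  have inc: "increment_autocovariance \<gamma> (int h) 0 = 2 * \<gamma> 0 - 2 * \<gamma> (int h)"
    using gamma_sym[of "int h"] by (simp add: increment_autocovariance_def)
  have T': "real T = real N + real h" using NT by linarith
  have "- (\<Sum>t\<in>{1..int N}. (z (t + int h) \<omega> - z t \<omega>)\<^sup>2 - increment_autocovariance \<gamma> (int h) 0)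
     + real h * increment_autocovariance \<gamma> (int h) 0
     - (\<Sum>t\<in>{1..int h}. (z t \<omega>)\<^sup>2) - (\<Sum>t\<in>{int N + 1..int T}. (z t \<omega>)\<^sup>2)
     = 2 * real T * (P / real T - \<gamma> (int h) - (A / real T - \<gamma> 0))"
    using T unfolding sum_subtractf S inc by (simp add: right_diff_distrib) (simp add: T' algebra_simps)
  then show ?thesis
    using T unfolding covariance_error_def e0 eh by simp
qed

lemma covariance_error_difference_second_moment:
  fixes h T :: nat
  assumes T: "h < T"
  defines "\<gamma>' \<equiv> increment_autocovariance \<gamma> (int h)"
  shows "integrable M (\<lambda>\<omega>. (covariance_error T \<omega> (int h) - covariance_error T \<omega> 0)\<^sup>2)"
    and "expectation (\<lambda>\<omega>. (covariance_error T \<omega> (int h) - covariance_error T \<omega> 0)\<^sup>2)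
      \<le> 4 * ((\<Sum>n<T. (\<gamma>' (int n))\<^sup>2) / real T)
        + ((real h)\<^sup>2 * (\<gamma>' 0)\<^sup>2 + 6 * (real h)\<^sup>2 * (\<gamma> 0)\<^sup>2) / (real T)\<^sup>2"
proof -
  interpret inc: stationary_gaussian M "\<lambda>t \<omega>. z (t + int h) \<omega> - z t \<omega>" \<gamma>'
    unfolding \<gamma>'_def by (rule increments)
  define N where "N = T - h"
  have N: "N \<ge> 1" "N \<le> T" using T by (auto simp: N_def)
  define S where "S = (\<lambda>\<omega>. \<Sum>t\<in>{1..int N}. (z (t + int h) \<omega> - z t \<omega>)\<^sup>2 - \<gamma>' 0)"
  define B1 where "B1 = (\<lambda>\<omega>. \<Sum>t\<in>{1..int h}. (z t \<omega>)\<^sup>2)"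
  define B2 where "B2 = (\<lambda>\<omega>. \<Sum>t\<in>{int N + 1..int T}. (z t \<omega>)\<^sup>2)"
  define F where "F = (\<lambda>\<omega>. (- S \<omega> + real h * \<gamma>' 0 - B1 \<omega> - B2 \<omega>) / (2 * real T))"
  have eq: "(\<lambda>\<omega>. (covariance_error T \<omega> (int h) - covariance_error T \<omega> 0)\<^sup>2) = (\<lambda>\<omega>. (F \<omega>)\<^sup>2)"
    unfolding covariance_error_difference[OF T] F_def S_def B1_def B2_def N_def \<gamma>'_def ..
  have S: "S \<in> borel_measurable M" "integrable M (\<lambda>\<omega>. (S \<omega>)\<^sup>2)"
    "expectation (\<lambda>\<omega>. (S \<omega>)\<^sup>2) \<le> 4 * real N * (\<Sum>n<N. (\<gamma>' (int n))\<^sup>2)"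
    using single(1) inc.empirical_variance_error[of N] unfolding S_def by auto
  have B1: "B1 \<in> borel_measurable M" "integrable M (\<lambda>\<omega>. (B1 \<omega>)\<^sup>2)"
    "expectation (\<lambda>\<omega>. (B1 \<omega>)\<^sup>2) \<le> (real h)\<^sup>2 * (3 * (\<gamma> 0)\<^sup>2)"
    using single(1) sum_squares_second_moment[of "{1..int h}"] unfolding B1_def by auto
  have B2: "B2 \<in> borel_measurable M" "integrable M (\<lambda>\<omega>. (B2 \<omega>)\<^sup>2)"
    "expectation (\<lambda>\<omega>. (B2 \<omega>)\<^sup>2) \<le> (real h)\<^sup>2 * (3 * (\<gamma> 0)\<^sup>2)"
    using single(1) sum_squares_second_moment[of "{int N + 1..int T}"] T unfolding B2_def by (auto simp: N_def)
  define G where "G = (\<lambda>\<omega>. ((S \<omega>)\<^sup>2 + (real h * \<gamma>' 0)\<^sup>2 + (B1 \<omega>)\<^sup>2 + (B2 \<omega>)\<^sup>2) / (real T)\<^sup>2)"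
  have le: "(F \<omega>)\<^sup>2 \<le> G \<omega>" for \<omega>
  proof -
    have "(- p + q - r - s)\<^sup>2 \<le> 4 * (p\<^sup>2 + q\<^sup>2 + r\<^sup>2 + s\<^sup>2)" for p q r s :: real
    proof -
      have "4 * (p\<^sup>2 + q\<^sup>2 + r\<^sup>2 + s\<^sup>2) - (- p + q - r - s)\<^sup>2
        = (p + q)\<^sup>2 + (p - r)\<^sup>2 + (p - s)\<^sup>2 + (q + r)\<^sup>2 + (q + s)\<^sup>2 + (r - s)\<^sup>2"
        by (simp add: power2_eq_square algebra_simps)
      also have "\<dots> \<ge> 0" by simp
      finally show ?thesis by simp
    qed
    from this[of "S \<omega>" "real h * \<gamma>' 0" "B1 \<omega>" "B2 \<omega>"] show ?thesis
      using T unfolding F_def G_def power_divide power_mult_distrib by (simp add: field_simps)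
  qed
  have Gi: "integrable M G" unfolding G_def using S B1 B2 by simp
  have Fm: "(\<lambda>\<omega>. (F \<omega>)\<^sup>2) \<in> borel_measurable M" unfolding F_def using S(1) B1(1) B2(1) by measurable
  have Fi: "integrable M (\<lambda>\<omega>. (F \<omega>)\<^sup>2)"
    by (intro Bochner_Integration.integrable_bound[OF Gi Fm] AE_I2)
      (use le in \<open>simp add: order.trans[OF _ abs_ge_self]\<close>)
  then show "integrable M (\<lambda>\<omega>. (covariance_error T \<omega> (int h) - covariance_error T \<omega> 0)\<^sup>2)"
    by (simp only: eq)
  have "expectation (\<lambda>\<omega>. (F \<omega>)\<^sup>2) \<le> expectation G"
    by (intro integral_mono Fi Gi le)
  also have "\<dots> = (expectation (\<lambda>\<omega>. (S \<omega>)\<^sup>2) + (real h * \<gamma>' 0)\<^sup>2 + expectation (\<lambda>\<omega>. (B1 \<omega>)\<^sup>2) + expectation (\<lambda>\<omega>. (B2 \<omega>)\<^sup>2)) / (real T)\<^sup>2"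
    unfolding G_def using S B1 B2 by (simp add: prob_space)
  also have "\<dots> \<le> (4 * real T * (\<Sum>n<T. (\<gamma>' (int n))\<^sup>2) + (real h * \<gamma>' 0)\<^sup>2 + (real h)\<^sup>2 * (3 * (\<gamma> 0)\<^sup>2) + (real h)\<^sup>2 * (3 * (\<gamma> 0)\<^sup>2)) / (real T)\<^sup>2"
  proof -
    have "4 * real N * (\<Sum>n<N. (\<gamma>' (int n))\<^sup>2) \<le> 4 * real T * (\<Sum>n<T. (\<gamma>' (int n))\<^sup>2)"
      using N by (intro mult_mono sum_mono2) (auto intro: sum_nonneg)
    then show ?thesis using S(3) B1(3) B2(3) by (intro divide_right_mono add_mono) auto
  qed
  also have "\<dots> = 4 * ((\<Sum>n<T. (\<gamma>' (int n))\<^sup>2) / real T)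
        + ((real h)\<^sup>2 * (\<gamma>' 0)\<^sup>2 + 6 * (real h)\<^sup>2 * (\<gamma> 0)\<^sup>2) / (real T)\<^sup>2"
    using T by (simp add: power2_eq_square field_simps)
  finally show "expectation (\<lambda>\<omega>. (covariance_error T \<omega> (int h) - covariance_error T \<omega> 0)\<^sup>2)
      \<le> 4 * ((\<Sum>n<T. (\<gamma>' (int n))\<^sup>2) / real T)
        + ((real h)\<^sup>2 * (\<gamma>' 0)\<^sup>2 + 6 * (real h)\<^sup>2 * (\<gamma> 0)\<^sup>2) / (real T)\<^sup>2"
    by (simp only: eq)
qed

end

section \<open>Asymptotics of the autocovariances\<close>

text \<open>A power function does not notice a bounded shift of its argument.\<close>

lemma shifted_autocovariance_limit:
  fixes \<sigma> :: "int \<Rightarrow> real"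
  assumes lam: "lam > 0" and asym: "(\<lambda>j. \<sigma> (int j)) \<sim>[at_top] (\<lambda>j. lam * real j powr p)"
  shows "(\<lambda>s. \<sigma> (int s + c) / real s powr p) \<longlonglongrightarrow> lam"
proof -
  have "\<forall>\<^sub>F j in sequentially. \<sigma> (int j) \<noteq> 0 \<or> lam * real j powr p \<noteq> 0"
    using eventually_gt_at_top[of "0::nat"] by eventually_elim (use lam in simp)
  then have "(\<lambda>j. \<sigma> (int j) / (lam * real j powr p)) \<longlonglongrightarrow> 1"
    by (rule asymp_equivD_strong[OF asym])
  then have "(\<lambda>j. lam * (\<sigma> (int j) / (lam * real j powr p))) \<longlonglongrightarrow> lam * 1"
    by (intro tendsto_mult tendsto_const)
  then have q: "(\<lambda>j. \<sigma> (int j) / real j powr p) \<longlonglongrightarrow> lam" using lam by simp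
  have "filterlim (\<lambda>s. nat (int s + c)) at_top sequentially"
    unfolding filterlim_at_top
  proof
    fix Z
    show "\<forall>\<^sub>F s in sequentially. Z \<le> nat (int s + c)"
      using eventually_ge_at_top[of "Z + nat \<bar>c\<bar>"] by eventually_elim auto
  qed
  from filterlim_compose[OF q this]
  have q': "(\<lambda>s. \<sigma> (int (nat (int s + c))) / real (nat (int s + c)) powr p) \<longlonglongrightarrow> lam" .
  have "(\<lambda>s. 1 + real_of_int c / real s) \<longlonglongrightarrow> 1 + 0"
    by (intro tendsto_add tendsto_const lim_const_over_n)
  then have "(\<lambda>s. (1 + real_of_int c / real s) powr p) \<longlonglongrightarrow> (1 + 0) powr p"
    by (intro tendsto_powr tendsto_const) auto
  from tendsto_mult[OF q' this]
  have "(\<lambda>s. \<sigma> (int (nat (int s + c))) / real (nat (int s + c)) powr p * (1 + real_of_int c / real s) powr p) \<longlonglongrightarrow> lam"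
    by simp
  moreover have "\<forall>\<^sub>F s in sequentially. \<sigma> (int (nat (int s + c))) / real (nat (int s + c)) powr p * (1 + real_of_int c / real s) powr p
      = \<sigma> (int s + c) / real s powr p"
    using eventually_gt_at_top[of "nat \<bar>c\<bar>"]
  proof eventually_elim
    case (elim s)
    define x where "x = real_of_int (int s + c)"
    have x: "x > 0" "real (nat (int s + c)) = x" "int (nat (int s + c)) = int s + c" using elim by (auto simp: x_def)
    have s: "real s > 0" using elim by auto
    have "1 + real_of_int c / real s = x / real s" using s by (simp add: x_def add_divide_distrib)
    then have "(1 + real_of_int c / real s) powr p = x powr p / real s powr p" using x s by (simp add: powr_divide)
    then show ?case using x by simp
  qed
  ultimately show ?thesis by (rule Lim_transform_eventually)
qed

lemma autocovariance_tendsto_0: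
  fixes \<sigma> :: "int \<Rightarrow> real"
  assumes lam: "lam > 0" and p: "p < 0" and asym: "(\<lambda>j. \<sigma> (int j)) \<sim>[at_top] (\<lambda>j. lam * real j powr p)"
  shows "(\<lambda>s. \<sigma> (int s)) \<longlonglongrightarrow> 0"
proof -
  have "(\<lambda>s. real s powr p) \<longlonglongrightarrow> 0"
    using p by (intro tendsto_neg_powr filterlim_real_sequentially)
  from tendsto_mult[OF shifted_autocovariance_limit[OF lam asym, of 0] this]
  have "(\<lambda>s. \<sigma> (int s + 0) / real s powr p * real s powr p) \<longlonglongrightarrow> 0" by simp
  then show ?thesis
    by (rule Lim_transform_eventually) (use eventually_gt_at_top[of "0::nat"] in \<open>eventually_elim, simp\<close>)
qed

lemma autocovariance_eventually_ge:
  fixes \<sigma> :: "int \<Rightarrow> real"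
  assumes lam: "lam > 0" and asym: "(\<lambda>j. \<sigma> (int j)) \<sim>[at_top] (\<lambda>j. lam * real j powr p)"
  shows "\<forall>\<^sub>F s in sequentially. lam / 2 * real s powr p \<le> \<sigma> (int s)"
proof -
  have "\<forall>\<^sub>F s in sequentially. lam / 2 < \<sigma> (int s + 0) / real s powr p"
    using shifted_autocovariance_limit[OF lam asym, of 0] lam by (intro order_tendstoD(1)) auto
  then show ?thesis
    using eventually_gt_at_top[of "0::nat"] by eventually_elim (simp add: pos_less_divide_eq)
qed

lemma increment_autocovariance_small:
  fixes \<sigma> :: "int \<Rightarrow> real"
  assumes lam: "lam > 0" and asym: "(\<lambda>j. \<sigma> (int j)) \<sim>[at_top] (\<lambda>j. lam * real j powr p)" and e: "e > 0"
  shows "\<forall>\<^sub>F s in sequentially. \<bar>increment_autocovariance \<sigma> h (int s)\<bar> \<le> e * \<bar>\<sigma> (int s)\<bar>"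
proof -
  note L = shifted_autocovariance_limit[OF lam asym]
  have "(\<lambda>s. 2 * (\<sigma> (int s + 0) / real s powr p) - \<sigma> (int s + h) / real s powr p - \<sigma> (int s + - h) / real s powr p)
      \<longlonglongrightarrow> 2 * lam - lam - lam"
    by (intro tendsto_diff tendsto_mult tendsto_const L)
  then have "(\<lambda>s. increment_autocovariance \<sigma> h (int s) / real s powr p) \<longlonglongrightarrow> 0"
    by (simp add: increment_autocovariance_def diff_divide_distrib)
  then have "\<forall>\<^sub>F s in sequentially. \<bar>increment_autocovariance \<sigma> h (int s) / real s powr p\<bar> < e * (lam / 2)"
    using e lam by (intro order_tendstoD(2)[OF tendsto_rabs]) auto
  then show ?thesis
    using autocovariance_eventually_ge[OF lam asym] eventually_gt_at_top[of "0::nat"]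
  proof eventually_elim
    case (elim s)
    have "\<bar>increment_autocovariance \<sigma> h (int s)\<bar> \<le> e * (lam / 2 * real s powr p)"
      using elim(1,3) by (simp add: pos_divide_less_eq)
    also have "\<dots> \<le> e * \<bar>\<sigma> (int s)\<bar>" using elim(2) e by (intro mult_left_mono) auto
    finally show ?case .
  qed
qed

text \<open>This is where \<open>d \<ge> 1 / 4\<close> is decisive: with \<open>p = 2 * d - 1\<close> the squared covariances
  dominate a multiple of the harmonic series. Consequently terms of order \<open>1 / T\<close> in the mean squared
  errors are negligible against the leading term.\<close>

lemma sum_squared_autocovariance_at_top:
  fixes \<sigma> :: "int \<Rightarrow> real"
  assumes lam: "lam > 0" and p: "- 1 / 2 \<le> p" and asym: "(\<lambda>j. \<sigma> (int j)) \<sim>[at_top] (\<lambda>j. lam * real j powr p)"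
  shows "filterlim (\<lambda>T. \<Sum>s<T. (\<sigma> (int s))\<^sup>2) at_top sequentially"
proof -
  have "\<not> summable (\<lambda>s. (\<sigma> (int s))\<^sup>2)"
  proof
    assume s: "summable (\<lambda>s. (\<sigma> (int s))\<^sup>2)"
    have "\<forall>\<^sub>F s in sequentially. norm ((lam / 2)\<^sup>2 * inverse (real s)) \<le> (\<sigma> (int s))\<^sup>2"
      using autocovariance_eventually_ge[OF lam asym] eventually_ge_at_top[of "1::nat"]
    proof eventually_elim
      case (elim s)
      have "(real s powr (- 1 / 2))\<^sup>2 = real s powr (- 1 / 2 + - 1 / 2)"
        by (simp only: power2_eq_square powr_add)
      then have "inverse (real s) = (real s powr (- 1 / 2))\<^sup>2"
        using elim by (simp add: powr_minus)
      also have "\<dots> \<le> (real s powr p)\<^sup>2" using elim p by (intro power_mono powr_mono) auto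
      finally have "(lam / 2)\<^sup>2 * inverse (real s) \<le> (lam / 2 * real s powr p)\<^sup>2"
        unfolding power_mult_distrib by (intro mult_left_mono) auto
      also have "\<dots> \<le> (\<sigma> (int s))\<^sup>2" using elim lam by (intro power_mono) auto
      finally show ?case by simp
    qed
    then have "summable (\<lambda>s. (lam / 2)\<^sup>2 * inverse (real s))"
      by (rule summable_comparison_test_ev[OF _ s])
    then have "summable (\<lambda>s. inverse (real s))" by (rule summable_mult_D) (use lam in simp)
    then show False using not_summable_harmonic[where 'a = real] by simp
  qed
  then have unb: "\<exists>T. K < (\<Sum>s<T. (\<sigma> (int s))\<^sup>2)" for K
    using summableI_nonneg_bounded[of "\<lambda>s. (\<sigma> (int s))\<^sup>2" K] by (auto simp: not_le[symmetric])
  show ?thesis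
    unfolding filterlim_at_top
  proof
    fix K
    obtain T0 where T0: "K < (\<Sum>s<T0. (\<sigma> (int s))\<^sup>2)" using unb by blast
    show "\<forall>\<^sub>F T in sequentially. K \<le> (\<Sum>s<T. (\<sigma> (int s))\<^sup>2)"
      using eventually_ge_at_top[of T0]
    proof eventually_elim
      case (elim T)
      have "(\<Sum>s<T0. (\<sigma> (int s))\<^sup>2) \<le> (\<Sum>s<T. (\<sigma> (int s))\<^sup>2)" using elim by (intro sum_mono2) auto
      with T0 show ?case by simp
    qed
  qed
qed

lemma sum_squares_smallo:
  fixes u v :: "nat \<Rightarrow> real"
  assumes small: "\<And>e. e > 0 \<Longrightarrow> \<forall>\<^sub>F s in sequentially. \<bar>u s\<bar> \<le> e * \<bar>v s\<bar>"
    and div: "filterlim (\<lambda>T. \<Sum>s<T. (v s)\<^sup>2) at_top sequentially" and e: "e > 0"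
  shows "\<forall>\<^sub>F T in sequentially. (\<Sum>s<T. (u s)\<^sup>2) \<le> e * (\<Sum>s<T. (v s)\<^sup>2)"
proof -
  obtain N where N: "\<And>s. s \<ge> N \<Longrightarrow> \<bar>u s\<bar> \<le> sqrt (e / 2) * \<bar>v s\<bar>"
    using small[of "sqrt (e / 2)"] e by (auto simp: eventually_at_top_linorder)
  define K where "K = (\<Sum>s<N. (u s)\<^sup>2)"
  have "\<forall>\<^sub>F T in sequentially. 2 * K / e \<le> (\<Sum>s<T. (v s)\<^sup>2)"
    using div by (simp add: filterlim_at_top)
  then show ?thesis
    using eventually_ge_at_top[of N]
  proof eventually_elim
    case (elim T)
    have "(u s)\<^sup>2 \<le> e / 2 * (v s)\<^sup>2" if "s \<ge> N" for s
    proof -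
      have "\<bar>u s\<bar>\<^sup>2 \<le> (sqrt (e / 2) * \<bar>v s\<bar>)\<^sup>2" using N[OF that] by (intro power_mono) auto
      then show ?thesis using e by (simp add: power_mult_distrib)
    qed
    then have "(\<Sum>s\<in>{N..<T}. (u s)\<^sup>2) \<le> (\<Sum>s\<in>{N..<T}. e / 2 * (v s)\<^sup>2)" by (intro sum_mono) auto
    also have "\<dots> \<le> (\<Sum>s<T. e / 2 * (v s)\<^sup>2)" using e by (intro sum_mono2) auto
    also have "\<dots> = e / 2 * (\<Sum>s<T. (v s)\<^sup>2)" by (simp add: sum_distrib_left)
    finally have tail: "(\<Sum>s\<in>{N..<T}. (u s)\<^sup>2) \<le> e / 2 * (\<Sum>s<T. (v s)\<^sup>2)" .
    have split: "{..<T} = {..<N} \<union> {N..<T}" using elim(2) by auto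
    have "(\<Sum>s<T. (u s)\<^sup>2) = K + (\<Sum>s\<in>{N..<T}. (u s)\<^sup>2)"
      unfolding K_def by (subst split, rule sum.union_disjoint) auto
    moreover have "K \<le> e / 2 * (\<Sum>s<T. (v s)\<^sup>2)"
    proof -
      have "2 * K \<le> (\<Sum>s<T. (v s)\<^sup>2) * e" using elim(1) e by (simp only: pos_divide_le_eq)
      then show ?thesis by (simp add: mult.commute)
    qed
    ultimately show ?case using tail by simp
  qed
qed

text \<open>The increments have autocovariances of smaller order than \<open>\<gamma>\<close>, so their empirical variance
  fluctuates less; the boundary terms contribute only \<open>O(1 / T\<^sup>2)\<close>.\<close>

lemma (in stationary_gaussian) covariance_error_difference_smallo:
  fixes h :: nat
  assumes lam: "lam > 0" and p: "- 1 / 2 \<le> p" and asym: "(\<lambda>j. \<gamma> (int j)) \<sim>[at_top] (\<lambda>j. lam * real j powr p)"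
    and e: "e > 0"
  shows "\<forall>\<^sub>F T in sequentially. expectation (\<lambda>\<omega>. (covariance_error T \<omega> (int h) - covariance_error T \<omega> 0)\<^sup>2)
    \<le> e * ((\<Sum>s<T. (\<gamma> (int s))\<^sup>2) / real T)"
proof -
  define \<gamma>' where "\<gamma>' = increment_autocovariance \<gamma> (int h)"
  define U where "U = (\<lambda>T. \<Sum>s<T. (\<gamma> (int s))\<^sup>2)"
  define K where "K = (real h)\<^sup>2 * (\<gamma>' 0)\<^sup>2 + 6 * (real h)\<^sup>2 * (\<gamma> 0)\<^sup>2"
  have K: "K \<ge> 0" by (simp add: K_def)
  have U: "filterlim U at_top sequentially"
    unfolding U_def by (rule sum_squared_autocovariance_at_top[OF lam p asym])
  have ev1: "\<forall>\<^sub>F T in sequentially. (\<Sum>n<T. (\<gamma>' (int n))\<^sup>2) \<le> e / 8 * (\<Sum>n<T. (\<gamma> (int n))\<^sup>2)"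
    using increment_autocovariance_small[OF lam asym, of _ "int h"] U e unfolding U_def \<gamma>'_def
    by (intro sum_squares_smallo) auto
  have ev2: "\<forall>\<^sub>F T in sequentially. 2 * K / e \<le> U T"
    using U by (simp add: filterlim_at_top)
  have key: "expectation (\<lambda>\<omega>. (covariance_error T \<omega> (int h) - covariance_error T \<omega> 0)\<^sup>2) \<le> e * (U T / real T)"
    if elim: "(\<Sum>n<T. (\<gamma>' (int n))\<^sup>2) \<le> e / 8 * (\<Sum>n<T. (\<gamma> (int n))\<^sup>2)" "2 * K / e \<le> U T" "h < T" for T
  proof -
    have T: "real T \<ge> 1" using elim(3) by simp
    have "K / (real T)\<^sup>2 \<le> K / real T"
    proof (rule divide_left_mono)
      show "real T \<le> (real T)\<^sup>2" using T by (simp add: self_le_power)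
    qed (use K T in auto)
    also have "\<dots> \<le> e / 2 * U T / real T"
    proof (rule divide_right_mono)
      have "2 * K \<le> U T * e" using elim(2) e by (simp only: pos_divide_le_eq)
      then show "K \<le> e / 2 * U T" by (simp add: mult.commute)
    qed simp
    finally have 1: "K / (real T)\<^sup>2 \<le> e / 2 * (U T / real T)" by simp
    have "(\<Sum>n<T. (\<gamma>' (int n))\<^sup>2) / real T \<le> e / 8 * U T / real T"
      using elim(1) T unfolding U_def by (intro divide_right_mono) auto
    then have "4 * ((\<Sum>n<T. (\<gamma>' (int n))\<^sup>2) / real T) \<le> e / 2 * (U T / real T)" by simp
    from add_mono[OF this 1]
    have "4 * ((\<Sum>n<T. (\<gamma>' (int n))\<^sup>2) / real T) + K / (real T)\<^sup>2
      \<le> e / 2 * (U T / real T) + e / 2 * (U T / real T)" .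
    also have "\<dots> = e * (U T / real T)" by (simp only: distrib_right[symmetric] field_sum_of_halves)
    finally have "4 * ((\<Sum>n<T. (\<gamma>' (int n))\<^sup>2) / real T) + K / (real T)\<^sup>2 \<le> e * (U T / real T)" .
    from order.trans[OF covariance_error_difference_second_moment(2)[OF elim(3), folded \<gamma>'_def, folded K_def] this]
    show ?thesis .
  qed
  have "\<forall>\<^sub>F T in sequentially. expectation (\<lambda>\<omega>. (covariance_error T \<omega> (int h) - covariance_error T \<omega> 0)\<^sup>2)
      \<le> e * (U T / real T)"
    using ev1 ev2 eventually_gt_at_top[of h] by eventually_elim (rule key)
  then show ?thesis unfolding U_def .
qed

lemma sum_powr_le:
  fixes q :: real
  assumes q: "0 < q" "q < 1"
  shows "(\<Sum>s=1..n. real s powr (q - 1)) \<le> real n powr q / q"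
proof (induction n)
  case (Suc n)
  have "real (Suc n) powr (q - 1) \<le> (real (Suc n) powr q - real n powr q) / q"
  proof (cases "n = 0")
    case False
    then show ?thesis using powr_le_difference_quotient[of q "real n"] q by (simp add: add.commute)
  qed (use q in simp)
  then show ?case using Suc by (simp add: diff_divide_distrib)
qed simp

lemma sum_inverse_le_ln:
  assumes "n \<ge> 1"
  shows "(\<Sum>s=1..n. 1 / real s) \<le> 1 + ln (real n)"
  using assms
proof (induction n rule: dec_induct)
  case (step n)
  have n: "real n > 0" using step by simp
  have "ln (real n / real (Suc n)) \<le> real n / real (Suc n) - 1" using n by (intro ln_le_minus_one) simp
  also have "\<dots> = - (1 / real (Suc n))" by (simp add: field_simps)
  finally have "1 / real (Suc n) \<le> ln (real (Suc n)) - ln (real n)" using n by (simp add: ln_div)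
  then show ?case using step by simp
qed simp

text \<open>Four times the left-hand side bounds the mean squared error of the empirical variance.\<close>

lemma mean_squared_autocovariance_rate:
  fixes \<sigma> :: "int \<Rightarrow> real"
  assumes d: "1 / 4 \<le> d" "d < 1 / 2"
    and asym: "(\<lambda>j. \<sigma> (int j)) \<sim>[at_top] (\<lambda>j. lam * real j powr (2 * d - 1))"
  shows "d = 1 / 4 \<Longrightarrow> \<exists>K. \<forall>\<^sub>F T in sequentially. (\<Sum>s<T. (\<sigma> (int s))\<^sup>2) / real T \<le> K * (ln (real T) / real T)"
    and "1 / 4 < d \<Longrightarrow> \<exists>K. \<forall>\<^sub>F T in sequentially. (\<Sum>s<T. (\<sigma> (int s))\<^sup>2) / real T \<le> K * (1 / real T powr (2 - 4 * d))"
proof -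
  obtain S where S: "S \<ge> 0" "\<And>j. j \<ge> 1 \<Longrightarrow> \<bar>\<sigma> (int j)\<bar> \<le> S * real j powr (2 * d - 1)"
    using asymp_equiv_powr_bound[OF asym] by blast
  have U: "(\<Sum>s<T. (\<sigma> (int s))\<^sup>2) \<le> (\<sigma> 0)\<^sup>2 + S\<^sup>2 * (\<Sum>s=1..T. real s powr (4 * d - 2))" for T
  proof -
    have "(\<Sum>s<T. (\<sigma> (int s))\<^sup>2) \<le> (\<Sum>s=0..T. (\<sigma> (int s))\<^sup>2)" by (intro sum_mono2) auto
    also have "\<dots> = (\<sigma> 0)\<^sup>2 + (\<Sum>s=1..T. (\<sigma> (int s))\<^sup>2)" by (simp add: sum.atLeast_Suc_atMost[of 0])
    also have "(\<Sum>s=1..T. (\<sigma> (int s))\<^sup>2) \<le> (\<Sum>s=1..T. S\<^sup>2 * real s powr (4 * d - 2))"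
    proof (rule sum_mono)
      fix s assume "s \<in> {1..T}"
      then have "\<bar>\<sigma> (int s)\<bar>\<^sup>2 \<le> (S * real s powr (2 * d - 1))\<^sup>2" by (intro power_mono S) auto
      also have "\<dots> = S\<^sup>2 * real s powr (4 * d - 2)"
        by (simp add: power_mult_distrib power2_eq_square[of "_ powr _"] powr_add[symmetric])
      finally show "(\<sigma> (int s))\<^sup>2 \<le> S\<^sup>2 * real s powr (4 * d - 2)" by simp
    qed
    finally show ?thesis by (simp add: sum_distrib_left)
  qed
  show "\<exists>K. \<forall>\<^sub>F T in sequentially. (\<Sum>s<T. (\<sigma> (int s))\<^sup>2) / real T \<le> K * (ln (real T) / real T)" if d: "d = 1 / 4"
  proof -
    have "filterlim (\<lambda>T. ln (real T)) at_top sequentially"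
      by (rule filterlim_compose[OF ln_at_top filterlim_real_sequentially])
    then have "\<forall>\<^sub>F T in sequentially. 1 \<le> ln (real T)" by (simp add: filterlim_at_top)
    then have "\<forall>\<^sub>F T in sequentially. (\<Sum>s<T. (\<sigma> (int s))\<^sup>2) / real T \<le> ((\<sigma> 0)\<^sup>2 + 2 * S\<^sup>2) * (ln (real T) / real T)"
      using eventually_ge_at_top[of "1::nat"]
    proof eventually_elim
      case (elim T)
      have "(\<Sum>s=1..T. real s powr (4 * d - 2)) = (\<Sum>s=1..T. 1 / real s)"
      proof (rule sum.cong[OF refl])
        fix s assume "s \<in> {1..T}"
        moreover have "4 * d - 2 = - 1" using d by simp
        ultimately show "real s powr (4 * d - 2) = 1 / real s" by (simp only:) (simp add: powr_minus_divide)
      qed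
      also have "\<dots> \<le> 2 * ln (real T)" using sum_inverse_le_ln[OF elim(2)] elim(1) by simp
      finally have "S\<^sup>2 * (\<Sum>s=1..T. real s powr (4 * d - 2)) \<le> S\<^sup>2 * (2 * ln (real T))"
        by (intro mult_left_mono) auto
      moreover have "(\<sigma> 0)\<^sup>2 * 1 \<le> (\<sigma> 0)\<^sup>2 * ln (real T)" using elim(1) by (intro mult_left_mono) auto
      ultimately have "(\<Sum>s<T. (\<sigma> (int s))\<^sup>2) \<le> ((\<sigma> 0)\<^sup>2 + 2 * S\<^sup>2) * ln (real T)"
        using U[of T] by (simp add: algebra_simps)
      then have "(\<Sum>s<T. (\<sigma> (int s))\<^sup>2) / real T \<le> ((\<sigma> 0)\<^sup>2 + 2 * S\<^sup>2) * ln (real T) / real T"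
        by (intro divide_right_mono) auto
      then show ?case by simp
    qed
    then show ?thesis by blast
  qed
  show "\<exists>K. \<forall>\<^sub>F T in sequentially. (\<Sum>s<T. (\<sigma> (int s))\<^sup>2) / real T \<le> K * (1 / real T powr (2 - 4 * d))" if d': "1 / 4 < d"
  proof -
    define q where "q = 4 * d - 1"
    have q: "0 < q" "q < 1" using d d' by (auto simp: q_def)
    have "\<forall>\<^sub>F T in sequentially. (\<Sum>s<T. (\<sigma> (int s))\<^sup>2) / real T \<le> ((\<sigma> 0)\<^sup>2 + S\<^sup>2 / q) * (1 / real T powr (2 - 4 * d))"
      using eventually_ge_at_top[of "1::nat"]
    proof eventually_elim
      case (elim T)
      have "S\<^sup>2 * (\<Sum>s=1..T. real s powr (q - 1)) \<le> S\<^sup>2 * (real T powr q / q)"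
        by (intro mult_left_mono sum_powr_le q) auto
      moreover have "(\<sigma> 0)\<^sup>2 * 1 \<le> (\<sigma> 0)\<^sup>2 * real T powr q"
        using elim q by (intro mult_left_mono ge_one_powr_ge_zero) auto
      moreover have "q - 1 = 4 * d - 2" by (simp add: q_def)
      ultimately have "(\<Sum>s<T. (\<sigma> (int s))\<^sup>2) \<le> ((\<sigma> 0)\<^sup>2 + S\<^sup>2 / q) * real T powr q"
        using U[of T] by (simp add: algebra_simps)
      then have "(\<Sum>s<T. (\<sigma> (int s))\<^sup>2) / real T \<le> ((\<sigma> 0)\<^sup>2 + S\<^sup>2 / q) * real T powr q / real T"
        by (intro divide_right_mono) auto
      also have "\<dots> = ((\<sigma> 0)\<^sup>2 + S\<^sup>2 / q) * (real T powr q / real T powr 1)" using elim by simp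
      also have "real T powr q / real T powr 1 = 1 / real T powr (2 - 4 * d)"
        unfolding powr_diff[symmetric] powr_minus_divide[symmetric] by (simp add: q_def algebra_simps)
      finally show ?case .
    qed
    then show ?thesis by blast
  qed
qed

section \<open>Perturbation of the Yule-Walker equations\<close>

text \<open>The quadratic form at constant weights is \<open>H\<^sup>2\<close> times the variance of the mean of \<open>H\<close>
  observations, which tends to \<open>0\<close> with the covariances.\<close>

lemma variance_of_mean_small:
  fixes \<sigma> :: "int \<Rightarrow> real"
  assumes sym: "\<And>h. \<sigma> (- h) = \<sigma> h" and lim: "(\<lambda>s. \<sigma> (int s)) \<longlonglongrightarrow> 0" and e: "e > 0"
  shows "\<exists>H\<ge>k. H \<ge> 1 \<and> toeplitz_form \<sigma> {1..H} (\<lambda>_. 1) \<le> e * (real H)\<^sup>2"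
proof -
  have "\<forall>\<^sub>F s in sequentially. \<bar>\<sigma> (int s)\<bar> < e / 4"
    using tendsto_rabs[OF lim] e by (intro order_tendstoD(2)) auto
  then obtain N where N: "\<And>s. s \<ge> N \<Longrightarrow> \<bar>\<sigma> (int s)\<bar> \<le> e / 4"
    by (force simp: eventually_at_top_linorder)
  define A where "A = (\<Sum>s<N. \<bar>\<sigma> (int s)\<bar>)"
  define H where "H = k + N + 1 + nat \<lceil>4 * A / e\<rceil>"
  have H: "H \<ge> k" "H \<ge> 1" "H \<ge> N" "4 * A / e \<le> real H" unfolding H_def by linarith+
  have "(\<Sum>s\<in>{N..<H}. \<bar>\<sigma> (int s)\<bar>) \<le> real (card {N..<H}) * (e / 4)"
    using N by (intro sum_bounded_above) auto
  also have "\<dots> \<le> real H * (e / 4)" using e by (intro mult_right_mono) auto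
  finally have tail: "(\<Sum>s\<in>{N..<H}. \<bar>\<sigma> (int s)\<bar>) \<le> real H * (e / 4)" .
  have split: "{..<H} = {..<N} \<union> {N..<H}" using H by auto
  have "(\<Sum>s<H. \<bar>\<sigma> (int s)\<bar>) = A + (\<Sum>s\<in>{N..<H}. \<bar>\<sigma> (int s)\<bar>)"
    unfolding A_def by (subst split, rule sum.union_disjoint) auto
  moreover have "A \<le> real H * (e / 4)" using H(4) e by (simp add: field_simps)
  ultimately have half: "(\<Sum>s<H. \<bar>\<sigma> (int s)\<bar>) \<le> real H * (e / 2)" using tail by simp
  have "toeplitz_form \<sigma> {1..H} (\<lambda>_. 1) \<le> (\<Sum>i=1..H. \<Sum>j=1..H. \<bar>\<sigma> (int j - int i)\<bar>)"
    unfolding toeplitz_form_def using sym[of "int _ - int _"]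
    by (intro sum_mono) (metis abs_ge_self minus_diff_eq mult_1)
  also have "\<dots> = (\<Sum>i\<in>{1..int H}. \<Sum>j\<in>{1..int H}. \<bar>\<sigma> (j - i)\<bar>)"
    using sum_nat_eq_sum_int[of "\<lambda>i. \<Sum>j\<in>{1..int H}. \<bar>\<sigma> (j - i)\<bar>" H]
    by (simp only: sum_nat_eq_sum_int[of "\<lambda>j. \<bar>\<sigma> (j - int _)\<bar>" H])
  also have "\<dots> \<le> 2 * real H * (\<Sum>h<H. \<bar>\<sigma> (int h)\<bar>)"
    by (rule double_sum_lag_le[of "\<lambda>h. \<bar>\<sigma> h\<bar>"]) (simp_all add: sym)
  also have "\<dots> \<le> 2 * real H * (real H * (e / 2))" using half by (intro mult_left_mono) auto
  also have "\<dots> = e * (real H)\<^sup>2" by (simp add: power2_eq_square)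
  finally show ?thesis using H by blast
qed

text \<open>A deterministic statement. The covariance error \<open>\<rho>\<close> splits into its common value \<open>\<rho> 0\<close> and
  a remainder \<open>\<tau>\<close>. In the Yule-Walker equations the common value acts as a constant right-hand side,
  proportional to \<open>1 - (\<Sum>i=1..k. \<phi> i)\<close>, and the response to a constant is controlled by the bound \<open>B\<close> on
  sums; this is much better than the bound by the smallest eigenvalue \<open>\<mu>\<close>, which is used only for \<open>\<tau>\<close>.

  The perturbed form must not degenerate. A large positive \<open>\<rho> 0\<close> only increases it. A large negative
  \<open>\<rho> 0\<close> is impossible if \<open>\<tau>\<close> is small: the form of \<open>r\<close> at the constant vector of length \<open>H\<close> is nonnegative,
  but it is nearly \<open>\<rho> 0 * H\<^sup>2\<close>.\<close>

lemma yule_walker_perturbation: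
  fixes \<sigma> r :: "int \<Rightarrow> real"
  assumes H: "k \<le> H" "1 \<le> H" and sym: "\<And>h. \<sigma> (- h) = \<sigma> h" "\<And>h. r (- h) = r h"
    and mu: "\<mu> > 0" "\<And>w. \<mu> * (\<Sum>i=1..k. (w i)\<^sup>2) \<le> toeplitz_form \<sigma> {1..k} w"
    and B: "B > 0" "\<And>w. (\<Sum>i=1..k. w i)\<^sup>2 \<le> B * toeplitz_form \<sigma> {1..k} w"
    and psd: "0 \<le> toeplitz_form r {1..H} (\<lambda>_. 1)"
    and mean: "toeplitz_form \<sigma> {1..H} (\<lambda>_. 1) \<le> \<delta> * (real H)\<^sup>2"
    and delta: "0 \<le> \<delta>" "8 * \<delta> * B \<le> 1" "4 * \<delta> * real k \<le> \<mu>"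
    and yw: "yule_walker r k \<phi>'" "yule_walker \<sigma> k \<phi>"
  defines "\<rho> \<equiv> \<lambda>h. r h - \<sigma> h"
  assumes close: "\<And>h. h \<le> H \<Longrightarrow> \<bar>\<rho> (int h) - \<rho> 0\<bar> \<le> \<delta>"
  shows "toeplitz_form \<sigma> {1..k} (\<lambda>i. \<phi>' i - \<phi> i)
    \<le> 8 * B * (1 - (\<Sum>i=1..k. \<phi> i))\<^sup>2 * (\<rho> 0)\<^sup>2
      + 8 * real k * (1 + (\<Sum>i=1..k. \<bar>\<phi> i\<bar>))\<^sup>2 / \<mu> * (\<Sum>h\<le>H. (\<rho> (int h) - \<rho> 0)\<^sup>2)"
proof -
  define \<tau> where "\<tau> = (\<lambda>h. \<rho> h - \<rho> 0)"
  define Dl where "Dl = (\<Sum>h\<le>H. (\<rho> (int h) - \<rho> 0)\<^sup>2)"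
  have r_eq: "r h = \<sigma> h + (\<rho> 0 + \<tau> h)" for h by (simp add: \<tau>_def \<rho>_def)
  have tau_abs: "\<tau> h = \<tau> (int (nat \<bar>h\<bar>))" for h
    using sym[of h] by (auto simp: \<tau>_def \<rho>_def abs_if)
  have tau_le: "\<bar>\<tau> (int i - int j)\<bar> \<le> \<delta>" "(\<tau> (int i - int j))\<^sup>2 \<le> Dl" if "i \<le> H" "j \<le> H" for i j
  proof -
    have n: "nat \<bar>int i - int j\<bar> \<le> H" using that by auto
    show "\<bar>\<tau> (int i - int j)\<bar> \<le> \<delta>"
      using close[OF n] tau_abs[of "int i - int j"] by (simp only: \<tau>_def)
    have "(\<tau> (int (nat \<bar>int i - int j\<bar>)))\<^sup>2 \<le> Dl"
      unfolding Dl_def \<tau>_def using n by (intro member_le_sum[of _ _ "\<lambda>h. (\<rho> (int h) - \<rho> 0)\<^sup>2"]) auto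
    then show "(\<tau> (int i - int j))\<^sup>2 \<le> Dl" using tau_abs[of "int i - int j"] by simp
  qed
  have split: "toeplitz_form r I w = toeplitz_form \<sigma> I w + \<rho> 0 * (\<Sum>i\<in>I. w i)\<^sup>2 + toeplitz_form \<tau> I w" for I w
  proof -
    have "toeplitz_form r I w = toeplitz_form \<sigma> I w + \<rho> 0 * (\<Sum>i\<in>I. \<Sum>j\<in>I. w i * w j) + toeplitz_form \<tau> I w"
      unfolding toeplitz_form_def r_eq by (simp add: algebra_simps sum.distrib sum_distrib_left)
    then show ?thesis by (simp add: power2_eq_square sum_product)
  qed
  have tau_form: "\<bar>toeplitz_form \<tau> {1..n} w\<bar> \<le> \<delta> * (\<Sum>i=1..n. \<bar>w i\<bar>)\<^sup>2" if "n \<le> H" for n w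
  proof -
    have "\<bar>toeplitz_form \<tau> {1..n} w\<bar> \<le> (\<Sum>i=1..n. \<Sum>j=1..n. \<bar>w i * w j * \<tau> (int i - int j)\<bar>)"
      unfolding toeplitz_form_def by (intro order.trans[OF sum_abs] sum_mono sum_abs)
    also have "\<dots> \<le> (\<Sum>i=1..n. \<Sum>j=1..n. \<delta> * (\<bar>w i\<bar> * \<bar>w j\<bar>))"
    proof (intro sum_mono)
      fix i j assume "i \<in> {1..n}" "j \<in> {1..n}"
      then have "\<bar>\<tau> (int i - int j)\<bar> \<le> \<delta>" using that by (intro tau_le(1)) auto
      then have "\<bar>w i * w j\<bar> * \<bar>\<tau> (int i - int j)\<bar> \<le> \<bar>w i * w j\<bar> * \<delta>" by (rule mult_left_mono) simp
      then show "\<bar>w i * w j * \<tau> (int i - int j)\<bar> \<le> \<delta> * (\<bar>w i\<bar> * \<bar>w j\<bar>)"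
        by (simp only: abs_mult mult.commute[of \<delta>])
    qed
    also have "\<dots> = \<delta> * (\<Sum>i=1..n. \<bar>w i\<bar>)\<^sup>2"
      unfolding power2_eq_square sum_product by (simp only: sum_distrib_left)
    finally show ?thesis .
  qed
  \<comment> \<open>Two summands of at most \<open>\<delta> * H\<^sup>2\<close> each: the form of \<open>\<sigma>\<close>, and that of \<open>\<tau>\<close>.\<close>
  have rho0: "\<rho> 0 \<ge> - (2 * \<delta>)"
  proof -
    have "0 \<le> toeplitz_form \<sigma> {1..H} (\<lambda>_. 1) + \<rho> 0 * (real H)\<^sup>2 + toeplitz_form \<tau> {1..H} (\<lambda>_. 1)"
      using psd split[of "{1..H}" "\<lambda>_. 1"] by simp
    also have "\<dots> \<le> \<delta> * (real H)\<^sup>2 + \<rho> 0 * (real H)\<^sup>2 + \<delta> * (real H)\<^sup>2"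
      using tau_form[of H "\<lambda>_. 1"] mean by simp
    also have "\<dots> = (2 * \<delta> + \<rho> 0) * (real H)\<^sup>2" by (simp add: algebra_simps)
    finally show ?thesis using H by (simp add: zero_le_mult_iff)
  qed
  define e where "e = (\<lambda>i. \<phi>' i - \<phi> i)"
  define Q where "Q = toeplitz_form \<sigma> {1..k} e"
  define n2 where "n2 = (\<Sum>i=1..k. (e i)\<^sup>2)"
  have n2: "\<mu> * n2 \<le> Q" unfolding n2_def Q_def by (rule mu(2))
  have n2_nonneg: "n2 \<ge> 0" unfolding n2_def by (rule sum_nonneg) simp
  have Q: "(\<Sum>i=1..k. e i)\<^sup>2 \<le> B * Q" unfolding Q_def by (rule B(2))
  have Q0: "Q \<ge> 0" using mult_nonneg_nonneg[OF less_imp_le[OF mu(1)] n2_nonneg] n2 by linarith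
  have low: "Q / 2 \<le> toeplitz_form r {1..k} e"
  proof -
    have "- (2 * \<delta>) * (\<Sum>i=1..k. e i)\<^sup>2 \<le> \<rho> 0 * (\<Sum>i=1..k. e i)\<^sup>2"
      by (intro mult_right_mono rho0) auto
    moreover have "2 * \<delta> * (\<Sum>i=1..k. e i)\<^sup>2 \<le> Q / 4"
    proof -
      have "2 * \<delta> * (\<Sum>i=1..k. e i)\<^sup>2 \<le> 2 * \<delta> * (B * Q)" using Q delta by (intro mult_left_mono) auto
      also have "\<dots> = (8 * \<delta> * B) * (Q / 4)" by simp
      also have "\<dots> \<le> 1 * (Q / 4)" using delta Q0 by (intro mult_right_mono) auto
      finally show ?thesis by simp
    qed
    moreover have "\<bar>toeplitz_form \<tau> {1..k} e\<bar> \<le> Q / 4"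
    proof -
      have "(\<Sum>i=1..k. \<bar>e i\<bar>)\<^sup>2 \<le> real k * n2"
        using sum_squared_le_sum_of_squares[of "\<lambda>i. \<bar>e i\<bar>" "{1..k}"] by (simp add: n2_def mult.commute)
      then have "\<delta> * (\<Sum>i=1..k. \<bar>e i\<bar>)\<^sup>2 \<le> \<delta> * (real k * n2)" using delta by (intro mult_left_mono) auto
      also have "\<dots> = (4 * \<delta> * real k) * n2 / 4" by simp
      also have "\<dots> \<le> \<mu> * n2 / 4" using delta n2_nonneg by (intro divide_right_mono mult_right_mono) auto
      also have "\<dots> \<le> Q / 4" using n2 by simp
      finally show ?thesis using tau_form[OF H(1), of e] by linarith
    qed
    ultimately show ?thesis using split[of "{1..k}" e] unfolding Q_def[symmetric] by simp
  qed
  define p where "p = 1 - (\<Sum>i=1..k. \<phi> i)"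
  define g where "g = (\<lambda>j. \<tau> (int j) - (\<Sum>i=1..k. \<phi> i * \<tau> (int i - int j)))"
  have row: "(\<Sum>i=1..k. e i * r (int i - int j)) = p * \<rho> 0 + g j" if j: "j \<in> {1..k}" for j
  proof -
    have "(\<Sum>i=1..k. e i * r (int i - int j)) = r (int j) - (\<Sum>i=1..k. \<phi> i * r (int i - int j))"
      using yw(1) j by (simp add: e_def yule_walker_def left_diff_distrib sum_subtractf)
    also have "\<dots> = (\<sigma> (int j) + \<rho> 0 + \<tau> (int j)) - (\<sigma> (int j) + \<rho> 0 * (\<Sum>i=1..k. \<phi> i) + (\<Sum>i=1..k. \<phi> i * \<tau> (int i - int j)))"
      using yw(2) j unfolding r_eq yule_walker_def
      by (simp add: algebra_simps sum.distrib sum_distrib_left)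
    finally show ?thesis by (simp add: p_def g_def algebra_simps)
  qed
  define W where "W = 1 + (\<Sum>i=1..k. \<bar>\<phi> i\<bar>)"
  have Dl0: "Dl \<ge> 0" unfolding Dl_def by (intro sum_nonneg) simp
  have g: "(g j)\<^sup>2 \<le> W\<^sup>2 * Dl" if j: "j \<in> {1..k}" for j
  proof -
    have t: "\<bar>\<tau> (int i - int j)\<bar> \<le> sqrt Dl" if "i \<le> H" for i
      using tau_le(2)[OF that, of j] j H by (intro real_le_rsqrt) auto
    have "\<bar>g j\<bar> \<le> \<bar>\<tau> (int j)\<bar> + \<bar>\<Sum>i=1..k. \<phi> i * \<tau> (int i - int j)\<bar>"
      unfolding g_def by (rule abs_triangle_ineq4)
    also have "\<dots> \<le> sqrt Dl + (\<Sum>i=1..k. \<bar>\<phi> i\<bar> * sqrt Dl)"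
    proof (intro add_mono)
      show "\<bar>\<tau> (int j)\<bar> \<le> sqrt Dl" using t[of 0] tau_abs[of "- int j"] by simp
      show "\<bar>\<Sum>i=1..k. \<phi> i * \<tau> (int i - int j)\<bar> \<le> (\<Sum>i=1..k. \<bar>\<phi> i\<bar> * sqrt Dl)"
        using t H by (intro order.trans[OF sum_abs] sum_mono) (auto simp: abs_mult intro!: mult_left_mono)
    qed
    also have "\<dots> = W * sqrt Dl" by (simp add: W_def algebra_simps sum_distrib_left)
    finally have "\<bar>g j\<bar>\<^sup>2 \<le> (W * sqrt Dl)\<^sup>2" by (intro power_mono) auto
    then show ?thesis using Dl0 by (simp add: power_mult_distrib)
  qed
  have "toeplitz_form r {1..k} e = (\<Sum>j=1..k. e j * (p * \<rho> 0 + g j))"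
    unfolding toeplitz_form_rows by (intro sum.cong refl) (simp only: row)
  also have "\<dots> = (p * \<rho> 0) * (\<Sum>j=1..k. e j) + (\<Sum>j=1..k. e j * g j)"
    by (simp add: algebra_simps sum.distrib sum_distrib_left)
  finally have eq: "toeplitz_form r {1..k} e = (p * \<rho> 0) * (\<Sum>j=1..k. e j) + (\<Sum>j=1..k. e j * g j)" .
  \<comment> \<open>The weights \<open>4 * B\<close> and \<open>\<mu> / 4\<close> below leave \<open>Q / 8\<close> from each of the two terms, to be absorbed
    into \<open>Q / 2\<close>.\<close>
  have young: "x * y \<le> x\<^sup>2 * c / 2 + y\<^sup>2 / (2 * c)" if "c > 0" for x y c :: real
  proof -
    have "0 \<le> (x * c - y)\<^sup>2 / (2 * c)" using that by simp
    also have "\<dots> = x\<^sup>2 * c / 2 + y\<^sup>2 / (2 * c) - x * y"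
      using that by (simp add: power2_eq_square field_simps)
    finally show ?thesis by simp
  qed
  have "(p * \<rho> 0) * (\<Sum>j=1..k. e j) \<le> (p * \<rho> 0)\<^sup>2 * (4 * B) / 2 + (\<Sum>j=1..k. e j)\<^sup>2 / (2 * (4 * B))"
    using B(1) by (intro young) simp
  moreover have "(\<Sum>j=1..k. e j)\<^sup>2 / (2 * (4 * B)) \<le> Q / 8"
    using Q B(1) by (simp add: field_simps)
  moreover have "(\<Sum>j=1..k. e j * g j) \<le> Q / 8 + 2 * real k * W\<^sup>2 / \<mu> * Dl"
  proof -
    have "(\<Sum>j=1..k. e j * g j) \<le> (\<Sum>j=1..k. (e j)\<^sup>2 * (\<mu> / 4) / 2 + W\<^sup>2 * Dl / (2 * (\<mu> / 4)))"
    proof (rule sum_mono)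
      fix j assume j: "j \<in> {1..k}"
      have "e j * g j \<le> (e j)\<^sup>2 * (\<mu> / 4) / 2 + (g j)\<^sup>2 / (2 * (\<mu> / 4))" using mu(1) by (intro young) simp
      also have "(g j)\<^sup>2 / (2 * (\<mu> / 4)) \<le> W\<^sup>2 * Dl / (2 * (\<mu> / 4))"
        using g[OF j] mu(1) by (intro divide_right_mono) auto
      finally show "e j * g j \<le> (e j)\<^sup>2 * (\<mu> / 4) / 2 + W\<^sup>2 * Dl / (2 * (\<mu> / 4))" by simp
    qed
    also have "\<dots> = \<mu> * n2 / 8 + 2 * real k * W\<^sup>2 / \<mu> * Dl"
      by (simp add: n2_def sum.distrib sum_divide_distrib[symmetric] sum_distrib_left[symmetric] mult_ac)
    also have "\<dots> \<le> Q / 8 + 2 * real k * W\<^sup>2 / \<mu> * Dl" using n2 by simp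
    finally show ?thesis .
  qed
  ultimately have "Q / 4 \<le> 2 * B * (p * \<rho> 0)\<^sup>2 + 2 * real k * W\<^sup>2 / \<mu> * Dl"
    using low eq by simp
  then have "Q \<le> 8 * B * p\<^sup>2 * (\<rho> 0)\<^sup>2 + 8 * real k * W\<^sup>2 / \<mu> * Dl"
    by (simp add: power_mult_distrib)
  then show ?thesis unfolding Q_def e_def p_def W_def Dl_def .
qed

section \<open>The expected squared prediction error\<close>

text \<open>Positive definiteness of the empirical covariances rests on a nonzero observation; a Gaussian
  variable of positive variance has no atom at \<open>0\<close>.\<close>

lemma (in stationary_gaussian) AE_nonzero:
  assumes "\<gamma> 0 \<noteq> 0"
  shows "AE \<omega> in M. z n \<omega> \<noteq> 0"
  using gaussian_single[of n] unfolding gaussian_rv_def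
proof (elim disjE exE conjE)
  fix \<mu> s :: real
  assume D: "distributed M lborel (z n) (\<lambda>x. ennreal (normal_density \<mu> s x))"
  have "(AE \<omega> in M. z n \<omega> \<noteq> 0) \<longleftrightarrow> (AE x in lborel. 0 < ennreal (normal_density \<mu> s x) \<longrightarrow> x \<noteq> 0)"
    by (intro distributed_AE2[OF D]) measurable
  moreover have "AE x in lborel. x \<noteq> (0::real)" by (rule AE_lborel_singleton)
  ultimately show ?thesis by auto
next
  fix \<mu> :: real
  assume ae: "AE \<omega> in M. z n \<omega> = \<mu>"
  have "expectation (z n) = expectation (\<lambda>_. \<mu>)" using ae single(1) by (intro integral_cong_AE) auto
  then have "\<mu> = 0" using mean_zero by (simp add: prob_space)
  then have "AE \<omega> in M. (z n \<omega>)\<^sup>2 = 0" using ae by auto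
  then have "expectation (\<lambda>\<omega>. (z n \<omega>)\<^sup>2) = expectation (\<lambda>_. 0)" using single(1) by (intro integral_cong_AE) auto
  then show ?thesis using variance_eq[of n] assms by simp
qed

lemma abs_toeplitz_form_le:
  assumes r: "\<And>h. \<bar>r h\<bar> \<le> s" and w: "\<And>i. i \<in> I \<Longrightarrow> \<bar>w i\<bar> \<le> c"
  shows "\<bar>toeplitz_form r I w\<bar> \<le> (real (card I))\<^sup>2 * (c\<^sup>2 * s)"
proof -
  have s: "s \<ge> 0" using r[of 0] by linarith
  have "\<bar>toeplitz_form r I w\<bar> \<le> (\<Sum>i\<in>I. \<Sum>j\<in>I. \<bar>w i * w j * r (int i - int j)\<bar>)"
    unfolding toeplitz_form_def by (intro order.trans[OF sum_abs] sum_mono sum_abs)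
  also have "\<dots> \<le> (\<Sum>i\<in>I. \<Sum>j\<in>I. c\<^sup>2 * s)"
  proof (intro sum_mono)
    fix i j assume ij: "i \<in> I" "j \<in> I"
    then have "0 \<le> c" using w[of i] by linarith
    then have "\<bar>w i\<bar> * \<bar>w j\<bar> * \<bar>r (int i - int j)\<bar> \<le> c * c * s"
      using ij w r s by (intro mult_mono) auto
    then show "\<bar>w i * w j * r (int i - int j)\<bar> \<le> c\<^sup>2 * s" by (simp add: abs_mult power2_eq_square)
  qed
  also have "\<dots> = (real (card I))\<^sup>2 * (c\<^sup>2 * s)" by (simp add: power2_eq_square)
  finally show ?thesis .
qed

text \<open>Given the coefficients, an independent copy of the process contributes only through its
  covariances.\<close>

lemma (in prob_space) prediction_second_moment_independent_coefficients:
  fixes X Y :: "int \<Rightarrow> 'a \<Rightarrow> real" and g :: "nat \<Rightarrow> (int \<Rightarrow> real) \<Rightarrow> real"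
  assumes indep: "indep_var (\<Pi>\<^sub>M n\<in>UNIV. borel) (\<lambda>\<omega> n. X n \<omega>) (\<Pi>\<^sub>M n\<in>UNIV. borel) (\<lambda>\<omega> n. Y n \<omega>)"
    and X: "\<And>n. X n \<in> borel_measurable M" "\<And>n. integrable M (\<lambda>\<omega>. (X n \<omega>)\<^sup>2)"
    and cov: "\<And>m n. expectation (\<lambda>\<omega>. X m \<omega> * X n \<omega>) = \<sigma> (n - m)"
    and g: "\<And>i. g i \<in> borel_measurable (\<Pi>\<^sub>M n\<in>UNIV. borel)"
    and bound: "\<And>i y. i \<in> {1..k} \<Longrightarrow> \<bar>g i y\<bar> \<le> c"
  defines "e \<equiv> \<lambda>\<omega> j. g j (\<lambda>n. Y n \<omega>)"
  shows "integrable M (\<lambda>\<omega>. (one_step_predictor k (e \<omega>) X \<omega>)\<^sup>2)"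
    and "integrable M (\<lambda>\<omega>. toeplitz_form \<sigma> {1..k} (e \<omega>))"
    and "expectation (\<lambda>\<omega>. (one_step_predictor k (e \<omega>) X \<omega>)\<^sup>2) = expectation (\<lambda>\<omega>. toeplitz_form \<sigma> {1..k} (e \<omega>))"
proof -
  let ?P = "(\<Pi>\<^sub>M n\<in>UNIV. borel) :: (int \<Rightarrow> real) measure"
  have Ym: "(\<lambda>\<omega> n. Y n \<omega>) \<in> measurable M ?P" using indep by (rule indep_var_rv2)
  have em: "(\<lambda>\<omega>. e \<omega> j) \<in> borel_measurable M" for j
    unfolding e_def using measurable_compose[OF Ym g] by simp
  have ei: "integrable M (\<lambda>\<omega>. e \<omega> i * e \<omega> j)" if ij: "i \<in> {1..k}" "j \<in> {1..k}" for i j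
  proof (rule integrable_const_bound[where B = "c * c"])
    have "0 \<le> c" using bound[OF ij(1), of undefined] by linarith
    then have "\<bar>e \<omega> i\<bar> * \<bar>e \<omega> j\<bar> \<le> c * c" for \<omega>
      unfolding e_def using bound ij by (intro mult_mono) auto
    then show "AE \<omega> in M. norm (e \<omega> i * e \<omega> j) \<le> c * c" by (simp add: abs_mult)
  qed (use em in measurable)
  have Xi: "integrable M (\<lambda>\<omega>. X m \<omega> * X n \<omega>)" for m n by (intro integrable_mult_of_squares X)
  have ind: "indep_var borel (\<lambda>\<omega>. X m \<omega> * X n \<omega>) borel (\<lambda>\<omega>. e \<omega> i * e \<omega> j)" for m n i j
  proof -
    have "indep_var borel ((\<lambda>x. x m * x n) \<circ> (\<lambda>\<omega> n. X n \<omega>)) borel ((\<lambda>y. g i y * g j y) \<circ> (\<lambda>\<omega> n. Y n \<omega>))"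
      using g by (intro indep_var_compose[OF indep] borel_measurable_times measurable_component_singleton) auto
    then show ?thesis by (simp add: comp_def e_def)
  qed
  have eq: "(one_step_predictor k (e \<omega>) X \<omega>)\<^sup>2
     = (\<Sum>i=1..k. \<Sum>j=1..k. (X (int k + 1 - int i) \<omega> * X (int k + 1 - int j) \<omega>) * (e \<omega> i * e \<omega> j))" for \<omega>
    unfolding one_step_predictor_def power2_eq_square sum_product by (intro sum.cong refl) (simp add: mult_ac)
  have pi: "integrable M (\<lambda>\<omega>. (X m \<omega> * X n \<omega>) * (e \<omega> i * e \<omega> j))" if "i \<in> {1..k}" "j \<in> {1..k}" for i j m n
    by (rule indep_var_integrable[OF ind Xi ei[OF that]])
  show "integrable M (\<lambda>\<omega>. (one_step_predictor k (e \<omega>) X \<omega>)\<^sup>2)"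
    unfolding eq by (intro Bochner_Integration.integrable_sum pi)
  have ti: "integrable M (\<lambda>\<omega>. e \<omega> i * e \<omega> j * \<sigma> (int i - int j))" if "i \<in> {1..k}" "j \<in> {1..k}" for i j
    using ei[OF that] by (rule integrable_mult_left)
  show "integrable M (\<lambda>\<omega>. toeplitz_form \<sigma> {1..k} (e \<omega>))"
    unfolding toeplitz_form_def by (intro Bochner_Integration.integrable_sum ti)
  have "expectation (\<lambda>\<omega>. (one_step_predictor k (e \<omega>) X \<omega>)\<^sup>2)
      = (\<Sum>i=1..k. \<Sum>j=1..k. expectation (\<lambda>\<omega>. (X (int k + 1 - int i) \<omega> * X (int k + 1 - int j) \<omega>) * (e \<omega> i * e \<omega> j)))"
    unfolding eq
    by (subst Bochner_Integration.integral_sum)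
      (intro Bochner_Integration.integrable_sum sum.cong refl Bochner_Integration.integral_sum pi; assumption)+
  also have "\<dots> = (\<Sum>i=1..k. \<Sum>j=1..k. expectation (\<lambda>\<omega>. e \<omega> i * e \<omega> j * \<sigma> (int i - int j)))"
  proof (intro sum.cong refl)
    fix i j assume ij: "i \<in> {1..k}" "j \<in> {1..k}"
    show "expectation (\<lambda>\<omega>. (X (int k + 1 - int i) \<omega> * X (int k + 1 - int j) \<omega>) * (e \<omega> i * e \<omega> j))
      = expectation (\<lambda>\<omega>. e \<omega> i * e \<omega> j * \<sigma> (int i - int j))"
      using indep_var_lebesgue_integral[OF ind Xi ei[OF ij], of "int k + 1 - int i" "int k + 1 - int j"] ei[OF ij]
      by (simp add: cov mult.commute)
  qed
  also have "\<dots> = expectation (\<lambda>\<omega>. toeplitz_form \<sigma> {1..k} (e \<omega>))"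
    unfolding toeplitz_form_def
    by (subst Bochner_Integration.integral_sum)
      (intro Bochner_Integration.integrable_sum sum.cong refl Bochner_Integration.integral_sum[symmetric] ti; assumption)+
  finally show "expectation (\<lambda>\<omega>. (one_step_predictor k (e \<omega>) X \<omega>)\<^sup>2) = expectation (\<lambda>\<omega>. toeplitz_form \<sigma> {1..k} (e \<omega>))" .
qed

lemma one_step_predictor_diff:
  "one_step_predictor k c X \<omega> - one_step_predictor k c' X \<omega> = one_step_predictor k (\<lambda>j. c j - c' j) X \<omega>"
  by (simp add: one_step_predictor_def left_diff_distrib sum_subtractf)

text \<open>Let \<open>Dl\<close> be the sum of the squared differences of the covariance errors at the lags
  \<open>0, \<dots>, H\<close> from the error at lag \<open>0\<close>. If \<open>Dl \<le> \<delta>\<^sup>2\<close>, the perturbation bound applies. Otherwise the universal bound on the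
  coefficients is multiplied by \<open>Dl / \<delta>\<^sup>2 \<ge> 1\<close>. Since the expectation of \<open>Dl\<close> is of smaller order than \<open>R T\<close>, for
  fixed \<open>k\<close>, the exceptional event needs no finer probability estimate than Markov's inequality, and the
  constants \<open>\<delta>\<close>, \<open>H\<close> and the bound on the coefficients may depend on \<open>k\<close> in any way.\<close>

lemma expected_prediction_error_bound:
  fixes M :: "'a measure" and X Y \<epsilon>X \<epsilon>Y :: "int \<Rightarrow> 'a \<Rightarrow> real"
    and ak :: "nat \<Rightarrow> nat \<Rightarrow> real" and ahat :: "nat \<Rightarrow> nat \<Rightarrow> nat \<Rightarrow> 'a \<Rightarrow> real"
  assumes d: "1 / 4 \<le> d" "d < 1 / 2"
    and X: "long_memory_process M X \<epsilon>X \<sigma> a b s2 d"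
    and Y: "long_memory_process M Y \<epsilon>Y \<sigma> a b s2 d"
    and indep: "prob_space.indep_var M (\<Pi>\<^sub>M n\<in>UNIV. borel) (\<lambda>\<omega> n. X n \<omega>) (\<Pi>\<^sub>M n\<in>UNIV. borel) (\<lambda>\<omega> n. Y n \<omega>)"
    and gaussian: "gaussian_process M Y"
    and lam: "lam > 0" and asym: "(\<lambda>j. \<sigma> (int j)) \<sim>[at_top] (\<lambda>j. lam * real j powr (2 * d - 1))"
    and f: "spectral_density \<sigma> f" and c: "c > 0"
    and lb: "\<And>x. x \<in> {-pi..pi} - {0} \<Longrightarrow> c * \<bar>x\<bar> powr (- 2 * d) \<le> f x"
    and ak: "\<And>k. yule_walker \<sigma> k (ak k)"
    and ahat_measurable: "\<And>T k i. i \<in> {1..k} \<Longrightarrow> ahat T k i \<in> borel_measurable M"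
    and ahat: "\<And>T k \<omega>. \<omega> \<in> space M \<Longrightarrow> yule_walker (empirical_covariance Y T \<omega>) k (\<lambda>i. ahat T k i \<omega>)"
  defines "sq_error \<equiv> (\<lambda>T k \<omega>.
    (one_step_predictor k (\<lambda>j. ahat T k j \<omega>) X \<omega> - one_step_predictor k (ak k) X \<omega>)\<^sup>2)"
  shows "\<exists>K. \<forall>k\<ge>1. \<forall>\<^sub>F T in sequentially. integrable M (sq_error T k) \<and>
    integral\<^sup>L M (sq_error T k) \<le> K * real k powr (1 - 2 * d) * ((\<Sum>s<T. (\<sigma> (int s))\<^sup>2) / real T)"
proof -
  interpret X: long_memory_process M X \<epsilon>X \<sigma> a b s2 d by (rule X)
  interpret Y: long_memory_process M Y \<epsilon>Y \<sigma> a b s2 d by (rule Y)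
  interpret G: stationary_gaussian M Y \<sigma>
    by unfold_locales (rule gaussian Y.X_mean Y.covariance_eq)+
  note sym = X.autocovariance_sym
  have d0: "0 < d" using d by simp
  have psd: "0 \<le> toeplitz_form \<sigma> I w" if "finite I" for I w
    using toeplitz_form_ge_sum_squares[OF f that, of 0 w] f by (auto simp: spectral_density_def)
  obtain C where C: "C > 0"
    "\<And>k w. k \<ge> 1 \<Longrightarrow> (\<Sum>i=1..k. w i)\<^sup>2 \<le> C * real k powr (1 - 2 * d) * toeplitz_form \<sigma> {1..k} w"
    using sum_squared_le_toeplitz_form[OF f d0 d(2) c lb] by blast
  obtain P where P: "\<And>k. k \<ge> 1 \<Longrightarrow> \<bar>1 - (\<Sum>i=1..k. ak k i)\<bar> \<le> P"
    using X.sum_predictor_coefficients_bounded[OF d asym psd C ak] by blast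
  define \<mu> where "\<mu> = 2 * pi * (c * pi powr (- 2 * d))"
  have mu: "\<mu> > 0" using c by (simp add: \<mu>_def)
  have mu_le: "\<mu> * (\<Sum>i\<in>I. (w i)\<^sup>2) \<le> toeplitz_form \<sigma> I w" if "finite I" for I w
    unfolding \<mu>_def
  proof (rule toeplitz_form_ge_sum_squares[OF f that])
    fix x assume x: "x \<in> {-pi..pi} - {0::real}"
    then have "c * pi powr (- 2 * d) \<le> c * \<bar>x\<bar> powr (- 2 * d)"
      using c d0 by (intro mult_left_mono powr_mono2') auto
    also have "\<dots> \<le> f x" by (rule lb[OF x])
    finally show "c * pi powr (- 2 * d) \<le> f x" .
  qed
  have s0: "\<sigma> 0 > 0"
    using mu_le[of "{0}" "\<lambda>_. 1"] mu by (simp add: toeplitz_form_def)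
  have zero: "(\<lambda>s. \<sigma> (int s)) \<longlonglongrightarrow> 0"
    using d by (intro autocovariance_tendsto_0[OF lam _ asym]) simp
  define R where "R = (\<lambda>T. (\<Sum>s<T. (\<sigma> (int s))\<^sup>2) / real T)"
  have "\<forall>\<^sub>F T in sequentially. integrable M (sq_error T k) \<and>
    integral\<^sup>L M (sq_error T k) \<le> ((32 * P\<^sup>2 + 1) * C) * real k powr (1 - 2 * d) * R T" if k: "k \<ge> 1" for k
  proof -
    define B where "B = C * real k powr (1 - 2 * d)"
    have B: "B > 0" "\<And>w. (\<Sum>i=1..k. w i)\<^sup>2 \<le> B * toeplitz_form \<sigma> {1..k} w"
      using C k by (auto simp: B_def)
    \<comment> \<open>The largest value that the perturbation bound admits.\<close>
    define \<delta> where "\<delta> = min (1 / (8 * B)) (\<mu> / (4 * real k))"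
    have delta: "\<delta> > 0" "8 * \<delta> * B \<le> 1" "4 * \<delta> * real k \<le> \<mu>"
    proof -
      show "\<delta> > 0" using B mu k by (simp add: \<delta>_def)
      have "\<delta> \<le> 1 / (8 * B)" "\<delta> \<le> \<mu> / (4 * real k)" by (auto simp: \<delta>_def)
      then show "8 * \<delta> * B \<le> 1" "4 * \<delta> * real k \<le> \<mu>"
        using B k by (simp_all add: pos_le_divide_eq mult_ac)
    qed
    obtain H where H: "H \<ge> k" "H \<ge> 1" "toeplitz_form \<sigma> {1..H} (\<lambda>_. 1) \<le> \<delta> * (real H)\<^sup>2"
      using variance_of_mean_small[OF sym zero delta(1), of k] by blast
    define S where "S = (\<Sum>i=1..k. \<bar>ak k i\<bar>)"
    define E where "E = (real k)\<^sup>2 * ((2 ^ k + S)\<^sup>2 * \<sigma> 0)"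
    define c2 where "c2 = 8 * real k * (1 + S)\<^sup>2 / \<mu> + E / \<delta>\<^sup>2"
    have S0: "S \<ge> 0" by (simp add: S_def sum_nonneg)
    have E0: "E \<ge> 0" using s0 by (simp add: E_def)
    have c2: "c2 > 0" using k mu S0 E0 delta by (auto simp: c2_def intro!: add_pos_nonneg divide_pos_pos mult_pos_pos)
    define diff where "diff = (\<lambda>T h \<omega>. (G.covariance_error T \<omega> (int h) - G.covariance_error T \<omega> 0)\<^sup>2)"
    \<comment> \<open>Chosen so that the \<open>H + 1\<close> remainder terms together contribute \<open>B * R T\<close>.\<close>
    define \<eta> where "\<eta> = B / (c2 * real (Suc H))"
    have eta: "\<eta> > 0" using B c2 by (simp add: \<eta>_def)
    have small_eventually: "\<forall>\<^sub>F T in sequentially. \<forall>h\<in>{..H}. X.expectation (diff T h) \<le> \<eta> * R T"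
      unfolding diff_def R_def using d
      by (intro eventually_ball_finite ballI G.covariance_error_difference_smallo[OF lam _ asym eta]) auto
    have bound: "integrable M (sq_error T k) \<and>
      integral\<^sup>L M (sq_error T k) \<le> ((32 * P\<^sup>2 + 1) * C) * real k powr (1 - 2 * d) * R T"
      if small: "\<forall>h\<in>{..H}. X.expectation (diff T h) \<le> \<eta> * R T" and T: "T > H" for T
    proof -
      define r where "r = (\<lambda>y. empirical_covariance (\<lambda>n y. y n) T (y :: int \<Rightarrow> real))"
      have r_path: "r (\<lambda>n. Y n \<omega>) = empirical_covariance Y T \<omega>" for \<omega>
        by (simp add: r_def empirical_covariance_def fun_eq_iff)
      have T1: "T \<ge> 1" using T by simp
      have pd: "positive_definite (r y)" if "y \<in> {y. y 1 \<noteq> 0}" for y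
        unfolding r_def using that T1 by (intro empirical_covariance_positive_definite) auto
      have rm: "(\<lambda>y. r y h) \<in> borel_measurable (\<Pi>\<^sub>M n\<in>UNIV. borel)" for h
        unfolding r_def empirical_covariance_def
        by (intro borel_measurable_times borel_measurable_const borel_measurable_sum measurable_component_singleton) auto
      from yule_walker_measurable_bounded_solution[where k = k and r = r and A = "{y. y 1 \<noteq> 0}", OF rm pd]
      obtain \<phi> where \<phi>m: "\<forall>i. \<phi> i \<in> borel_measurable (\<Pi>\<^sub>M n\<in>UNIV. borel)"
        and \<phi>s: "\<forall>y\<in>{y. y 1 \<noteq> 0}. yule_walker (r y) k (\<lambda>i. \<phi> i y) \<and> (\<forall>i\<in>{1..k}. \<bar>\<phi> i y\<bar> \<le> 2 ^ k)"
        by blast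
      have \<phi>: "\<And>i. \<phi> i \<in> borel_measurable (\<Pi>\<^sub>M n\<in>UNIV. borel)"
        "\<And>y. y 1 \<noteq> 0 \<Longrightarrow> yule_walker (r y) k (\<lambda>i. \<phi> i y)"
        "\<And>y i. y 1 \<noteq> 0 \<Longrightarrow> i \<in> {1..k} \<Longrightarrow> \<bar>\<phi> i y\<bar> \<le> 2 ^ k"
        using \<phi>m \<phi>s by blast+
      \<comment> \<open>The value \<open>0\<close> on the null event \<open>y 1 = 0\<close> keeps \<open>g\<close> bounded everywhere.\<close>
      define g where "g = (\<lambda>i (y :: int \<Rightarrow> real). (if y 1 \<noteq> 0 then \<phi> i y else 0) - ak k i)"
      have g1: "g i \<in> borel_measurable (\<Pi>\<^sub>M n\<in>UNIV. borel)" for i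
        unfolding g_def using \<phi>(1) by measurable
      have g2: "\<bar>g i y\<bar> \<le> 2 ^ k + S" if "i \<in> {1..k}" for i y
      proof -
        have "\<bar>if y 1 \<noteq> 0 then \<phi> i y else 0\<bar> \<le> 2 ^ k" using \<phi>(3)[of y i] that by auto
        moreover have "\<bar>ak k i\<bar> \<le> S" unfolding S_def using that by (intro member_le_sum) auto
        ultimately show ?thesis unfolding g_def by linarith
      qed
      define e where "e = (\<lambda>\<omega> j. g j (\<lambda>n. Y n \<omega>))"
      have second_moment: "integrable M (\<lambda>\<omega>. (one_step_predictor k (e \<omega>) X \<omega>)\<^sup>2)"
        "integrable M (\<lambda>\<omega>. toeplitz_form \<sigma> {1..k} (e \<omega>))"
        "X.expectation (\<lambda>\<omega>. (one_step_predictor k (e \<omega>) X \<omega>)\<^sup>2) = X.expectation (\<lambda>\<omega>. toeplitz_form \<sigma> {1..k} (e \<omega>))"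
        unfolding e_def
        by (rule X.prediction_second_moment_independent_coefficients[OF indep X.X_measurable
          X.X_square_integrable X.covariance_eq g1 g2]; assumption)+
      have nz: "AE \<omega> in M. Y 1 \<omega> \<noteq> 0" using s0 by (intro G.AE_nonzero) simp
      have hat: "ahat T k i \<omega> - ak k i = e \<omega> i" if "\<omega> \<in> space M" "Y 1 \<omega> \<noteq> 0" "i \<in> {1..k}" for \<omega> i
      proof -
        have "yule_walker (empirical_covariance Y T \<omega>) k (\<lambda>i. \<phi> i (\<lambda>n. Y n \<omega>))"
          using \<phi>(2)[of "\<lambda>n. Y n \<omega>"] that(2) by (simp only: r_path not_False_eq_True)
        with empirical_covariance_positive_definite[where Y = Y, OF T1 that(2)] ahat[OF that(1)]
        have "ahat T k i \<omega> = \<phi> i (\<lambda>n. Y n \<omega>)"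
          using that(3) by (rule yule_walker_unique)
        then show ?thesis using that(2) by (simp add: e_def g_def)
      qed
      have sq: "AE \<omega> in M. sq_error T k \<omega> = (one_step_predictor k (e \<omega>) X \<omega>)\<^sup>2"
        using nz
      proof (rule AE_mp, intro AE_I2 impI)
        fix \<omega> assume w: "\<omega> \<in> space M" "Y 1 \<omega> \<noteq> 0"
        have "one_step_predictor k (\<lambda>j. ahat T k j \<omega> - ak k j) X \<omega> = one_step_predictor k (e \<omega>) X \<omega>"
          unfolding one_step_predictor_def using hat[OF w] by (intro sum.cong) auto
        then show "sq_error T k \<omega> = (one_step_predictor k (e \<omega>) X \<omega>)\<^sup>2"
          by (simp add: sq_error_def one_step_predictor_diff)
      qed
      have sqm: "sq_error T k \<in> borel_measurable M"
        unfolding sq_error_def one_step_predictor_def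
        by (intro borel_measurable_power borel_measurable_diff borel_measurable_sum borel_measurable_times
            borel_measurable_const X.X_measurable ahat_measurable) auto
      have int: "integrable M (sq_error T k)"
        by (rule integrable_cong_AE_imp[OF second_moment(1) sqm]) (use sq in auto)
      have "integral\<^sup>L M (sq_error T k) = X.expectation (\<lambda>\<omega>. (one_step_predictor k (e \<omega>) X \<omega>)\<^sup>2)"
        using sq sqm second_moment(1) by (intro integral_cong_AE) auto
      also have "\<dots> = X.expectation (\<lambda>\<omega>. toeplitz_form \<sigma> {1..k} (e \<omega>))"
        by (rule second_moment(3))
      also have "\<dots> \<le> X.expectation (\<lambda>\<omega>. 8 * B * P\<^sup>2 * (G.covariance_error T \<omega> 0)\<^sup>2 + c2 * (\<Sum>h\<le>H. diff T h \<omega>))"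
      proof (rule integral_mono_AE[OF second_moment(2)])
        show "integrable M (\<lambda>\<omega>. 8 * B * P\<^sup>2 * (G.covariance_error T \<omega> 0)\<^sup>2 + c2 * (\<Sum>h\<le>H. diff T h \<omega>))"
          unfolding diff_def using T T1 G.covariance_error_0_second_moment(1) G.covariance_error_difference_second_moment(1)
          by (intro Bochner_Integration.integrable_add integrable_mult_right Bochner_Integration.integrable_sum) auto
        show "AE \<omega> in M. toeplitz_form \<sigma> {1..k} (e \<omega>) \<le> 8 * B * P\<^sup>2 * (G.covariance_error T \<omega> 0)\<^sup>2 + c2 * (\<Sum>h\<le>H. diff T h \<omega>)"
          using nz
        proof (rule AE_mp, intro AE_I2 impI)
          fix \<omega> assume w: "\<omega> \<in> space M" "Y 1 \<omega> \<noteq> 0"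
          define Dl where "Dl = (\<Sum>h\<le>H. diff T h \<omega>)"
          have diff0: "diff T h \<omega> \<ge> 0" for h by (simp add: diff_def)
          have Dl0: "Dl \<ge> 0" unfolding Dl_def by (intro sum_nonneg diff0)
          show "toeplitz_form \<sigma> {1..k} (e \<omega>) \<le> 8 * B * P\<^sup>2 * (G.covariance_error T \<omega> 0)\<^sup>2 + c2 * (\<Sum>h\<le>H. diff T h \<omega>)"
          proof (cases "Dl \<le> \<delta>\<^sup>2")
            case True
            have close: "\<bar>G.covariance_error T \<omega> (int h) - G.covariance_error T \<omega> 0\<bar> \<le> \<delta>" if "h \<le> H" for h
            proof -
              have "diff T h \<omega> \<le> Dl" unfolding Dl_def using that diff0 by (intro member_le_sum) auto
              then have "(G.covariance_error T \<omega> (int h) - G.covariance_error T \<omega> 0)\<^sup>2 \<le> \<delta>\<^sup>2"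
                using True by (simp add: diff_def)
              then show ?thesis using delta(1) by (simp add: abs_le_square_iff[symmetric])
            qed
            have "toeplitz_form \<sigma> {1..k} (\<lambda>i. ahat T k i \<omega> - ak k i)
              \<le> 8 * B * (1 - (\<Sum>i=1..k. ak k i))\<^sup>2 * (empirical_covariance Y T \<omega> 0 - \<sigma> 0)\<^sup>2
              + 8 * real k * (1 + (\<Sum>i=1..k. \<bar>ak k i\<bar>))\<^sup>2 / \<mu>
                * (\<Sum>h\<le>H. (empirical_covariance Y T \<omega> (int h) - \<sigma> (int h) - (empirical_covariance Y T \<omega> 0 - \<sigma> 0))\<^sup>2)"
            proof (rule yule_walker_perturbation[OF H(1,2) sym empirical_covariance_sym mu mu_le B(1) B(2) _ H(3) less_imp_le[OF delta(1)] delta(2,3) ahat[OF w(1)] ak])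
              show "0 \<le> toeplitz_form (empirical_covariance Y T \<omega>) {1..H} (\<lambda>_. 1)"
                by (rule empirical_toeplitz_form_nonneg) simp
              show "\<bar>empirical_covariance Y T \<omega> (int h) - \<sigma> (int h) - (empirical_covariance Y T \<omega> 0 - \<sigma> 0)\<bar> \<le> \<delta>"
                if "h \<le> H" for h using close[OF that] by (simp add: G.covariance_error_def)
            qed simp
            also have "toeplitz_form \<sigma> {1..k} (\<lambda>i. ahat T k i \<omega> - ak k i) = toeplitz_form \<sigma> {1..k} (e \<omega>)"
              unfolding toeplitz_form_def using hat[OF w] by (intro sum.cong refl) auto
            also have "8 * B * (1 - (\<Sum>i=1..k. ak k i))\<^sup>2 * (empirical_covariance Y T \<omega> 0 - \<sigma> 0)\<^sup>2
                \<le> 8 * B * P\<^sup>2 * (G.covariance_error T \<omega> 0)\<^sup>2"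
            proof -
              have "\<bar>1 - (\<Sum>i=1..k. ak k i)\<bar>\<^sup>2 \<le> P\<^sup>2" using P[OF k] by (intro power_mono) auto
              then show ?thesis unfolding G.covariance_error_def using B(1) by (intro mult_right_mono mult_left_mono) auto
            qed
            also have "8 * real k * (1 + (\<Sum>i=1..k. \<bar>ak k i\<bar>))\<^sup>2 / \<mu>
                * (\<Sum>h\<le>H. (empirical_covariance Y T \<omega> (int h) - \<sigma> (int h) - (empirical_covariance Y T \<omega> 0 - \<sigma> 0))\<^sup>2)
                = 8 * real k * (1 + S)\<^sup>2 / \<mu> * Dl"
              by (simp add: S_def Dl_def diff_def G.covariance_error_def)
            also have "\<dots> \<le> c2 * Dl"
              using Dl0 E0 by (intro mult_right_mono) (auto simp: c2_def)
            finally show ?thesis by (simp add: Dl_def)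
          next
            case False
            have "toeplitz_form \<sigma> {1..k} (e \<omega>) \<le> E"
              using abs_toeplitz_form_le[of \<sigma> "\<sigma> 0" "{1..k}" "e \<omega>" "2 ^ k + S"] X.abs_autocovariance_le g2
              by (force simp: e_def E_def)
            also have "E \<le> E / \<delta>\<^sup>2 * Dl"
              using False E0 delta(1) mult_left_mono[of "\<delta>\<^sup>2" Dl E] by (simp add: pos_le_divide_eq)
            also have "\<dots> \<le> c2 * Dl"
              using Dl0 mu by (intro mult_right_mono) (auto simp: c2_def)
            also have "\<dots> \<le> 8 * B * P\<^sup>2 * (G.covariance_error T \<omega> 0)\<^sup>2 + c2 * Dl" using B by simp
            finally show ?thesis by (simp add: Dl_def)
          qed
        qed
      qed
      also have "\<dots> = 8 * B * P\<^sup>2 * X.expectation (\<lambda>\<omega>. (G.covariance_error T \<omega> 0)\<^sup>2) + c2 * (\<Sum>h\<le>H. X.expectation (diff T h))"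
      proof -
        have i: "integrable M (diff T h)" if "h \<le> H" for h
          unfolding diff_def using that T by (intro G.covariance_error_difference_second_moment(1)) simp
        have "X.expectation (\<lambda>\<omega>. \<Sum>h\<le>H. diff T h \<omega>) = (\<Sum>h\<le>H. X.expectation (diff T h))"
          using i by (intro Bochner_Integration.integral_sum) auto
        moreover have "integrable M (\<lambda>\<omega>. \<Sum>h\<le>H. diff T h \<omega>)" using i by (intro Bochner_Integration.integrable_sum) auto
        ultimately show ?thesis using G.covariance_error_0_second_moment(1)[OF T1] by simp
      qed
      also have "\<dots> \<le> 8 * B * P\<^sup>2 * (4 * R T) + c2 * (\<Sum>h\<le>H. \<eta> * R T)"
        using small G.covariance_error_0_second_moment(2)[OF T1] B c2 unfolding R_def
        by (intro add_mono mult_left_mono sum_mono) auto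
      also have "c2 * (\<Sum>h\<le>H. \<eta> * R T) = B * R T"
        using c2 by (simp add: \<eta>_def)
      also have "8 * B * P\<^sup>2 * (4 * R T) + B * R T = ((32 * P\<^sup>2 + 1) * C) * real k powr (1 - 2 * d) * R T"
        by (simp add: B_def algebra_simps)
      finally show ?thesis using int by blast
    qed
    show ?thesis
      using small_eventually eventually_gt_at_top[of H] by eventually_elim (rule bound)
  qed
  then show ?thesis unfolding R_def by blast
qed

theorem theorem3p4p2:
  fixes M :: "'a measure"
    and X Y \<epsilon>X \<epsilon>Y :: "int \<Rightarrow> 'a \<Rightarrow> real"
    and \<sigma> :: "int \<Rightarrow> real"
    and a b :: "nat \<Rightarrow> real"
    and s2 d lam delta :: real
    and f L :: "real \<Rightarrow> real"
    and ak :: "nat \<Rightarrow> nat \<Rightarrow> real"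
    and ahat :: "nat \<Rightarrow> nat \<Rightarrow> nat \<Rightarrow> 'a \<Rightarrow> real"
  assumes d: "1 / 4 \<le> d" "d < 1 / 2"
    and X: "long_memory_process M X \<epsilon>X \<sigma> a b s2 d"
    and Y: "long_memory_process M Y \<epsilon>Y \<sigma> a b s2 d"
    and independent:
      "prob_space.indep_var M (\<Pi>\<^sub>M n\<in>UNIV. borel) (\<lambda>\<omega> n. X n \<omega>) (\<Pi>\<^sub>M n\<in>UNIV. borel) (\<lambda>\<omega> n. Y n \<omega>)"
    and same_law:
      "distr M (\<Pi>\<^sub>M n\<in>UNIV. borel) (\<lambda>\<omega> n. X n \<omega>) = distr M (\<Pi>\<^sub>M n\<in>UNIV. borel) (\<lambda>\<omega> n. Y n \<omega>)"
    and gaussian: "gaussian_process M X" "gaussian_process M Y"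
    and lam: "lam > 0" "(\<lambda>j. \<sigma> (int j)) \<sim>[at_top] (\<lambda>j. lam * real j powr (2 * d - 1))"
    and delta: "delta > 0" "b \<sim>[at_top] (\<lambda>j. delta * real j powr (d - 1))"
    and fourth_moment:
      "\<And>n. integrable M (\<lambda>\<omega>. (\<epsilon>X n \<omega>) ^ 4)" "\<And>n. integrable M (\<lambda>\<omega>. (\<epsilon>Y n \<omega>) ^ 4)"
    and f: "spectral_density \<sigma> f"
      "\<And>x. x \<in> {-pi..pi} - {0} \<Longrightarrow> f x = spectral_density_fd d x * L x"
    and L: "\<And>x. x \<in> {-pi..pi} \<Longrightarrow> L x > 0"
      "set_integrable lebesgue {-pi..pi} L"
      "isCont L 0"
      "\<exists>m>0. \<forall>x\<in>{-pi..pi}. m \<le> L x"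
    and ak: "\<And>k. yule_walker \<sigma> k (ak k)"
    and ahat_measurable: "\<And>T k i. i \<in> {1..k} \<Longrightarrow> ahat T k i \<in> borel_measurable M"
    and ahat: "\<And>T k \<omega>. \<omega> \<in> space M \<Longrightarrow>
      yule_walker (empirical_covariance Y T \<omega>) k (\<lambda>i. ahat T k i \<omega>)"
  defines "sq_error \<equiv> (\<lambda>T k \<omega>.
    (one_step_predictor k (\<lambda>j. ahat T k j \<omega>) X \<omega> - one_step_predictor k (ak k) X \<omega>)\<^sup>2)"
  shows "(\<forall>\<^sub>F k in sequentially. \<forall>\<^sub>F T in sequentially. integrable M (sq_error T k)) \<and>
    (d = 1 / 4 \<longrightarrow>
      iterated_bigo (\<lambda>T k. integral\<^sup>L M (sq_error T k))
                    (\<lambda>T k. ln (real T) * sqrt (real k) / real T)) \<and>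
    (1 / 4 < d \<longrightarrow>
      iterated_bigo (\<lambda>T k. integral\<^sup>L M (sq_error T k))
                    (\<lambda>T k. real k powr (1 - 2 * d) / real T powr (2 - 4 * d)))"
proof -
  obtain m where m: "m > 0" "\<And>x. x \<in> {-pi..pi} \<Longrightarrow> m \<le> L x" using L(4) by blast
  have d0: "0 < d" using d by simp
  have lb: "m / (2 * pi) * \<bar>x\<bar> powr (- 2 * d) \<le> f x" if x: "x \<in> {-pi..pi} - {0}" for x
    using spectral_density_lower_bound[OF d0 m(1) x m(2)] x f(2)[OF x] by simp
  have c: "m / (2 * pi) > 0" using m(1) by simp
  define R where "R = (\<lambda>T. (\<Sum>s<T. (\<sigma> (int s))\<^sup>2) / real T)"
  obtain K where K: "\<And>k. k \<ge> 1 \<Longrightarrow> \<forall>\<^sub>F T in sequentially. integrable M (sq_error T k) \<and>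
      integral\<^sup>L M (sq_error T k) \<le> K * real k powr (1 - 2 * d) * R T"
    using expected_prediction_error_bound[OF d X Y independent gaussian(2) lam f(1) c lb ak ahat_measurable ahat]
    unfolding sq_error_def R_def by blast
  have R0: "R T \<ge> 0" for T unfolding R_def by (intro divide_nonneg_nonneg sum_nonneg) auto
  have bigo: "iterated_bigo (\<lambda>T k. integral\<^sup>L M (sq_error T k)) (\<lambda>T k. real k powr (1 - 2 * d) * \<rho> T)"
    if rate: "\<exists>K'. \<forall>\<^sub>F T in sequentially. R T \<le> K' * \<rho> T" for \<rho>
  proof -
    obtain K' where K': "\<forall>\<^sub>F T in sequentially. R T \<le> K' * \<rho> T" using rate by blast
    have "\<forall>\<^sub>F T in sequentially. \<bar>integral\<^sup>L M (sq_error T k)\<bar> \<le> \<bar>K\<bar> * \<bar>K'\<bar> * \<bar>real k powr (1 - 2 * d) * \<rho> T\<bar>"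
      if k: "k \<ge> 1" for k
      using K[OF k] K'
    proof eventually_elim
      case (elim T)
      have "\<bar>integral\<^sup>L M (sq_error T k)\<bar> = integral\<^sup>L M (sq_error T k)"
        unfolding sq_error_def by (intro abs_of_nonneg integral_nonneg) simp
      also have "\<dots> \<le> K * (real k powr (1 - 2 * d) * R T)" using elim by simp
      also have "\<dots> \<le> \<bar>K\<bar> * (real k powr (1 - 2 * d) * R T)"
        using R0 by (intro mult_right_mono mult_nonneg_nonneg) auto
      also have "\<dots> \<le> \<bar>K\<bar> * (real k powr (1 - 2 * d) * \<bar>K' * \<rho> T\<bar>)"
        using elim(2) by (intro mult_left_mono) auto
      also have "\<dots> = \<bar>K\<bar> * \<bar>K'\<bar> * \<bar>real k powr (1 - 2 * d) * \<rho> T\<bar>" by (simp add: abs_mult)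
      finally show ?case .
    qed
    then have "\<forall>\<^sub>F k in sequentially. \<forall>\<^sub>F T in sequentially.
        \<bar>integral\<^sup>L M (sq_error T k)\<bar> \<le> \<bar>K\<bar> * \<bar>K'\<bar> * \<bar>real k powr (1 - 2 * d) * \<rho> T\<bar>"
      by (rule eventually_mono[OF eventually_ge_at_top[of "1::nat"]])
    then show ?thesis unfolding iterated_bigo_def by (rule exI)
  qed
  show ?thesis
  proof (intro conjI impI)
    show "\<forall>\<^sub>F k in sequentially. \<forall>\<^sub>F T in sequentially. integrable M (sq_error T k)"
    proof (rule eventually_mono[OF eventually_ge_at_top[of "1::nat"]])
      fix k :: nat assume "1 \<le> k"
      from K[OF this] show "\<forall>\<^sub>F T in sequentially. integrable M (sq_error T k)"
        by (rule eventually_mono) simp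
    qed
    show "iterated_bigo (\<lambda>T k. integral\<^sup>L M (sq_error T k)) (\<lambda>T k. ln (real T) * sqrt (real k) / real T)"
      if d': "d = 1 / 4"
    proof -
      have "(\<lambda>T k. ln (real T) * sqrt (real k) / real T) = (\<lambda>T k. real k powr (1 - 2 * d) * (ln (real T) / real T))"
        by (simp add: d' powr_half_sqrt mult_ac)
      moreover have "\<exists>K'. \<forall>\<^sub>F T in sequentially. R T \<le> K' * (ln (real T) / real T)"
        unfolding R_def by (rule mean_squared_autocovariance_rate(1)[OF d lam(2) d'])
      then have "iterated_bigo (\<lambda>T k. integral\<^sup>L M (sq_error T k)) (\<lambda>T k. real k powr (1 - 2 * d) * (ln (real T) / real T))"
        by (rule bigo)
      ultimately show ?thesis by (simp only:)
    qed
    show "iterated_bigo (\<lambda>T k. integral\<^sup>L M (sq_error T k)) (\<lambda>T k. real k powr (1 - 2 * d) / real T powr (2 - 4 * d))"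
      if d': "1 / 4 < d"
    proof -
      have "\<exists>K'. \<forall>\<^sub>F T in sequentially. R T \<le> K' * (1 / real T powr (2 - 4 * d))"
        unfolding R_def by (rule mean_squared_autocovariance_rate(2)[OF d lam(2) d'])
      from bigo[OF this] show ?thesis by simp
    qed
  qed
qed

end
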